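(* Let $\alpha$ be a Gaussian quantum cellular automaton on $\mathcal A_{\mathrm{loc}}$ whose phase-space map $\Phi$ is regular and locally hyperbolic, and let $\omega$ be a locally normal state on $\mathcal A_{\mathrm{loc}}$ with finite particle density. Then, for every nonzero $\xi\in V$, $$\lim_{k\to\infty}\omega\bigl(\alpha^k(W(\xi))\bigr)=0 .$$ Equivalently, for every finite linear combination $A=\sum_{\xi}c_\xi W(\xi)\in\mathcal A_{\mathrm{loc}}$ (with $c_\xi\in\mathbb C$), $$\lim_{k\to\infty}\omega\bigl(\alpha^k(A)\bigr)=c_0=\omega_\infty(A).$$
   Context: **System.** Fix $d\ge 1$, $\Lambda=\mathbb Z^d$. $V=c_{00}(\Lambda,\mathbb R^2)$ is the space of finitely supported functions $\xi=(u,v):\Lambda\to\mathbb R^2$, with $\|\xi\|_2^2=\sum_x\|\xi(x)\|_{\mathbb R^2}^2$ and symplectic form $\sigma(\xi_1,\xi_2)=\sum_{x}\bigl(u_1(x)v_2(x)-u_2(x)v_1(x)\bigr)$. $\mathcal A_{\mathrm{loc}}$ is the complex unital $*$-algebra with linear basis the symbols $W(\xi)$, $\xi\in V$, and relations $W(\xi_1)W(\xi_2)=e^{\frac i2\sigma(\xi_1,\xi_2)}W(\xi_1+\xi_2)$, $W(\xi)^*=W(-\xi)$, $1=W(0)$. For finite $\Gamma\subset\Lambda$, $\mathcal A_\Gamma$ is the span of the $W(\xi)$ with $\operatorname{supp}\xi\subset\Gamma$. It is represented on $\mathcal H_\Gamma=\bigotimes_{x\in\Gamma}L^2(\mathbb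 R)=L^2(\mathbb R^\Gamma)$ by the Schrödinger representation $[\pi_\Gamma(W(u,v))f](q)=e^{i\sum_{x\in\Gamma}v(x)(q_x+u(x)/2)}f(q+u)$. **States.** A state on $\mathcal A_{\mathrm{loc}}$ is a linear functional $\omega$ with $\omega(1)=1$, $\omega(a^*a)\ge0$. It is locally normal if for each finite $\Gamma$ there is a density operator (positive trace-class, trace one) $\rho_\Gamma$ on $\mathcal H_\Gamma$ with $\omega(a)=\operatorname{Tr}(\rho_\Gamma\pi_\Gamma(a))$ for all $a\in\mathcal A_\Gamma$. Let $\hat q_x$ be multiplication by $q_x$, $\hat p_x=-i\partial_{q_x}$, $a_x=(\hat q_x+i\hat p_x)/\sqrt2$, and $N_\Gamma=\sum_{x\in\Gamma}a_x^*a_x$ (positive self-adjoint number operator on $\mathcal H_\Gamma$). Put $\omega(N_\Gamma):=\sup_n\operatorname{Tr}(N_\Gamma\mathbf 1_{[0,n]}(N_\Gamma)\rho_\Gamma)\in[0,\infty]$. A locally normal $\omega$ has finite particle density if there is $\nu<\infty$ with $\omega(N_\Gamma)\le\nu|\Gamma|$ for every finite $\Gamma\subset\Lambda$. $\omega_\infty$ is the state with $\omega_\infty(1)=1$ and $\omega_\infty(W(\xi))=0$ for $\xi\ne0$. **Gaussian QCA.** A Gaussian quantum cellular automaton is a $*$-automorphism $\alpha$ of $\mathcal A_{\mathrm{loc}}$ of the form $\alpha(W(\xi))=e^{i\chi(\xi)}W(\Phi\xi)$, where $\chi:V\to\mathbb R/2\pi\mathbb Z$ is a character (additive homomorphism)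 and $\Phi:V\to V$ is a real-linear bijection (the phase-space map) such that: there is a finite $S\subset\Lambda$ with $\operatorname{supp}(\Phi^{\pm1}\xi)\subset\operatorname{supp}\xi+S$ for all $\xi$; and $\Phi T_y=T_y\Phi$ for all $y\in\Lambda$, where $(T_y\xi)(x)=\xi(x-y)$. The Weyl relations force $\Phi$ to preserve $\sigma$. Then $(\Phi\xi)(x)=\sum_{y\in F}\Phi_y\xi(x-y)$ for a finite $F\subset\Lambda$ and $\Phi_y\in\operatorname{Mat}_2(\mathbb R)$. Its symbol is $A(\theta)=\sum_{y\in F}\Phi_ye^{iy\cdot\theta}$, $\theta\in\mathbb T^d=(\mathbb R/2\pi\mathbb Z)^d$. **Local hyperbolicity and regularity.** $\Phi$ is locally hyperbolic if there exist $\theta_0\in\mathbb T^d$ and $\delta>0$ such that no eigenvalue $\zeta$ of $A(\theta_0)$ satisfies $e^{-\delta}<|\zeta|<e^{\delta}$. $\Phi$ is regular if there do not exist $0\ne\xi\in V$, $c\in\mathbb R\setminus\{0\}$ and $x\in\Lambda$ with $\Phi\xi=c\,T_x\xi$. *)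

theory Defs
  imports "HOL-Analysis.Analysis" "HOL-Library.Poly_Mapping" "HOL-Library.Real_Mod"
begin

section \<open>Phase space\<close>

type_synonym 'd lattice = "(int, 'd) vec"

type_synonym 'd phase = "'d lattice \<Rightarrow>\<^sub>0 (real, 2) vec"

abbreviation supp :: "('a \<Rightarrow>\<^sub>0 'b::zero) \<Rightarrow> 'a set"
  where "supp \<equiv> Poly_Mapping.keys"

abbreviation val :: "('a \<Rightarrow>\<^sub>0 'b::zero) \<Rightarrow> 'a \<Rightarrow> 'b"
  where "val \<equiv> Poly_Mapping.lookup"

instantiation poly_mapping :: (type, real_vector) real_vector
begin

lift_definition scaleR_poly_mapping :: "real \<Rightarrow> ('a \<Rightarrow>\<^sub>0 'b) \<Rightarrow> ('a \<Rightarrow>\<^sub>0 'b)"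
  is "\<lambda>c f x. c *\<^sub>R f x"
  by (rule finite_subset) auto

instance
  by standard (transfer, simp add: scaleR_add_left scaleR_add_right fun_eq_iff)+

end

lemma lookup_scaleR [simp]: "val (c *\<^sub>R p) x = c *\<^sub>R val p x"
  by transfer simp

lemma poly_mapping_sum_single:
  assumes "finite K" "supp p \<subseteq> K"
  shows "p = (\<Sum>k\<in>K. Poly_Mapping.single k (val p k))"
  using assms
  by (intro poly_mapping_eqI)
     (auto simp: lookup_sum lookup_single when_def in_keys_iff)

definition sympl :: "'d::finite phase \<Rightarrow> 'd phase \<Rightarrow> real" where
  "sympl \<xi> \<eta> = (\<Sum>x\<in>supp \<xi> \<union> supp \<eta>. val \<xi> x $ 1 * val \<eta> x $ 2 - val \<eta> x $ 1 * val \<xi> x $ 2)"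

lemma sympl_superset:
  assumes "finite K" "supp \<xi> \<union> supp \<eta> \<subseteq> K"
  shows "sympl \<xi> \<eta> = (\<Sum>x\<in>K. val \<xi> x $ 1 * val \<eta> x $ 2 - val \<eta> x $ 1 * val \<xi> x $ 2)"
  unfolding sympl_def using assms
  by (intro sum.mono_neutral_left) (auto simp: in_keys_iff)

lemma sympl_add_left: "sympl (\<xi> + \<xi>') \<eta> = sympl \<xi> \<eta> + sympl \<xi>' \<eta>"
proof -
  let ?K = "supp \<xi> \<union> supp \<xi>' \<union> supp \<eta>"
  have "supp (\<xi> + \<xi>') \<union> supp \<eta> \<subseteq> ?K" using keys_add[of \<xi> \<xi>'] by auto
  then show ?thesis
    using sympl_superset[of ?K "\<xi> + \<xi>'" \<eta>] sympl_superset[of ?K \<xi> \<eta>] sympl_superset[of ?K \<xi>' \<eta>]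
    by (simp add: le_supI1 le_supI2 Un_assoc lookup_add algebra_simps sum.distrib sum_subtractf)
qed

lemma sympl_swap: "sympl \<eta> \<xi> = - sympl \<xi> \<eta>"
  by (simp add: sympl_def Un_commute sum_negf[symmetric] del: sum_negf)

lemma sympl_add_right: "sympl \<eta> (\<xi> + \<xi>') = sympl \<eta> \<xi> + sympl \<eta> \<xi>'"
  by (simp add: sympl_swap[of \<eta>] sympl_add_left)

lemma sympl_zero [simp]: "sympl 0 \<xi> = 0" "sympl \<xi> 0 = 0"
  by (simp_all add: sympl_def)

lemma sympl_self [simp]: "sympl \<xi> \<xi> = 0"
  using sympl_swap[of \<xi> \<xi>] by simp

lemma sympl_minus [simp]: "sympl (- \<xi>) \<eta> = - sympl \<xi> \<eta>" "sympl \<eta> (- \<xi>) = - sympl \<eta> \<xi>"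
  using sympl_add_left[of \<xi> "- \<xi>" \<eta>] sympl_add_right[of \<eta> \<xi> "- \<xi>"] by simp_all


section \<open>The Weyl algebra\<close>

text \<open>An element is stored as its family of coefficients in the basis of the \<open>W(\<xi>)\<close>.
  A separate type is needed because the multiplication that \<open>Poly_Mapping\<close> provides is the
  untwisted one. The lifting setup of \<open>poly_mapping\<close> is dropped so that definitions on the new
  type lift through one type copy only.\<close>

typedef (overloaded) 'd weyl = "UNIV :: ('d::finite phase \<Rightarrow>\<^sub>0 complex) set"
  morphisms weyl_coeffs Abs_weyl by simp

lifting_forget poly_mapping.lifting
setup_lifting type_definition_weyl

abbreviation coeff_at :: "'d::finite weyl \<Rightarrow> 'd phase \<Rightarrow> complex"
  where "coeff_at a \<equiv> val (weyl_coeffs a)"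

lift_definition W :: "'d::finite phase \<Rightarrow> 'd weyl" is "\<lambda>\<xi>. Poly_Mapping.single \<xi> 1" .

lift_definition cscale :: "complex \<Rightarrow> 'd::finite weyl \<Rightarrow> 'd weyl" (infixr \<open>*\<^sub>C\<close> 75)
  is "\<lambda>c. Poly_Mapping.map ((*) c)" .

definition twisted :: "('d::finite phase \<Rightarrow>\<^sub>0 complex) \<Rightarrow> ('d phase \<Rightarrow>\<^sub>0 complex) \<Rightarrow> ('d phase \<Rightarrow>\<^sub>0 complex)" where
  "twisted p q = (\<Sum>\<xi>\<in>supp p. \<Sum>\<eta>\<in>supp q.
     Poly_Mapping.single (\<xi> + \<eta>) (val p \<xi> * val q \<eta> * exp (\<i> / 2 * sympl \<xi> \<eta>)))"

lemma twisted_superset: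
  assumes "finite K" "supp p \<subseteq> K" "finite L" "supp q \<subseteq> L"
  shows "twisted p q = (\<Sum>\<xi>\<in>K. \<Sum>\<eta>\<in>L.
     Poly_Mapping.single (\<xi> + \<eta>) (val p \<xi> * val q \<eta> * exp (\<i> / 2 * sympl \<xi> \<eta>)))"
proof -
  have "twisted p q = (\<Sum>\<xi>\<in>supp p. \<Sum>\<eta>\<in>L.
     Poly_Mapping.single (\<xi> + \<eta>) (val p \<xi> * val q \<eta> * exp (\<i> / 2 * sympl \<xi> \<eta>)))"
    unfolding twisted_def using assms
    by (intro sum.cong refl sum.mono_neutral_left) (auto simp: in_keys_iff)
  also have "\<dots> = (\<Sum>\<xi>\<in>K. \<Sum>\<eta>\<in>L.
     Poly_Mapping.single (\<xi> + \<eta>) (val p \<xi> * val q \<eta> * exp (\<i> / 2 * sympl \<xi> \<eta>)))"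
    using assms by (intro sum.mono_neutral_left) (auto simp: in_keys_iff)
  finally show ?thesis .
qed

lemma twisted_add_left: "twisted (p + p') q = twisted p q + twisted p' q"
proof -
  let ?K = "supp p \<union> supp p'"
  have "supp (p + p') \<subseteq> ?K" by (rule keys_add)
  then show ?thesis
    by (simp add: twisted_superset[of ?K _ "supp q"] lookup_add distrib_right single_add sum.distrib)
qed

lemma twisted_add_right: "twisted q (p + p') = twisted q p + twisted q p'"
proof -
  let ?K = "supp p \<union> supp p'"
  have "supp (p + p') \<subseteq> ?K" by (rule keys_add)
  then show ?thesis
    by (simp add: twisted_superset[of "supp q" _ ?K] lookup_add distrib_left distrib_right single_add sum.distrib)
qed

lemma twisted_zero [simp]: "twisted 0 q = 0" "twisted q 0 = 0"
  by (simp_all add: twisted_def)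

lemma twisted_sum_left: "twisted (\<Sum>i\<in>I. f i) q = (\<Sum>i\<in>I. twisted (f i) q)"
  by (induction I rule: infinite_finite_induct) (simp_all add: twisted_add_left)

lemma twisted_sum_right: "twisted q (\<Sum>i\<in>I. f i) = (\<Sum>i\<in>I. twisted q (f i))"
  by (induction I rule: infinite_finite_induct) (simp_all add: twisted_add_right)

lemma twisted_single:
  "twisted (Poly_Mapping.single \<xi> a) (Poly_Mapping.single \<eta> b)
     = Poly_Mapping.single (\<xi> + \<eta>) (a * b * exp (\<i> / 2 * sympl \<xi> \<eta>))"
  by (subst twisted_superset[of "{\<xi>}" _ "{\<eta>}"]) auto

lemma twisted_assoc: "twisted (twisted p q) r = twisted p (twisted q r)"
proof -
  have *: "twisted (twisted (Poly_Mapping.single \<xi> a) (Poly_Mapping.single \<eta> b)) (Poly_Mapping.single \<zeta> c)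
      = twisted (Poly_Mapping.single \<xi> a) (twisted (Poly_Mapping.single \<eta> b) (Poly_Mapping.single \<zeta> c))"
    for \<xi> \<eta> \<zeta> :: "'a phase" and a b c
    by (simp add: twisted_single sympl_add_left sympl_add_right add.assoc distrib_left exp_add mult_ac)
  let ?s = "\<lambda>p. \<Sum>k\<in>supp p. Poly_Mapping.single k (val p k)"
  have "twisted (twisted (?s p) (?s q)) (?s r) = twisted (?s p) (twisted (?s q) (?s r))"
    by (simp only: twisted_sum_left twisted_sum_right *)
  then show ?thesis
    by (simp only: poly_mapping_sum_single[OF finite_keys order_refl, symmetric])
qed

lemma twisted_one:
  "twisted (Poly_Mapping.single 0 1) p = p" "twisted p (Poly_Mapping.single 0 1) = p"
proof -
  let ?s = "\<Sum>k\<in>supp p. Poly_Mapping.single k (val p k)"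
  have "twisted (Poly_Mapping.single 0 1) ?s = ?s" "twisted ?s (Poly_Mapping.single 0 1) = ?s"
    by (simp_all add: twisted_sum_left twisted_sum_right twisted_single del: single_one)
  then show "twisted (Poly_Mapping.single 0 1) p = p" "twisted p (Poly_Mapping.single 0 1) = p"
    by (simp_all only: poly_mapping_sum_single[OF finite_keys order_refl, symmetric])
qed

instantiation weyl :: (finite) ring_1
begin

lift_definition zero_weyl :: "'a weyl" is 0 .
lift_definition one_weyl :: "'a weyl" is "Poly_Mapping.single 0 1" .
lift_definition plus_weyl :: "'a weyl \<Rightarrow> 'a weyl \<Rightarrow> 'a weyl" is "(+)" .
lift_definition minus_weyl :: "'a weyl \<Rightarrow> 'a weyl \<Rightarrow> 'a weyl" is "(-)" .
lift_definition uminus_weyl :: "'a weyl \<Rightarrow> 'a weyl" is uminus .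
lift_definition times_weyl :: "'a weyl \<Rightarrow> 'a weyl \<Rightarrow> 'a weyl" is twisted .

instance
proof
  fix a b c :: "'a weyl"
  show "a + b + c = a + (b + c)" by transfer (rule add.assoc)
  show "a + b = b + a" by transfer (rule add.commute)
  show "0 + a = a" by transfer simp
  show "- a + a = 0" by transfer simp
  show "a - b = a + - b" by transfer simp
  show "a * b * c = a * (b * c)" by transfer (rule twisted_assoc)
  show "1 * a = a" "a * 1 = a" by (transfer, rule twisted_one)+
  show "(a + b) * c = a * c + b * c" by transfer (rule twisted_add_left)
  show "a * (b + c) = a * b + a * c" by transfer (rule twisted_add_right)
  show "(0::'a weyl) \<noteq> 1"
    by (simp add: weyl_coeffs_inject[symmetric] zero_weyl.rep_eq one_weyl.rep_eq)
qed

end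

lift_definition star :: "'d::finite weyl \<Rightarrow> 'd weyl"
  is "\<lambda>p. \<Sum>\<xi>\<in>supp p. Poly_Mapping.single (- \<xi>) (cnj (val p \<xi>))" .

lemma W_mult: "W \<xi> * W \<eta> = exp (\<i> / 2 * sympl \<xi> \<eta>) *\<^sub>C W (\<xi> + \<eta>)"
  by (simp add: weyl_coeffs_inject[symmetric] W.rep_eq times_weyl.rep_eq cscale.rep_eq twisted_single)

lemma star_W: "star (W \<xi>) = W (- \<xi>)"
  by (simp add: weyl_coeffs_inject[symmetric] W.rep_eq star.rep_eq)

lemma W_zero: "W 0 = 1"
  by (simp add: weyl_coeffs_inject[symmetric] W.rep_eq one_weyl.rep_eq)

lemma coeff_at_W: "coeff_at (W \<xi>) \<eta> = (if \<xi> = \<eta> then 1 else 0)"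
  by transfer (simp add: lookup_single when_def)

lemma coeff_at_add [simp]: "coeff_at (a + b) \<xi> = coeff_at a \<xi> + coeff_at b \<xi>"
  by transfer (simp add: lookup_add)

lemma coeff_at_zero [simp]: "coeff_at 0 \<xi> = 0"
  by transfer simp

lemma coeff_at_sum: "coeff_at (\<Sum>i\<in>I. f i) \<xi> = (\<Sum>i\<in>I. coeff_at (f i) \<xi>)"
  by (induction I rule: infinite_finite_induct) simp_all

lemma coeff_at_cscale [simp]: "coeff_at (c *\<^sub>C a) \<xi> = c * coeff_at a \<xi>"
  by transfer (simp add: Poly_Mapping.map.rep_eq when_def)

lemma weyl_eqI: "(\<And>\<xi>. coeff_at a \<xi> = coeff_at b \<xi>) \<Longrightarrow> a = b"
  by (metis weyl_coeffs_inject poly_mapping_eqI)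

lemma weyl_expansion: "a = (\<Sum>\<xi>\<in>supp (weyl_coeffs a). coeff_at a \<xi> *\<^sub>C W \<xi>)"
proof (rule weyl_eqI)
  fix \<eta>
  have "(\<Sum>\<xi>\<in>supp (weyl_coeffs a). coeff_at a \<xi> * (if \<xi> = \<eta> then 1 else 0))
      = (\<Sum>\<xi>\<in>supp (weyl_coeffs a). if \<xi> = \<eta> then coeff_at a \<xi> else 0)"
    by (intro sum.cong) auto
  also have "\<dots> = coeff_at a \<eta>"
    by (simp add: in_keys_iff)
  finally show "coeff_at a \<eta> = coeff_at (\<Sum>\<xi>\<in>supp (weyl_coeffs a). coeff_at a \<xi> *\<^sub>C W \<xi>) \<eta>"
    by (simp only: coeff_at_sum coeff_at_W coeff_at_cscale)
qed

interpretation weyl: vector_space "cscale :: complex \<Rightarrow> 'd::finite weyl \<Rightarrow> 'd weyl"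
proof
  fix a b :: complex and x y :: "'d weyl"
  show "a *\<^sub>C (x + y) = a *\<^sub>C x + a *\<^sub>C y"
    by (rule weyl_eqI) (simp add: algebra_simps)
  show "(a + b) *\<^sub>C x = a *\<^sub>C x + b *\<^sub>C x"
    by (rule weyl_eqI) (simp add: algebra_simps)
  show "a *\<^sub>C b *\<^sub>C x = (a * b) *\<^sub>C x"
    by (rule weyl_eqI) (simp add: algebra_simps)
  show "1 *\<^sub>C x = x"
    by (rule weyl_eqI) simp
qed

lemma coeff_at_mult:
  assumes "finite K" "supp (weyl_coeffs a) \<subseteq> K" "finite L" "supp (weyl_coeffs b) \<subseteq> L"
  shows "coeff_at (a * b) \<zeta> = (\<Sum>\<xi>\<in>K. \<Sum>\<eta>\<in>L.
     if \<xi> + \<eta> = \<zeta> then coeff_at a \<xi> * coeff_at b \<eta> * exp (\<i> / 2 * sympl \<xi> \<eta>) else 0)"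
  by (auto simp: times_weyl.rep_eq twisted_superset[OF assms] lookup_sum lookup_single intro!: sum.cong)

lemma cscale_mult_left: "(c *\<^sub>C a) * b = c *\<^sub>C (a * b)"
proof (rule weyl_eqI)
  fix \<zeta>
  have "supp (weyl_coeffs (c *\<^sub>C a)) \<subseteq> supp (weyl_coeffs a)"
    by (auto simp: in_keys_iff)
  then show "coeff_at ((c *\<^sub>C a) * b) \<zeta> = coeff_at (c *\<^sub>C (a * b)) \<zeta>"
    by (auto simp: coeff_at_mult[of "supp (weyl_coeffs a)" _ "supp (weyl_coeffs b)"]
        sum_distrib_left intro!: sum.cong)
qed

lemma cscale_mult_right: "a * (c *\<^sub>C b) = c *\<^sub>C (a * b)"
proof (rule weyl_eqI)
  fix \<zeta>
  have "supp (weyl_coeffs (c *\<^sub>C b)) \<subseteq> supp (weyl_coeffs b)"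
    by (auto simp: in_keys_iff)
  then show "coeff_at (a * (c *\<^sub>C b)) \<zeta> = coeff_at (c *\<^sub>C (a * b)) \<zeta>"
    by (auto simp: coeff_at_mult[of "supp (weyl_coeffs a)" _ "supp (weyl_coeffs b)"]
        sum_distrib_left intro!: sum.cong)
qed

lemma coeff_at_star [simp]: "coeff_at (star a) \<eta> = cnj (coeff_at a (- \<eta>))"
proof -
  have "coeff_at (star a) \<eta> = (\<Sum>\<xi>\<in>supp (weyl_coeffs a). if - \<xi> = \<eta> then cnj (coeff_at a \<xi>) else 0)"
    by (simp add: star.rep_eq lookup_sum lookup_single when_def)
  also have "\<dots> = (\<Sum>\<xi>\<in>supp (weyl_coeffs a). if \<xi> = - \<eta> then cnj (coeff_at a \<xi>) else 0)"
    by (intro sum.cong) auto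
  also have "\<dots> = cnj (coeff_at a (- \<eta>))"
    by (simp add: in_keys_iff)
  finally show ?thesis .
qed

lemma star_add: "star (a + b) = star a + star b"
  by (rule weyl_eqI) simp

lemma star_cscale: "star (c *\<^sub>C a) = cnj c *\<^sub>C star a"
  by (rule weyl_eqI) simp

lemma star_star: "star (star a) = a"
  by (rule weyl_eqI) simp

lemma supp_star: "supp (weyl_coeffs (star a)) = uminus ` supp (weyl_coeffs a)"
proof -
  have "\<eta> \<in> uminus ` supp (weyl_coeffs a)" if "coeff_at a (- \<eta>) \<noteq> 0" for \<eta>
    using that by (intro image_eqI[of _ _ "- \<eta>"]) (auto simp: in_keys_iff)
  then show ?thesis by (auto simp: in_keys_iff)
qed

lemma star_mult: "star (a * b) = star b * star a"
proof (rule weyl_eqI)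
  fix \<zeta>
  let ?K = "supp (weyl_coeffs a)" and ?L = "supp (weyl_coeffs b)"
  have eq: "- \<eta> + - \<xi> = \<zeta> \<longleftrightarrow> \<xi> + \<eta> = - \<zeta>" for \<xi> \<eta> :: "'a phase"
    by (metis add.inverse_inverse minus_add)
  have ex: "cnj (exp (\<i> / 2 * sympl \<xi> \<eta>)) = exp (\<i> / 2 * sympl \<eta> \<xi>)" for \<xi> \<eta> :: "'a phase"
    by (simp add: exp_cnj sympl_swap[of \<eta> \<xi>])
  have "coeff_at (star b * star a) \<zeta> = (\<Sum>\<eta>\<in>?L. \<Sum>\<xi>\<in>?K. if - \<eta> + - \<xi> = \<zeta>
      then cnj (coeff_at b \<eta>) * cnj (coeff_at a \<xi>) * exp (\<i> / 2 * sympl \<eta> \<xi>) else 0)"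
    by (subst coeff_at_mult[OF _ order_refl _ order_refl])
       (auto simp: supp_star sum.reindex inj_on_def intro!: sum.cong)
  also have "\<dots> = (\<Sum>\<xi>\<in>?K. \<Sum>\<eta>\<in>?L. if \<xi> + \<eta> = - \<zeta>
      then cnj (coeff_at a \<xi> * coeff_at b \<eta> * exp (\<i> / 2 * sympl \<xi> \<eta>)) else 0)"
    unfolding eq complex_cnj_mult ex by (subst sum.swap) (auto intro!: sum.cong)
  also have "\<dots> = coeff_at (star (a * b)) \<zeta>"
    by (auto simp: coeff_at_mult[OF _ order_refl _ order_refl] intro!: sum.cong)
  finally show "coeff_at (star (a * b)) \<zeta> = coeff_at (star b * star a) \<zeta>" by simp
qed

lemma coeff_at_star_mult_self:
  "coeff_at (star a * a) 0 = of_real (\<Sum>\<xi>\<in>supp (weyl_coeffs a). (cmod (coeff_at a \<xi>))\<^sup>2)"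
proof -
  let ?K = "supp (weyl_coeffs a)"
  have "coeff_at (star a * a) 0 = (\<Sum>\<xi>\<in>?K. \<Sum>\<eta>\<in>?K. if - \<xi> + \<eta> = 0
      then cnj (coeff_at a \<xi>) * coeff_at a \<eta> * exp (\<i> / 2 * sympl (- \<xi>) \<eta>) else 0)"
    by (subst coeff_at_mult[OF _ order_refl _ order_refl])
       (auto simp: supp_star sum.reindex inj_on_def intro!: sum.cong)
  also have "\<dots> = (\<Sum>\<xi>\<in>?K. \<Sum>\<eta>\<in>?K. if \<xi> = \<eta> then cnj (coeff_at a \<xi>) * coeff_at a \<xi> else 0)"
    by (intro sum.cong) auto
  also have "\<dots> = of_real (\<Sum>\<xi>\<in>?K. (cmod (coeff_at a \<xi>))\<^sup>2)"
    unfolding of_real_sum by (intro sum.cong) (auto simp: complex_norm_square mult.commute simp del: of_real_power)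
  finally show ?thesis .
qed


section \<open>States\<close>

definition state :: "('d::finite weyl \<Rightarrow> complex) \<Rightarrow> bool" where
  "state \<omega> \<longleftrightarrow> Vector_Spaces.linear cscale (*) \<omega> \<and> \<omega> 1 = 1 \<and> (\<forall>a. \<omega> (star a * a) \<in> \<real>\<^sub>\<ge>\<^sub>0)"

definition omega_infty :: "'d::finite weyl \<Rightarrow> complex" where
  "omega_infty = (THE \<omega>. state \<omega> \<and> \<omega> 1 = 1 \<and> (\<forall>\<xi>. \<xi> \<noteq> 0 \<longrightarrow> \<omega> (W \<xi>) = 0))"

lemma omega_infty_eq: "omega_infty = (\<lambda>a. coeff_at a 0)"
  unfolding omega_infty_def
proof (rule the_equality)
  have "Vector_Spaces.linear cscale (*) (\<lambda>a::'a weyl. coeff_at a 0)"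
    by unfold_locales (simp_all add: algebra_simps)
  then show "state (\<lambda>a::'a weyl. coeff_at a 0) \<and> coeff_at (1::'a weyl) 0 = 1 \<and>
      (\<forall>\<xi>. \<xi> \<noteq> 0 \<longrightarrow> coeff_at (W \<xi> :: 'a weyl) 0 = 0)"
    unfolding state_def
    by (simp add: coeff_at_star_mult_self coeff_at_W sum_nonneg flip: W_zero del: of_real_sum)
next
  fix \<omega> :: "'a weyl \<Rightarrow> complex"
  assume \<omega>: "state \<omega> \<and> \<omega> 1 = 1 \<and> (\<forall>\<xi>. \<xi> \<noteq> 0 \<longrightarrow> \<omega> (W \<xi>) = 0)"
  then interpret Vector_Spaces.linear cscale "(*)" \<omega>
    by (simp add: state_def)
  show "\<omega> = (\<lambda>a. coeff_at a 0)"
  proof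
    fix a
    have "\<omega> a = (\<Sum>\<xi>\<in>supp (weyl_coeffs a). coeff_at a \<xi> * \<omega> (W \<xi>))"
      by (subst weyl_expansion) (simp add: sum scale)
    also have "\<dots> = (\<Sum>\<xi>\<in>supp (weyl_coeffs a). if \<xi> = 0 then coeff_at a \<xi> else 0)"
      using \<omega> by (intro sum.cong) (auto simp: W_zero)
    also have "\<dots> = coeff_at a 0"
      by (simp add: in_keys_iff)
    finally show "\<omega> a = coeff_at a 0" .
  qed
qed

definition local_algebra :: "'d::finite lattice set \<Rightarrow> 'd weyl set" where
  "local_algebra \<Gamma> = weyl.span (W ` {\<xi>. supp \<xi> \<subseteq> \<Gamma>})"


section \<open>Operators on \<open>L\<^sup>2\<close>\<close>

text \<open>Elements of \<open>L\<^sup>2(M)\<close> are represented by square-integrable functions, and equations between them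
  are read almost everywhere. Everywhere defined operators are functions, partially defined
  (unbounded) ones are graphs.\<close>

type_synonym 'a operator = "('a \<Rightarrow> complex) \<Rightarrow> ('a \<Rightarrow> complex)"
type_synonym 'a graph = "('a \<Rightarrow> complex) \<Rightarrow> ('a \<Rightarrow> complex) \<Rightarrow> bool"

definition L2 :: "'a measure \<Rightarrow> ('a \<Rightarrow> complex) set" where
  "L2 M = {f \<in> borel_measurable M. integrable M (\<lambda>q. (cmod (f q))\<^sup>2)}"

definition l2_inner :: "'a measure \<Rightarrow> ('a \<Rightarrow> complex) \<Rightarrow> ('a \<Rightarrow> complex) \<Rightarrow> complex" where
  "l2_inner M f g = (LINT q|M. cnj (f q) * g q)"

definition l2_norm :: "'a measure \<Rightarrow> ('a \<Rightarrow> complex) \<Rightarrow> real" where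
  "l2_norm M f = sqrt (LINT q|M. (cmod (f q))\<^sup>2)"

definition bounded_operator :: "'a measure \<Rightarrow> 'a operator \<Rightarrow> bool" where
  "bounded_operator M T \<longleftrightarrow>
     (\<forall>f\<in>L2 M. T f \<in> L2 M) \<and>
     (\<forall>f\<in>L2 M. \<forall>g\<in>L2 M. AE q in M. T (\<lambda>q. f q + g q) q = T f q + T g q) \<and>
     (\<forall>c. \<forall>f\<in>L2 M. AE q in M. T (\<lambda>q. c * f q) q = c * T f q) \<and>
     (\<exists>K. \<forall>f\<in>L2 M. l2_norm M (T f) \<le> K * l2_norm M f)"

definition orthonormal_basis :: "'a measure \<Rightarrow> ('a \<Rightarrow> complex) set \<Rightarrow> bool" where
  "orthonormal_basis M B \<longleftrightarrow> B \<subseteq> L2 M \<and>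
     (\<forall>e\<in>B. \<forall>f\<in>B. l2_inner M e f = (if e = f then 1 else 0)) \<and>
     (\<forall>f\<in>L2 M. (\<forall>e\<in>B. l2_inner M e f = 0) \<longrightarrow> (AE q in M. f q = 0))"

definition has_trace :: "'a measure \<Rightarrow> 'a operator \<Rightarrow> complex \<Rightarrow> bool" where
  "has_trace M T t \<longleftrightarrow>
     (\<forall>B. orthonormal_basis M B \<longrightarrow> ((\<lambda>e. l2_inner M e (T e)) has_sum t) B)"

definition positive_operator :: "'a measure \<Rightarrow> 'a operator \<Rightarrow> bool" where
  "positive_operator M T \<longleftrightarrow> bounded_operator M T \<and> (\<forall>f\<in>L2 M. l2_inner M f (T f) \<in> \<real>\<^sub>\<ge>\<^sub>0)"

text \<open>For a positive operator, being trace class means that its diagonal sums are finite, so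
  the last conjunct covers both the trace-class property and the normalization.\<close>

definition density_operator :: "'a measure \<Rightarrow> 'a operator \<Rightarrow> bool" where
  "density_operator M \<rho> \<longleftrightarrow> positive_operator M \<rho> \<and> has_trace M \<rho> 1"

definition adjoint_graph :: "'a measure \<Rightarrow> 'a graph \<Rightarrow> 'a graph" where
  "adjoint_graph M T f g \<longleftrightarrow> f \<in> L2 M \<and> g \<in> L2 M \<and>
     (\<forall>h k. T h k \<longrightarrow> l2_inner M f k = l2_inner M g h)"

definition op_app :: "'a graph \<Rightarrow> 'a operator" where
  "op_app T f = (SOME g. T f g)"

definition orthogonal_projection :: "'a measure \<Rightarrow> 'a operator \<Rightarrow> bool" where
  "orthogonal_projection M P \<longleftrightarrow> bounded_operator M P \<and>
     (\<forall>f\<in>L2 M. AE q in M. P (P f) q = P f q) \<and>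
     (\<forall>f\<in>L2 M. \<forall>g\<in>L2 M. l2_inner M f (P g) = l2_inner M (P f) g)"

definition projection_valued_measure :: "'a measure \<Rightarrow> (real set \<Rightarrow> 'a operator) \<Rightarrow> bool" where
  "projection_valued_measure M E \<longleftrightarrow>
     (\<forall>S\<in>sets borel. orthogonal_projection M (E S)) \<and>
     (\<forall>f\<in>L2 M. AE q in M. E UNIV f q = f q) \<and>
     (\<forall>S::nat \<Rightarrow> real set. range S \<subseteq> sets borel \<longrightarrow> disjoint_family S \<longrightarrow>
        (\<forall>f\<in>L2 M. \<forall>g\<in>L2 M. (\<lambda>n. l2_inner M f (E (S n) g)) sums l2_inner M f (E (\<Union>n. S n) g)))"

definition diagonal_measure :: "'a measure \<Rightarrow> (real set \<Rightarrow> 'a operator) \<Rightarrow> ('a \<Rightarrow> complex) \<Rightarrow> real measure" where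
  "diagonal_measure M E f =
     measure_of UNIV (sets borel) (\<lambda>S. ennreal (Re (l2_inner M f (E S f))))"

text \<open>\<open>T = \<integral> s dE(s)\<close>. By polarization, the domain and the quadratic form determine \<open>T\<close>;
  the spectral projection \<open>1\<^sub>S(T)\<close> is \<open>E S\<close>.\<close>

definition spectral_measure_of :: "'a measure \<Rightarrow> 'a graph \<Rightarrow> (real set \<Rightarrow> 'a operator) \<Rightarrow> bool" where
  "spectral_measure_of M T E \<longleftrightarrow> projection_valued_measure M E \<and>
     (\<forall>f\<in>L2 M. (\<exists>g. T f g) \<longleftrightarrow> integrable (diagonal_measure M E f) (\<lambda>s. s\<^sup>2)) \<and>
     (\<forall>f g. T f g \<longrightarrow> l2_inner M f g = of_real (LINT s|diagonal_measure M E f. s))"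


section \<open>Schroedinger representation and local normality\<close>

text \<open>Points of \<open>\<real>\<^sup>\<Gamma>\<close> are functions that are \<open>undefined\<close> off \<open>\<Gamma>\<close>.\<close>

definition config :: "'d::finite lattice set \<Rightarrow> ('d lattice \<Rightarrow> real) measure" where
  "config \<Gamma> = PiM \<Gamma> (\<lambda>_. lborel)"

definition schroedinger_W :: "'d::finite lattice set \<Rightarrow> 'd phase \<Rightarrow> ('d lattice \<Rightarrow> real) operator" where
  "schroedinger_W \<Gamma> \<xi> f = (\<lambda>q.
     exp (\<i> * of_real (\<Sum>x\<in>\<Gamma>. val \<xi> x $ 2 * (q x + val \<xi> x $ 1 / 2))) *
     f (\<lambda>x\<in>\<Gamma>. q x + val \<xi> x $ 1))"

definition schroedinger :: "'d::finite lattice set \<Rightarrow> 'd weyl \<Rightarrow> ('d lattice \<Rightarrow> real) operator" where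
  "schroedinger \<Gamma> a f = (\<lambda>q. \<Sum>\<xi>\<in>supp (weyl_coeffs a). coeff_at a \<xi> * schroedinger_W \<Gamma> \<xi> f q)"

definition local_density ::
    "('d::finite weyl \<Rightarrow> complex) \<Rightarrow> 'd lattice set \<Rightarrow> ('d lattice \<Rightarrow> real) operator \<Rightarrow> bool" where
  "local_density \<omega> \<Gamma> \<rho> \<longleftrightarrow> density_operator (config \<Gamma>) \<rho> \<and>
     (\<forall>a\<in>local_algebra \<Gamma>. has_trace (config \<Gamma>) (\<lambda>f. \<rho> (schroedinger \<Gamma> a f)) (\<omega> a))"

definition locally_normal :: "('d::finite weyl \<Rightarrow> complex) \<Rightarrow> bool" where
  "locally_normal \<omega> \<longleftrightarrow> (\<forall>\<Gamma>. finite \<Gamma> \<longrightarrow> (\<exists>\<rho>. local_density \<omega> \<Gamma> \<rho>))"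


section \<open>Particle number\<close>

definition position :: "'d::finite lattice set \<Rightarrow> 'd lattice \<Rightarrow> ('d lattice \<Rightarrow> real) graph" where
  "position \<Gamma> x f g \<longleftrightarrow> f \<in> L2 (config \<Gamma>) \<and> g \<in> L2 (config \<Gamma>) \<and>
     (AE q in config \<Gamma>. g q = of_real (q x) * f q)"

text \<open>The self-adjoint operator \<open>-\<i>\<partial>\<close> along the coordinate \<open>x\<close>, the derivative being the limit of the
  difference quotients in \<open>L\<^sup>2\<close>.\<close>

definition momentum :: "'d::finite lattice set \<Rightarrow> 'd lattice \<Rightarrow> ('d lattice \<Rightarrow> real) graph" where
  "momentum \<Gamma> x f g \<longleftrightarrow> f \<in> L2 (config \<Gamma>) \<and> g \<in> L2 (config \<Gamma>) \<and>
     ((\<lambda>t::real. l2_norm (config \<Gamma>)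
        (\<lambda>q. (f (q(x := q x + t)) - f q) / of_real t - \<i> * g q)) \<longlongrightarrow> 0) (at 0)"

definition annihilation :: "'d::finite lattice set \<Rightarrow> 'd lattice \<Rightarrow> ('d lattice \<Rightarrow> real) graph" where
  "annihilation \<Gamma> x f k \<longleftrightarrow> k \<in> L2 (config \<Gamma>) \<and>
     (\<exists>g h. position \<Gamma> x f g \<and> momentum \<Gamma> x f h \<and>
        (AE q in config \<Gamma>. k q = (g q + \<i> * h q) / of_real (sqrt 2)))"

definition number_operator :: "'d::finite lattice set \<Rightarrow> ('d lattice \<Rightarrow> real) graph" where
  "number_operator \<Gamma> f g \<longleftrightarrow> f \<in> L2 (config \<Gamma>) \<and> g \<in> L2 (config \<Gamma>) \<and>
     (\<exists>h. (\<forall>x\<in>\<Gamma>. \<exists>k. annihilation \<Gamma> x f k \<and>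
              adjoint_graph (config \<Gamma>) (annihilation \<Gamma> x) k (h x)) \<and>
          (AE q in config \<Gamma>. g q = (\<Sum>x\<in>\<Gamma>. h x q)))"

text \<open>\<open>m = sup\<^sub>n Tr (N\<^sub>\<Gamma> 1\<^bsub>[0,n]\<^esub>(N\<^sub>\<Gamma>) \<rho>)\<close>. The spectral measure \<open>E\<close> of a self-adjoint operator exists
  and is unique, so quantifying it existentially does not involve a choice.\<close>

definition has_particle_number ::
    "'d::finite lattice set \<Rightarrow> ('d lattice \<Rightarrow> real) operator \<Rightarrow> ereal \<Rightarrow> bool" where
  "has_particle_number \<Gamma> \<rho> m \<longleftrightarrow>
     (\<exists>E \<tau>. spectral_measure_of (config \<Gamma>) (number_operator \<Gamma>) E \<and>
        (\<forall>n::nat. has_trace (config \<Gamma>)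
           (\<lambda>f. op_app (number_operator \<Gamma>) (E {0..real n} (\<rho> f))) (of_real (\<tau> n))) \<and>
        m = (SUP n. ereal (\<tau> n)))"

text \<open>The density operator of \<open>\<omega>\<close> on \<open>\<Gamma>\<close> is unique (almost everywhere), hence \<open>m = \<omega>(N\<^sub>\<Gamma>)\<close>.\<close>

definition finite_particle_density :: "('d::finite weyl \<Rightarrow> complex) \<Rightarrow> bool" where
  "finite_particle_density \<omega> \<longleftrightarrow>
     (\<exists>\<nu>::real. \<forall>\<Gamma>. finite \<Gamma> \<longrightarrow>
        (\<exists>\<rho> m. local_density \<omega> \<Gamma> \<rho> \<and> has_particle_number \<Gamma> \<rho> m \<and> m \<le> ereal (\<nu> * real (card \<Gamma>))))"


section \<open>Gaussian quantum cellular automata\<close>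

definition star_automorphism :: "('d::finite weyl \<Rightarrow> 'd weyl) \<Rightarrow> bool" where
  "star_automorphism \<alpha> \<longleftrightarrow> bij \<alpha> \<and> Vector_Spaces.linear cscale cscale \<alpha> \<and> \<alpha> 1 = 1 \<and>
     (\<forall>a b. \<alpha> (a * b) = \<alpha> a * \<alpha> b) \<and> (\<forall>a. \<alpha> (star a) = star (\<alpha> a))"

definition translate :: "'d::finite lattice \<Rightarrow> 'd phase \<Rightarrow> 'd phase" where
  "translate y = Poly_Mapping.map_key (\<lambda>x. x - y)"

lemma val_translate: "val (translate y \<xi>) x = val \<xi> (x - y)"
  by (simp add: translate_def Poly_Mapping.map_key.rep_eq inj_on_def)

definition phase_space_map :: "('d::finite phase \<Rightarrow> 'd phase) \<Rightarrow> bool" where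
  "phase_space_map \<Phi> \<longleftrightarrow> linear \<Phi> \<and> bij \<Phi> \<and>
     (\<exists>S. finite S \<and>
        (\<forall>\<xi>. supp (\<Phi> \<xi>) \<subseteq> {x + s |x s. x \<in> supp \<xi> \<and> s \<in> S} \<and>
             supp (inv \<Phi> \<xi>) \<subseteq> {x + s |x s. x \<in> supp \<xi> \<and> s \<in> S})) \<and>
     (\<forall>y. \<Phi> \<circ> translate y = translate y \<circ> \<Phi>)"

definition gaussian_qca :: "('d::finite weyl \<Rightarrow> 'd weyl) \<Rightarrow> ('d phase \<Rightarrow> 'd phase) \<Rightarrow> bool" where
  "gaussian_qca \<alpha> \<Phi> \<longleftrightarrow> star_automorphism \<alpha> \<and> phase_space_map \<Phi> \<and>
     (\<exists>\<kappa>::'d phase \<Rightarrow> real.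
        (\<forall>\<xi> \<eta>. [\<kappa> (\<xi> + \<eta>) = \<kappa> \<xi> + \<kappa> \<eta>] (rmod (2 * pi))) \<and>
        (\<forall>\<xi>. \<alpha> (W \<xi>) = exp (\<i> * of_real (\<kappa> \<xi>)) *\<^sub>C W (\<Phi> \<xi>)))"

text \<open>The matrix \<open>\<Phi>\<^sub>y\<close> in \<open>(\<Phi> \<xi>)(x) = \<Sum>\<^sub>y \<Phi>\<^sub>y \<xi>(x - y)\<close> (see \<open>phase_space_map_convolution\<close> below) is read
  off from the phase-space points supported at the origin.\<close>

definition hopping :: "('d::finite phase \<Rightarrow> 'd phase) \<Rightarrow> 'd lattice \<Rightarrow> real^2^2" where
  "hopping \<Phi> y = matrix (\<lambda>w. val (\<Phi> (Poly_Mapping.single 0 w)) y)"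

lemma hopping_works:
  assumes "linear \<Phi>"
  shows "hopping \<Phi> y *v w = val (\<Phi> (Poly_Mapping.single 0 w)) y"
proof -
  have "Poly_Mapping.single 0 (c *\<^sub>R v) = c *\<^sub>R Poly_Mapping.single (0::'a lattice) v" for c and v :: "real^2"
    by (rule poly_mapping_eqI) (simp add: lookup_single when_def)
  then have "linear (\<lambda>w. val (\<Phi> (Poly_Mapping.single 0 w)) y)"
    by (intro linearI) (simp_all add: single_add linear_add[OF assms] linear_scale[OF assms] lookup_add)
  then show ?thesis
    by (simp add: hopping_def matrix_works)
qed

lemma finite_hopping:
  assumes "linear \<Phi>"
  shows "finite {y. hopping \<Phi> y \<noteq> 0}"
proof (rule finite_subset)
  let ?s = "\<lambda>i::2. supp (\<Phi> (Poly_Mapping.single 0 (axis i 1)))"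
  show "{y. hopping \<Phi> y \<noteq> 0} \<subseteq> (\<Union>i. ?s i)"
  proof
    fix y assume "y \<in> {y. hopping \<Phi> y \<noteq> 0}"
    then obtain i where "column i (hopping \<Phi> y) \<noteq> 0"
      by (auto simp: vec_eq_iff column_def)
    then show "y \<in> (\<Union>i. ?s i)"
      using hopping_works[OF assms, of y "axis i 1"]
      by (auto simp: in_keys_iff matrix_vector_mul_component column_def matrix_vector_mult_basis)
  qed
qed simp

lemma phase_space_map_convolution:
  assumes "phase_space_map \<Phi>"
  shows "val (\<Phi> \<xi>) x = (\<Sum>y | hopping \<Phi> y \<noteq> 0. hopping \<Phi> y *v val \<xi> (x - y))"
proof -
  have lin: "linear \<Phi>" and tr: "\<Phi> (translate z \<eta>) = translate z (\<Phi> \<eta>)" for z \<eta>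
    using assms by (auto simp: phase_space_map_def fun_eq_iff)
  have single: "Poly_Mapping.single z w = translate z (Poly_Mapping.single 0 w)"
    for z :: "'a lattice" and w :: "real^2"
    by (rule poly_mapping_eqI) (auto simp: val_translate lookup_single when_def)
  have hop: "val (\<Phi> (Poly_Mapping.single z w)) x = hopping \<Phi> (x - z) *v w" for z w
    by (subst single) (simp only: tr val_translate hopping_works[OF lin])
  let ?F = "{y. hopping \<Phi> y \<noteq> 0}"
  have "\<Phi> \<xi> = (\<Sum>z\<in>supp \<xi>. \<Phi> (Poly_Mapping.single z (val \<xi> z)))"
    by (subst poly_mapping_sum_single[OF finite_keys order_refl, of \<xi>]) (rule linear_sum[OF lin])
  then have "val (\<Phi> \<xi>) x = (\<Sum>z\<in>supp \<xi>. hopping \<Phi> (x - z) *v val \<xi> z)"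
    by (simp add: lookup_sum hop)
  also have "\<dots> = (\<Sum>y\<in>(\<lambda>z. x - z) ` supp \<xi>. hopping \<Phi> y *v val \<xi> (x - y))"
    by (simp add: sum.reindex inj_on_def)
  also have "\<dots> = (\<Sum>y\<in>?F \<union> (\<lambda>z. x - z) ` supp \<xi>. hopping \<Phi> y *v val \<xi> (x - y))"
  proof (rule sum.mono_neutral_left)
    show "\<forall>y\<in>?F \<union> (\<lambda>z. x - z) ` supp \<xi> - (\<lambda>z. x - z) ` supp \<xi>. hopping \<Phi> y *v val \<xi> (x - y) = 0"
    proof
      fix y assume "y \<in> ?F \<union> (\<lambda>z. x - z) ` supp \<xi> - (\<lambda>z. x - z) ` supp \<xi>"
      then have "x - y \<notin> supp \<xi>" by (auto simp: image_iff)
      then show "hopping \<Phi> y *v val \<xi> (x - y) = 0" by (simp add: in_keys_iff)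
    qed
  qed (use finite_hopping[OF lin] in auto)
  also have "\<dots> = (\<Sum>y\<in>?F. hopping \<Phi> y *v val \<xi> (x - y))"
    by (rule sum.mono_neutral_right) (use finite_hopping[OF lin] in auto)
  finally show ?thesis .
qed

text \<open>Points of the torus are represented by vectors of angles.\<close>

definition symbol :: "('d::finite phase \<Rightarrow> 'd phase) \<Rightarrow> real^'d \<Rightarrow> complex^2^2" where
  "symbol \<Phi> \<theta> = (\<chi> i j. \<Sum>y | hopping \<Phi> y \<noteq> 0.
     of_real (hopping \<Phi> y $ i $ j) * exp (\<i> * of_real (\<Sum>k\<in>UNIV. of_int (y $ k) * \<theta> $ k)))"

definition eigenvalue :: "complex^2^2 \<Rightarrow> complex \<Rightarrow> bool" where
  "eigenvalue A \<zeta> \<longleftrightarrow> (\<exists>w. w \<noteq> 0 \<and> A *v w = \<zeta> *s w)"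

definition locally_hyperbolic :: "('d::finite phase \<Rightarrow> 'd phase) \<Rightarrow> bool" where
  "locally_hyperbolic \<Phi> \<longleftrightarrow>
     (\<exists>\<theta>. \<exists>\<delta>>0. \<not> (\<exists>\<zeta>. eigenvalue (symbol \<Phi> \<theta>) \<zeta> \<and> exp (- \<delta>) < cmod \<zeta> \<and> cmod \<zeta> < exp \<delta>))"

definition regular :: "('d::finite phase \<Rightarrow> 'd phase) \<Rightarrow> bool" where
  "regular \<Phi> \<longleftrightarrow> \<not> (\<exists>\<xi> c x. \<xi> \<noteq> 0 \<and> c \<noteq> 0 \<and> \<Phi> \<xi> = c *\<^sub>R translate x \<xi>)"

end

(*
  In a state omega, two anticommuting Weyl operators W(xi), W(eta) satisfy
  |omega(W(xi))|^2 <= 2 |omega(W(eta)) - 1|.  If xi is large at some site x, then eta can be chosen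
  supported at x and of size pi / |xi(x)|.  Finite particle density bounds the energy of the
  one-site density operators uniformly in x, so omega(W(eta)) is uniformly close to 1 for small eta
  at a single site.  It therefore suffices that sup_x |(Phi^k xi)(x)| tends to infinity.

  For this, write A(theta) for the symbol and w for the Fourier transform of xi.  If A w and w were
  parallel for all theta, then A w = zeta w with zeta^k w a Laurent polynomial for all integers k, so
  zeta would be a unit of the Laurent polynomial ring, i.e. a monomial, contradicting regularity.
  Hence A w and w are linearly independent at some theta close to the hyperbolic point, where A has
  an eigenvalue outside the closed unit disc because |det A| = 1, and A^k w grows exponentially there.
  The support of Phi^k xi grows only polynomially, so some value of Phi^k xi grows.

  On one site, split the Hilbert space with the given spectral measure E of the number operator N.
  The trace of N rho bounds the weight of rho on N > m, and on N <= m both the position and the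
  momentum are bounded by sqrt(2m + 1), so W(eta) - 1 is small there.
*)
theory Submission
  imports Defs
begin

section \<open>Group rings over an orderable group\<close>

text \<open>Two obstacles shape the proof. First, zeta is only a fraction of Laurent polynomials:
  its powers are encoded by \<open>geometric_seq\<close>, and degrees come from an injective
  homomorphism of the lattice into the reals, given by a rationally independent direction tau. The
  same tau serves a second time: along a line in this direction a nonzero Laurent polynomial is an
  exponential sum with distinct frequencies, so it cannot vanish on a segment through the hyperbolic
  point. Second, the spectral measure \<open>E\<close> is known only through the domain and the
  quadratic form of the number operator N; neither eigenvectors nor the commutation of N with
  \<open>E\<close> are given, and a trace is only a family of sums over orthonormal bases. So traces
  are never rearranged as operators. A basis adapted to the levels of the ceiling of N replaces an
  eigenbasis; the difference of the ceiling and N lies between 0 and 1, and its contribution is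
  bounded, like that of W(eta) - 1, by Cauchy-Schwarz for the form <f, rho g> on finite
  sums.\<close>

lemma lookup_mult_superset:
  fixes p q :: "'a::ab_group_add \<Rightarrow>\<^sub>0 'b::comm_ring_1"
  assumes "finite K" "supp p \<subseteq> K"
  shows "val (p * q) z = (\<Sum>y\<in>K. val p y * val q (z - y))"
proof -
  have single: "val (Poly_Mapping.single y c * q) z = c * val q (z - y)" for y c
  proof -
    have q: "q = (\<Sum>k\<in>supp q. Poly_Mapping.single k (val q k))"
      by (rule poly_mapping_sum_single) auto
    have "Poly_Mapping.single y c * q = (\<Sum>k\<in>supp q. Poly_Mapping.single (y + k) (c * val q k))"
      by (subst q) (simp add: sum_distrib_left mult_single)
    then have "val (Poly_Mapping.single y c * q) z = (\<Sum>k\<in>supp q. if k = z - y then c * val q k else 0)"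
      by (simp only: lookup_sum lookup_single when_def) (auto intro!: sum.cong simp: algebra_simps)
    also have "\<dots> = c * val q (z - y)"
      by (simp add: in_keys_iff)
    finally show ?thesis .
  qed
  have p: "p = (\<Sum>k\<in>K. Poly_Mapping.single k (val p k))"
    using assms by (rule poly_mapping_sum_single)
  have "val (p * q) z = val ((\<Sum>k\<in>K. Poly_Mapping.single k (val p k)) * q) z"
    using p by simp
  then show ?thesis
    by (simp add: sum_distrib_right lookup_sum single)
qed

text \<open>An injective homomorphism into the reals orders the group compatibly with addition, so
  that elements of the group ring have a unique leading term although the exponents are
  vectors.\<close>

locale ordering_hom =
  fixes h :: "'a::ab_group_add \<Rightarrow> real"
  assumes h_add: "h (x + y) = h x + h y" and h_inj: "inj h"
begin

definition top_deg :: "('a \<Rightarrow>\<^sub>0 'b::zero) \<Rightarrow> real"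
  where "top_deg p = Max (h ` supp p)"

lemma h_zero [simp]: "h 0 = 0"
  using h_add[of 0 0] by simp

lemma h_minus [simp]: "h (- x) = - h x"
  using h_add[of x "- x"] by simp

lemma h_diff: "h (x - y) = h x - h y"
  using h_add[of x "- y"] by simp

lemma le_top_deg: "y \<in> supp p \<Longrightarrow> h y \<le> top_deg p"
  by (simp add: top_deg_def)

lemma top_deg_attained:
  assumes "p \<noteq> 0"
  obtains y where "y \<in> supp p" "h y = top_deg p"
proof -
  have "top_deg p \<in> h ` supp p"
    unfolding top_deg_def using assms by (intro Max_in) auto
  then show ?thesis using that by auto
qed

lemma top_deg_unique: "x \<in> supp p \<Longrightarrow> (\<And>y. y \<in> supp p \<Longrightarrow> h y \<le> h x) \<Longrightarrow> top_deg p = h x"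
  unfolding top_deg_def by (intro Max_eqI) auto

lemma
  fixes p q :: "'a \<Rightarrow>\<^sub>0 'b::idom"
  assumes "p \<noteq> 0" "q \<noteq> 0"
  shows mult_nonzero: "p * q \<noteq> 0" and top_deg_mult: "top_deg (p * q) = top_deg p + top_deg q"
proof -
  obtain y where y: "y \<in> supp p" "h y = top_deg p" using top_deg_attained[OF assms(1)] .
  obtain z where z: "z \<in> supp q" "h z = top_deg q" using top_deg_attained[OF assms(2)] .
  \<comment> \<open>Only the two leading terms contribute at \<open>y + z\<close>: any other
    \<open>x\<close> in the support of \<open>p\<close> has smaller \<open>h x\<close> and would
    need an exponent of \<open>q\<close> above its degree.\<close>
  have "val (p * q) (y + z) = (\<Sum>x\<in>supp p. if x = y then val p y * val q z else 0)"
    unfolding lookup_mult_superset[OF finite_keys order_refl]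
  proof (intro sum.cong refl)
    fix x assume x: "x \<in> supp p"
    have "val q (y + z - x) = 0" if "x \<noteq> y"
    proof (rule ccontr)
      assume "val q (y + z - x) \<noteq> 0"
      then have "h (y + z - x) \<le> top_deg q" by (intro le_top_deg) (simp add: in_keys_iff)
      moreover have "h x < top_deg p"
        using le_top_deg[OF x] y that h_inj by (metis injD order_le_less)
      ultimately show False using y z by (simp add: h_add h_diff)
    qed
    then show "val p x * val q (y + z - x) = (if x = y then val p y * val q z else 0)" by auto
  qed
  then have yz: "val (p * q) (y + z) = val p y * val q z" using y by simp
  then have mem: "y + z \<in> supp (p * q)" using y z by (simp add: in_keys_iff)
  then show "p * q \<noteq> 0" by auto
  show "top_deg (p * q) = top_deg p + top_deg q"
  proof (subst top_deg_unique[OF mem])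
    fix x assume "x \<in> supp (p * q)"
    then obtain a b where "x = a + b" "a \<in> supp p" "b \<in> supp q"
      using keys_mult[of p q] by auto
    then show "h x \<le> h (y + z)"
      using le_top_deg[of a p] le_top_deg[of b q] y z by (simp add: h_add)
  qed (simp add: h_add y z)
qed

lemma mult_left_cancel:
  fixes f p q :: "'a \<Rightarrow>\<^sub>0 'b::idom"
  assumes "f \<noteq> 0" "f * p = f * q"
  shows "p = q"
proof (rule ccontr)
  assume "p \<noteq> q"
  then have "f * (p - q) \<noteq> 0" using assms by (intro mult_nonzero) auto
  then show False using assms by (simp add: right_diff_distrib)
qed

end

text \<open>\<open>F k\<close> stands for \<open>\<zeta>^k f\<close> with
  \<open>\<zeta> = F 1 / f\<close>; clearing denominators keeps the definition inside the
  ring.\<close>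

definition geometric_seq :: "('a::ab_group_add \<Rightarrow>\<^sub>0 real) \<Rightarrow> (nat \<Rightarrow> 'a \<Rightarrow>\<^sub>0 real) \<Rightarrow> bool" where
  "geometric_seq f F \<longleftrightarrow> F 0 = f \<and> (\<forall>k. f * F (Suc k) = F k * F 1)"

context ordering_hom
begin

lemma geometric_seq_nonzero:
  fixes f :: "'a \<Rightarrow>\<^sub>0 real"
  assumes "geometric_seq f F" "f \<noteq> 0" "F 1 \<noteq> 0"
  shows "F k \<noteq> 0"
proof (induction k)
  case 0
  then show ?case using assms by (simp add: geometric_seq_def)
next
  case (Suc k)
  then have "f * F (Suc k) \<noteq> 0"
    using assms mult_nonzero[of "F k" "F 1"] by (simp add: geometric_seq_def)
  then show ?case by auto
qed

lemma geometric_seq_top_deg: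
  fixes f :: "'a \<Rightarrow>\<^sub>0 real"
  assumes "geometric_seq f F" "f \<noteq> 0" "F 1 \<noteq> 0"
  shows "top_deg (F k) = top_deg f + real k * (top_deg (F 1) - top_deg f)"
proof (induction k)
  case 0
  then show ?case using assms by (simp add: geometric_seq_def)
next
  case (Suc k)
  have "top_deg (f * F (Suc k)) = top_deg (F k * F 1)"
    using assms by (simp add: geometric_seq_def)
  then have "top_deg f + top_deg (F (Suc k)) = top_deg (F k) + top_deg (F 1)"
    using assms geometric_seq_nonzero[OF assms] by (simp add: top_deg_mult)
  then show ?case using Suc by (simp add: algebra_simps)
qed

end

text \<open>For the reversed order, \<open>neg.top_deg p\<close> is minus the lowest degree, so
  \<open>top_deg p + neg.top_deg p\<close> is the width of the support as measured by
  \<open>h\<close>.\<close>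

locale ordering_hom2 = ordering_hom h + neg: ordering_hom "\<lambda>x. - h x" for h :: "'a::ab_group_add \<Rightarrow> real"
begin

lemma width_nonneg:
  assumes "p \<noteq> 0"
  shows "top_deg p + neg.top_deg p \<ge> 0"
proof -
  obtain y where "y \<in> supp p" using assms by (meson all_not_in_conv keys_eq_empty)
  then show ?thesis using le_top_deg[of y p] neg.le_top_deg[of y p] by simp
qed

text \<open>The width of \<open>F k\<close> is affine in \<open>k\<close> and never negative, so its
  slope, the width of \<open>F 1\<close> minus that of \<open>f\<close>, cannot be negative.\<close>

lemma geometric_seq_width:
  fixes f :: "'a \<Rightarrow>\<^sub>0 real"
  assumes "geometric_seq f F" "f \<noteq> 0" "F 1 \<noteq> 0"
  shows "top_deg f + neg.top_deg f \<le> top_deg (F 1) + neg.top_deg (F 1)"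
proof (rule ccontr)
  let ?w = "\<lambda>p. top_deg p + neg.top_deg p"
  assume "\<not> ?thesis"
  then have "?w f - ?w (F 1) > 0" by simp
  then obtain k where "?w f < real k * (?w f - ?w (F 1))"
    using reals_Archimedean3 by blast
  moreover have "?w (F k) = ?w f - real k * (?w f - ?w (F 1))"
    using geometric_seq_top_deg[OF assms, of k] neg.geometric_seq_top_deg[OF assms, of k]
    by (simp add: algebra_simps)
  ultimately show False
    using width_nonneg[OF geometric_seq_nonzero[OF assms, of k]] by simp
qed

text \<open>With \<open>\<zeta> = F 1 / f\<close>, the powers \<open>\<zeta>\<^sup>k f\<close> being Laurent polynomials for all integers \<open>k\<close> forces
  \<open>\<zeta>\<close> to be a unit. After removing a monomial from \<open>\<zeta>\<close>, a suitable scalar \<open>r\<close> makes the degree of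
  \<open>(\<zeta> - r)\<^sup>n f\<close> drop linearly in \<open>n\<close>, while its lowest degree stays bounded below.\<close>

lemma geometric_seq_monomial:
  fixes f :: "'a \<Rightarrow>\<^sub>0 real"
  assumes F: "geometric_seq f F" and G: "geometric_seq f G" and f: "f \<noteq> 0" and FG: "F 1 * G 1 = f * f"
  obtains r a where "r \<noteq> 0" "F 1 = Poly_Mapping.single a r * f"
proof -
  have "f * f \<noteq> 0" using f by (rule mult_nonzero[OF f])
  then have F1: "F 1 \<noteq> 0" and G1: "G 1 \<noteq> 0" using FG by auto
  have "top_deg (F 1) + top_deg (G 1) = top_deg f + top_deg f"
       "neg.top_deg (F 1) + neg.top_deg (G 1) = neg.top_deg f + neg.top_deg f"
    using FG F1 G1 f by (metis top_deg_mult, metis neg.top_deg_mult)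
  \<comment> \<open>Both \<open>F 1\<close> and \<open>G 1\<close> are at least as wide as
    \<open>f\<close>, while their product has twice the width of \<open>f\<close>; hence equality.
    So \<zeta> shifts the highest and the lowest degree by the same amount.\<close>
  then have w: "top_deg (F 1) - top_deg f = - (neg.top_deg (F 1) - neg.top_deg f)"
    using geometric_seq_width[OF F f F1] geometric_seq_width[OF G f G1] by linarith
  obtain y0 where y0: "y0 \<in> supp f" "h y0 = top_deg f" using top_deg_attained[OF f] .
  obtain y1 where y1: "y1 \<in> supp (F 1)" "h y1 = top_deg (F 1)" using top_deg_attained[OF F1] .
  define a where "a = y1 - y0"
  have ha: "h a = top_deg (F 1) - top_deg f" by (simp add: a_def h_diff y0 y1)
  \<comment> \<open>\<open>m k\<close> is the monomial with exponent \<open>-k a\<close>, the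
    multiple being written as a sum because \<open>'a\<close> is only an abelian group. Then
    \<open>g\<close> is the sequence belonging to \<zeta> divided by its leading monomial.\<close>
  define m where "m k = Poly_Mapping.single (- (\<Sum>i<k. a)) (1::real)" for k :: nat
  define g where "g k = m k * F k" for k
  have m_Suc: "m (Suc k) = m k * m 1" and m0: "m 0 = 1" for k
    by (simp_all add: m_def mult_single)
  have m_key: "val (m k * q) z = val q (z + (\<Sum>i<k. a))" for k q z
    by (simp add: m_def lookup_mult_superset[of "{- (\<Sum>i<k. a)}"])
  have h_sum: "h (\<Sum>i<k. a) = real k * h a" for k
    by (induction k) (simp_all add: h_add algebra_simps del: sum_constant)
  have g: "geometric_seq f g"
    unfolding geometric_seq_def
  proof (intro conjI allI)
    show "g 0 = f" using F by (simp add: g_def m0 geometric_seq_def)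
    fix k
    have "f * g (Suc k) = m k * m 1 * (f * F (Suc k))" by (simp only: g_def m_Suc mult_ac)
    also have "\<dots> = g k * g 1" using F by (simp only: g_def geometric_seq_def mult_ac)
    finally show "f * g (Suc k) = g k * g 1" .
  qed
  have g_low: "h z \<ge> - neg.top_deg f" if "z \<in> supp (g k)" for z k
  proof -
    have "z + (\<Sum>i<k. a) \<in> supp (F k)"
      using that by (simp add: in_keys_iff g_def m_key del: sum_constant)
    then have "- h (z + (\<Sum>i<k. a)) \<le> neg.top_deg (F k)" by (rule neg.le_top_deg)
    then show ?thesis
      unfolding h_add h_sum neg.geometric_seq_top_deg[OF F f F1, of k] ha w by (simp add: algebra_simps)
  qed
  have g1_top: "h z \<le> top_deg f" if "z \<in> supp (g 1)" for z
  proof -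
    have "z + a \<in> supp (F 1)"
      using that m_key[of 1 "F 1" z] by (simp add: in_keys_iff g_def)
    then show ?thesis using le_top_deg[of "z + a" "F 1"] by (simp add: h_add ha)
  qed
  \<comment> \<open>This scalar cancels the coefficient of \<open>g 1\<close> at the leading
    exponent \<open>y0\<close> of \<open>f\<close>, so \<open>p\<close> below has smaller degree
    than \<open>f\<close> unless it is zero.\<close>
  define r where "r = val (F 1) y1 / val f y0"
  define c where "c = Poly_Mapping.single (0::'a) r"
  have c_key: "val (c * q) z = r * val q z" for q z
    by (simp add: c_def lookup_mult_superset[of "{0}"])
  define p where "p = g 1 - c * f"
  have "p = 0"
  proof (rule ccontr)
    assume p: "p \<noteq> 0"
    have "val (g 1) y0 = val (F 1) y1"
      using m_key[of 1 "F 1" y0] by (simp add: g_def a_def)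
    then have p0: "val p y0 = 0"
      using y0 by (simp add: p_def lookup_minus c_key r_def in_keys_iff)
    obtain z where z: "z \<in> supp p" "h z = top_deg p" using top_deg_attained[OF p] .
    have "h z \<le> top_deg f"
    proof -
      have "z \<in> supp (g 1) \<or> z \<in> supp f"
        using z(1) by (auto simp: p_def in_keys_iff lookup_minus c_key)
      then show ?thesis using g1_top le_top_deg by blast
    qed
    moreover have "z \<noteq> y0" using z(1) p0 by (auto simp: in_keys_iff)
    ultimately have drop: "top_deg f - top_deg p > 0"
      using z y0 h_inj by (metis diff_gt_0_iff_gt injD order_le_less)
    \<comment> \<open>With \<open>z = g 1 / f\<close>, \<open>H n k\<close> is
      \<open>(z - r)^n z^k f\<close>. The second index lets the recursion stay inside the ring,
      since each factor \<open>z - r\<close> uses up one more power of \<open>z\<close>.\<close>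
    define H where "H = rec_nat g (\<lambda>_ H k. H (Suc k) - c * H k)"
    have H0: "H 0 = g" and HS: "H (Suc n) k = H n (Suc k) - c * H n k" for n k
      by (simp_all add: H_def)
    have fH: "f * H (Suc n) k = p * H n k" for n k
    proof (induction n arbitrary: k)
      case 0
      show ?case using g by (simp add: HS H0 p_def geometric_seq_def algebra_simps)
    next
      case (Suc n)
      have "f * H (Suc (Suc n)) k = f * H (Suc n) (Suc k) - c * (f * H (Suc n) k)"
        by (simp only: HS[of "Suc n"]) (simp add: algebra_simps)
      also have "\<dots> = p * H n (Suc k) - c * (p * H n k)" by (simp only: Suc)
      also have "\<dots> = p * H (Suc n) k" by (simp add: HS algebra_simps)
      finally show ?case .
    qed
    have H_nz: "H n 0 \<noteq> 0" for n
    proof (induction n)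
      case 0
      show ?case using g f by (simp add: H0 geometric_seq_def)
    next
      case (Suc n)
      then have "f * H (Suc n) 0 \<noteq> 0" unfolding fH by (rule mult_nonzero[OF p])
      then show ?case by auto
    qed
    have H_top: "top_deg (H n 0) = top_deg f - real n * (top_deg f - top_deg p)" for n
    proof (induction n)
      case 0
      show ?case using g by (simp add: H0 geometric_seq_def)
    next
      case (Suc n)
      have "top_deg (f * H (Suc n) 0) = top_deg (p * H n 0)" by (simp add: fH)
      then show ?case
        using Suc by (simp add: top_deg_mult f p H_nz algebra_simps)
    qed
    have H_low: "\<forall>k. \<forall>z\<in>supp (H n k). h z \<ge> - neg.top_deg f" for n
    proof (induction n)
      case 0
      show ?case using g_low by (simp add: H0)
    next
      case (Suc n)
      show ?case
      proof (intro allI ballI)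
        fix k z assume "z \<in> supp (H (Suc n) k)"
        then have "z \<in> supp (H n (Suc k)) \<or> z \<in> supp (H n k)"
          by (auto simp: HS in_keys_iff lookup_minus c_key)
        then show "h z \<ge> - neg.top_deg f" using Suc by blast
      qed
    qed
    \<comment> \<open>The top degree of \<open>H n 0\<close> falls by a fixed positive amount with
      each \<open>n\<close>, yet all supports stay above the lowest degree of \<open>f\<close>; a
      large \<open>n\<close> is contradictory.\<close>
    obtain n where n: "top_deg f + neg.top_deg f < real n * (top_deg f - top_deg p)"
      using reals_Archimedean3[OF drop] by blast
    obtain z where "z \<in> supp (H n 0)" "h z = top_deg (H n 0)"
      using top_deg_attained[OF H_nz] .
    then show False using H_low[of n] H_top[of n] n by force
  qed
  have "F 1 = Poly_Mapping.single a r * f"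
  proof (rule poly_mapping_eqI)
    fix z
    have "val (g 1) (z - a) = val (c * f) (z - a)" using \<open>p = 0\<close> by (simp add: p_def)
    then show "val (F 1) z = val (Poly_Mapping.single a r * f) z"
      using m_key[of 1 "F 1" "z - a"] by (simp add: g_def c_key lookup_mult_superset[of "{a}"])
  qed
  moreover have "r \<noteq> 0" using y0 y1 by (simp add: r_def in_keys_iff)
  ultimately show ?thesis using that by blast
qed

end

section \<open>Symbols of phase-space maps\<close>

definition angle :: "'d::finite lattice \<Rightarrow> real^'d \<Rightarrow> real" where
  "angle y \<theta> = (\<Sum>k\<in>UNIV. of_int (y $ k) * \<theta> $ k)"

lemma angle_add_left: "angle (x + y) \<theta> = angle x \<theta> + angle y \<theta>"
  by (simp add: angle_def sum.distrib algebra_simps)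

lemma angle_add_right: "angle x (\<theta> + t *\<^sub>R \<eta>) = angle x \<theta> + t * angle x \<eta>"
  by (simp add: angle_def sum.distrib algebra_simps sum_distrib_left)

lemma angle_zero [simp]: "angle 0 \<theta> = 0"
  by (simp add: angle_def)

lemma angle_minus [simp]: "angle (- y) \<theta> = - angle y \<theta>"
  by (simp add: angle_def sum_negf)

text \<open>The coordinates of \<open>\<tau>\<close> are distinct powers of a real number that is not a root of any of the
  countably many nonzero integer polynomials that occur.\<close>

lemma ex_rationally_independent:
  obtains \<tau> :: "real^'d::finite" where "inj (\<lambda>y. angle y \<tau>)"
proof -
  obtain idx :: "'d \<Rightarrow> nat" where idx: "inj idx"
    using finite_imp_inj_to_nat_seg[of "UNIV :: 'd set"] by auto
  define P :: "'d lattice \<Rightarrow> real poly" where "P y = (\<Sum>k\<in>UNIV. monom (of_int (y $ k)) (idx k))" for y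
  have nz: "P y \<noteq> 0" if y: "y \<noteq> 0" for y
  proof -
    obtain k where k: "y $ k \<noteq> 0" using y by (auto simp: vec_eq_iff)
    have "coeff (P y) (idx k) = (\<Sum>l\<in>UNIV. if l = k then of_int (y $ k) else 0)"
      unfolding P_def coeff_sum by (intro sum.cong) (auto simp: inj_eq[OF idx])
    then have "coeff (P y) (idx k) \<noteq> 0" using k by simp
    then show ?thesis by auto
  qed
  have "countable (\<Union>y\<in>UNIV - {0}. {x. poly (P y) x = 0})"
    using nz by (intro countable_UN) (auto intro!: countable_finite poly_roots_finite)
  then have "(\<Union>y\<in>UNIV - {0}. {x. poly (P y) x = 0}) \<noteq> UNIV"
    using uncountable_UNIV_real by metis
  then obtain x where x: "\<And>y. y \<noteq> 0 \<Longrightarrow> poly (P y) x \<noteq> 0" by auto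
  define \<tau> where "\<tau> = (\<chi> k. x ^ idx k)"
  have "angle y \<tau> = poly (P y) x" for y
    by (simp add: angle_def \<tau>_def P_def poly_sum poly_monom)
  then have "angle y \<tau> \<noteq> 0" if "y \<noteq> 0" for y using x that by simp
  moreover have "angle (y - z) \<tau> = angle y \<tau> - angle z \<tau>" for y z
    using angle_add_left[of y "- z" \<tau>] by simp
  ultimately have "inj (\<lambda>y. angle y \<tau>)"
    by (intro injI) (metis cancel_comm_monoid_add_class.diff_cancel eq_iff_diff_eq_0)
  then show ?thesis using that by blast
qed

text \<open>Induction on \<open>K\<close>: dividing by one exponential makes its term constant, and
  differentiation removes it. The other coefficients are multiplied by frequency differences, which
  injectivity keeps nonzero.\<close>

lemma exponential_sum_coeffs_zero:
  fixes c :: "'a \<Rightarrow> complex" and \<mu> :: "'a \<Rightarrow> real"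
  assumes "finite K" "inj_on \<mu> K" "\<epsilon> > 0"
    and "\<And>t. \<bar>t\<bar> < \<epsilon> \<Longrightarrow> (\<Sum>y\<in>K. c y * exp (\<i> * of_real (t * \<mu> y))) = 0"
  shows "\<forall>y\<in>K. c y = 0"
  using assms
proof (induction K arbitrary: c \<mu> rule: finite_induct)
  case (insert z K)
  define F where "F t = (\<Sum>y\<in>insert z K. c y * exp (\<i> * of_real (t * (\<mu> y - \<mu> z))))" for t :: real
  have F0: "F t = 0" if "\<bar>t\<bar> < \<epsilon>" for t
  proof -
    have "F t = exp (- \<i> * of_real (t * \<mu> z)) * (\<Sum>y\<in>insert z K. c y * exp (\<i> * of_real (t * \<mu> y)))"
      unfolding F_def sum_distrib_left
      by (intro sum.cong refl) (simp add: exp_add[symmetric] algebra_simps)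
    then show ?thesis using insert.prems(3)[OF that] by simp
  qed
  have zero: "(\<Sum>y\<in>K. (c y * \<i> * of_real (\<mu> y - \<mu> z)) * exp (\<i> * of_real (t * (\<mu> y - \<mu> z)))) = 0"
    if t: "\<bar>t\<bar> < \<epsilon>" for t
  proof -
    have "(F has_vector_derivative
        (\<Sum>y\<in>insert z K. (c y * \<i> * of_real (\<mu> y - \<mu> z)) * exp (\<i> * of_real (t * (\<mu> y - \<mu> z))))) (at t)"
      unfolding F_def
    proof (rule has_vector_derivative_sum)
      fix y
      have "((\<lambda>w. c y * exp (\<i> * (w * of_real (\<mu> y - \<mu> z)))) has_field_derivative
          c y * \<i> * of_real (\<mu> y - \<mu> z) * exp (\<i> * (of_real t * of_real (\<mu> y - \<mu> z)))) (at (of_real t))"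
        by (auto intro!: derivative_eq_intros)
      then show "((\<lambda>t. c y * exp (\<i> * of_real (t * (\<mu> y - \<mu> z)))) has_vector_derivative
          c y * \<i> * of_real (\<mu> y - \<mu> z) * exp (\<i> * of_real (t * (\<mu> y - \<mu> z)))) (at t)"
        unfolding of_real_mult by (rule has_vector_derivative_real_field)
    qed
    moreover have "(F has_vector_derivative 0) (at t)"
    proof (rule has_vector_derivative_transform_within_open)
      show "((\<lambda>_. 0::complex) has_vector_derivative 0) (at t)" by simp
      show "open {-\<epsilon><..<\<epsilon>}" "t \<in> {-\<epsilon><..<\<epsilon>}" using t by auto
    qed (auto simp: F0 abs_less_iff)
    ultimately have "(\<Sum>y\<in>insert z K. (c y * \<i> * of_real (\<mu> y - \<mu> z)) * exp (\<i> * of_real (t * (\<mu> y - \<mu> z)))) = 0"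
      by (rule vector_derivative_unique_at)
    then show ?thesis using insert.hyps by simp
  qed
  have "\<forall>y\<in>K. c y * \<i> * of_real (\<mu> y - \<mu> z) = 0"
  proof (rule insert.IH)
    show "inj_on (\<lambda>y. \<mu> y - \<mu> z) K" using insert.prems(1) by (auto simp: inj_on_def)
  qed (use zero insert.prems in auto)
  moreover have "\<mu> y \<noteq> \<mu> z" if "y \<in> K" for y
    using insert.prems(1) insert.hyps(2) that unfolding inj_on_def by blast
  ultimately have K: "\<forall>y\<in>K. c y = 0" by auto
  then have "F 0 = c z" using insert.hyps by (simp add: F_def)
  then show ?case using K F0[of 0] insert.prems(2) by simp
qed simp

section \<open>Fourier transform of real Laurent polynomials\<close>

definition fourier :: "real^'d::finite \<Rightarrow> ('d lattice \<Rightarrow>\<^sub>0 real) \<Rightarrow> complex" where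
  "fourier \<theta> p = (\<Sum>y\<in>supp p. of_real (val p y) * exp (\<i> * of_real (angle y \<theta>)))"

lemma fourier_superset:
  assumes "finite K" "supp p \<subseteq> K"
  shows "fourier \<theta> p = (\<Sum>y\<in>K. of_real (val p y) * exp (\<i> * of_real (angle y \<theta>)))"
  unfolding fourier_def using assms by (intro sum.mono_neutral_left) (auto simp: in_keys_iff)

lemma fourier_add: "fourier \<theta> (p + q) = fourier \<theta> p + fourier \<theta> q"
proof -
  let ?K = "supp p \<union> supp q"
  have "supp (p + q) \<subseteq> ?K" by (rule keys_add)
  then show ?thesis
    by (simp add: fourier_superset[of ?K] lookup_add distrib_right sum.distrib)
qed

lemma fourier_uminus: "fourier \<theta> (- p) = - fourier \<theta> p"
  by (simp add: fourier_def sum_negf[symmetric] del: sum_negf)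

lemma fourier_diff: "fourier \<theta> (p - q) = fourier \<theta> p - fourier \<theta> q"
  using fourier_add[of \<theta> p "- q"] by (simp add: fourier_uminus)

lemma fourier_zero [simp]: "fourier \<theta> 0 = 0"
  by (simp add: fourier_def)

lemma fourier_single: "fourier \<theta> (Poly_Mapping.single y c) = of_real c * exp (\<i> * of_real (angle y \<theta>))"
  by (subst fourier_superset[of "{y}"]) auto

lemma fourier_one [simp]: "fourier \<theta> 1 = 1"
  using fourier_single[of \<theta> 0 1] by simp

lemma fourier_sum: "fourier \<theta> (\<Sum>i\<in>I. f i) = (\<Sum>i\<in>I. fourier \<theta> (f i))"
  by (induction I rule: infinite_finite_induct) (simp_all add: fourier_add)

lemma fourier_mult: "fourier \<theta> (p * q) = fourier \<theta> p * fourier \<theta> q"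
proof -
  have "p * q = (\<Sum>y\<in>supp p. Poly_Mapping.single y (val p y)) * (\<Sum>z\<in>supp q. Poly_Mapping.single z (val q z))"
    by (simp flip: poly_mapping_sum_single[OF finite_keys order_refl])
  also have "fourier \<theta> \<dots> = fourier \<theta> p * fourier \<theta> q"
    by (simp add: sum_product mult_single fourier_sum fourier_single fourier_def[of \<theta> p]
        fourier_def[of \<theta> q] angle_add_left exp_add algebra_simps)
  finally show ?thesis .
qed

lemma norm_fourier_le: "cmod (fourier \<theta> p) \<le> (\<Sum>y\<in>supp p. \<bar>val p y\<bar>)"
  unfolding fourier_def by (rule order_trans[OF norm_sum]) (simp add: norm_mult)

text \<open>Coefficients are real, so reflecting the exponents is complex conjugation on the torus;
  conjugates of symbols thus remain transforms of Laurent polynomials.\<close>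

definition reflect :: "('d::finite lattice \<Rightarrow>\<^sub>0 real) \<Rightarrow> ('d lattice \<Rightarrow>\<^sub>0 real)" where
  "reflect = Poly_Mapping.map_key uminus"

lemma val_reflect [simp]: "val (reflect p) y = val p (- y)"
  by (simp add: reflect_def Poly_Mapping.map_key.rep_eq inj_on_def)

lemma reflect_one [simp]: "reflect 1 = 1" and reflect_zero [simp]: "reflect 0 = 0"
  by (rule poly_mapping_eqI; simp add: lookup_one when_def)+

lemma fourier_reflect: "fourier \<theta> (reflect p) = cnj (fourier \<theta> p)"
proof -
  have "supp (reflect p) = uminus ` supp p"
    by (auto simp: in_keys_iff image_iff intro!: bexI[of _ "- _"])
  then show ?thesis
    by (simp add: fourier_def sum.reindex inj_on_def exp_cnj)
qed

text \<open>On the line through \<open>\<theta>\<close> in direction \<open>\<tau>\<close> the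
  transform is a one-variable exponential sum whose frequencies \<open>angle y \<tau>\<close> are
  distinct, so an arbitrarily short segment determines all coefficients.\<close>

lemma fourier_zero_imp_zero:
  assumes "inj (\<lambda>y. angle y \<tau>)" "\<epsilon> > 0" "\<And>t. \<bar>t\<bar> < \<epsilon> \<Longrightarrow> fourier (\<theta> + t *\<^sub>R \<tau>) p = 0"
  shows "p = 0"
proof -
  have "\<forall>y\<in>supp p. of_real (val p y) * exp (\<i> * of_real (angle y \<theta>)) = (0::complex)"
  proof (rule exponential_sum_coeffs_zero)
    fix t :: real assume "\<bar>t\<bar> < \<epsilon>"
    then show "(\<Sum>y\<in>supp p. of_real (val p y) * exp (\<i> * of_real (angle y \<theta>)) * exp (\<i> * of_real (t * angle y \<tau>))) = 0"
      using assms(3)[of t]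
      by (simp add: fourier_def angle_add_right distrib_left exp_add mult.assoc)
  qed (use assms in \<open>auto intro: inj_on_subset\<close>)
  then have "supp p = {}" by (fastforce simp: in_keys_iff)
  then show ?thesis by simp
qed

lemma isCont_fourier_line: "isCont (\<lambda>t::real. fourier (\<theta> + t *\<^sub>R \<tau>) p) t"
  unfolding fourier_def angle_add_right by (intro continuous_intros)

section \<open>Phase-space points as pairs of Laurent polynomials, and \<Phi> as a 2x2 matrix over
  them\<close>

definition phase_comp :: "2 \<Rightarrow> 'd::finite phase \<Rightarrow> ('d lattice \<Rightarrow>\<^sub>0 real)" where
  "phase_comp i = Poly_Mapping.map (\<lambda>v. v $ i)"

lemma val_phase_comp [simp]: "val (phase_comp i \<xi>) x = val \<xi> x $ i"
  by (simp add: phase_comp_def Poly_Mapping.map.rep_eq when_def)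

lemma supp_phase_comp: "supp (phase_comp i \<xi>) \<subseteq> supp \<xi>"
  by (auto simp: in_keys_iff)

lemma phase_eqI:
  assumes "phase_comp 1 \<xi> = phase_comp 1 \<eta>" "phase_comp 2 \<xi> = phase_comp 2 \<eta>"
  shows "\<xi> = \<eta>"
proof (rule poly_mapping_eqI)
  fix x
  have "val \<xi> x $ i = val \<eta> x $ i" for i
    using assms exhaust_2[of i] by (auto simp flip: val_phase_comp)
  then show "val \<xi> x = val \<eta> x" by (simp add: vec_eq_iff)
qed

lemma phase_comp_single: "phase_comp i (Poly_Mapping.single x v) = Poly_Mapping.single x (v $ i)"
  by (rule poly_mapping_eqI) (simp add: lookup_single when_def)

definition transfer_entry :: "('d::finite phase \<Rightarrow> 'd phase) \<Rightarrow> 2 \<Rightarrow> 2 \<Rightarrow> ('d lattice \<Rightarrow>\<^sub>0 real)" where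
  "transfer_entry \<Phi> i j = phase_comp i (\<Phi> (Poly_Mapping.single 0 (axis j 1)))"

lemma val_transfer_entry: "linear \<Phi> \<Longrightarrow> val (transfer_entry \<Phi> i j) y = hopping \<Phi> y $ i $ j"
  using hopping_works[of \<Phi> y "axis j 1"]
  by (simp add: transfer_entry_def matrix_vector_mult_basis column_def flip: hopping_works)

lemma phase_comp_apply:
  assumes "phase_space_map \<Phi>"
  shows "phase_comp i (\<Phi> \<xi>) = transfer_entry \<Phi> i 1 * phase_comp 1 \<xi> + transfer_entry \<Phi> i 2 * phase_comp 2 \<xi>"
proof (rule poly_mapping_eqI)
  fix x
  have lin: "linear \<Phi>" using assms by (simp add: phase_space_map_def)
  let ?F = "{y. hopping \<Phi> y \<noteq> 0}"
  have F: "finite ?F" "supp (transfer_entry \<Phi> i j) \<subseteq> ?F" for j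
    using finite_hopping[OF lin] by (auto simp: in_keys_iff val_transfer_entry[OF lin])
  show "val (phase_comp i (\<Phi> \<xi>)) x = val (transfer_entry \<Phi> i 1 * phase_comp 1 \<xi> + transfer_entry \<Phi> i 2 * phase_comp 2 \<xi>) x"
    by (simp add: phase_space_map_convolution[OF assms] lookup_add lookup_mult_superset[OF F]
        val_transfer_entry[OF lin] matrix_vector_mult_def sum_2 sum.distrib)
qed

lemma symbol_eq_fourier:
  assumes "phase_space_map \<Phi>"
  shows "symbol \<Phi> \<theta> $ i $ j = fourier \<theta> (transfer_entry \<Phi> i j)"
proof -
  have lin: "linear \<Phi>" using assms by (simp add: phase_space_map_def)
  show ?thesis
    using finite_hopping[OF lin]
    by (subst fourier_superset[of "{y. hopping \<Phi> y \<noteq> 0}"])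
       (auto simp: in_keys_iff val_transfer_entry[OF lin] symbol_def angle_def)
qed

text \<open>The generating series of the symplectic products of \<open>\<xi>\<close> with all
  translates of \<open>\<eta>\<close>. On the torus it pairs one transform with the conjugate of the
  other, so that the invariance under \<Phi> becomes an identity for the symbol.\<close>

definition sympl_series :: "'d::finite phase \<Rightarrow> 'd phase \<Rightarrow> ('d lattice \<Rightarrow>\<^sub>0 real)" where
  "sympl_series \<xi> \<eta> = phase_comp 1 \<xi> * reflect (phase_comp 2 \<eta>) - phase_comp 2 \<xi> * reflect (phase_comp 1 \<eta>)"

lemma val_sympl_series: "val (sympl_series \<xi> \<eta>) y = sympl \<xi> (translate y \<eta>)"
proof -
  let ?K = "supp \<xi> \<union> supp (translate y \<eta>)"
  have K: "finite ?K" "supp (phase_comp i \<xi>) \<subseteq> ?K" for i using supp_phase_comp by auto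
  show ?thesis
    by (simp add: sympl_series_def lookup_minus lookup_mult_superset[OF K] sympl_def val_translate
        sum_subtractf mult.commute[of "val \<eta> _ $ 1"])
qed

lemma sympl_series_apply:
  assumes "phase_space_map \<Phi>" "\<And>\<xi> \<eta>. sympl (\<Phi> \<xi>) (\<Phi> \<eta>) = sympl \<xi> \<eta>"
  shows "sympl_series (\<Phi> \<xi>) (\<Phi> \<eta>) = sympl_series \<xi> \<eta>"
proof (rule poly_mapping_eqI)
  fix y
  have "translate y (\<Phi> \<eta>) = \<Phi> (translate y \<eta>)"
    using assms(1) by (auto simp: phase_space_map_def fun_eq_iff)
  then show "val (sympl_series (\<Phi> \<xi>) (\<Phi> \<eta>)) y = val (sympl_series \<xi> \<eta>) y"
    by (simp add: val_sympl_series assms(2))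
qed

text \<open>The hypotheses are the entries of \<open>A^T J A' = J\<close> for the matrices with rows
  \<open>(a, b)\<close>, \<open>(c, d)\<close> and \<open>(a', b')\<close>, \<open>(c', d')\<close>,
  where \<open>J\<close> is the standard symplectic matrix; the claim is the determinant of this
  identity.\<close>

lemma det_mult_eq_1:
  fixes a b c d a' b' c' d' :: "'a::comm_ring_1"
  assumes "a * d' - c * b' = 1" "a * c' = c * a'" "b * d' = d * b'" "a' * d - c' * b = 1"
  shows "(a * d - b * c) * (a' * d' - b' * c') = 1"
proof -
  have "(a * d - b * c) * (a' * d' - b' * c') =
      a * a' * d * d' - (a * c') * (d * b') - (c * a') * (b * d') + b * b' * c * c'"
    by (simp add: algebra_simps)
  also have "\<dots> = a * a' * d * d' - (a * c') * (b * d') - (c * a') * (d * b') + b * b' * c * c'"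
    by (simp only: assms(2,3))
  also have "\<dots> = (a * d' - c * b') * (a' * d - c' * b)"
    by (simp add: algebra_simps)
  finally show ?thesis by (simp only: assms(1,4) mult_1)
qed

text \<open>On the torus the symplectic form is preserved with the second argument conjugated. Hence
  the product of the determinant and its conjugate is 1, which gives only the modulus.\<close>

lemma cmod_det_symbol:
  assumes "phase_space_map \<Phi>" "\<And>\<xi> \<eta>. sympl (\<Phi> \<xi>) (\<Phi> \<eta>) = sympl \<xi> \<eta>"
  shows "cmod (symbol \<Phi> \<theta> $ 1 $ 1 * symbol \<Phi> \<theta> $ 2 $ 2 - symbol \<Phi> \<theta> $ 1 $ 2 * symbol \<Phi> \<theta> $ 2 $ 1) = 1"
proof -
  define e where "e j = Poly_Mapping.single (0::'a lattice) (axis j (1::real) :: real^2)" for j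
  define s where "s i j = fourier \<theta> (transfer_entry \<Phi> i j)" for i j
  have A: "s 1 i * cnj (s 2 j) - s 2 i * cnj (s 1 j) = fourier \<theta> (sympl_series (e i) (e j))" for i j
    by (subst sympl_series_apply[OF assms, symmetric])
       (simp add: fourier_diff fourier_mult fourier_reflect s_def transfer_entry_def e_def sympl_series_def)
  have se: "sympl_series (e 1) (e 2) = 1" "sympl_series (e 1) (e 1) = 0" "sympl_series (e 2) (e 2) = 0"
    by (simp_all add: sympl_series_def e_def phase_comp_single axis_def reflect_one)
  have B: "s 1 1 * cnj (s 2 2) - s 2 1 * cnj (s 1 2) = 1" "s 1 1 * cnj (s 2 1) = s 2 1 * cnj (s 1 1)"
     "s 1 2 * cnj (s 2 2) = s 2 2 * cnj (s 1 2)"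
    using A[of 1 2] A[of 1 1] A[of 2 2] by (simp_all add: se)
  have C: "cnj (s 1 1) * s 2 2 - cnj (s 2 1) * s 1 2 = 1"
    using arg_cong[OF B(1), of cnj] by simp
  have "(s 1 1 * s 2 2 - s 1 2 * s 2 1) * cnj (s 1 1 * s 2 2 - s 1 2 * s 2 1) = 1"
    unfolding complex_cnj_diff complex_cnj_mult by (rule det_mult_eq_1[OF B C])
  then have "complex_of_real ((cmod (s 1 1 * s 2 2 - s 1 2 * s 2 1))\<^sup>2) = 1"
    by (simp only: complex_norm_square)
  then have "(cmod (s 1 1 * s 2 2 - s 1 2 * s 2 1))\<^sup>2 = 1"
    by (simp only: of_real_eq_1_iff)
  then have "cmod (s 1 1 * s 2 2 - s 1 2 * s 2 1) = 1"
    using norm_ge_zero[of "s 1 1 * s 2 2 - s 1 2 * s 2 1"] unfolding power2_eq_1_iff by linarith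
  then show ?thesis
    by (simp only: s_def symbol_eq_fourier[OF assms(1)])
qed

lemma (in ordering_hom) mult_eq_0_iff': "(p::'a \<Rightarrow>\<^sub>0 real) * q = 0 \<longleftrightarrow> p = 0 \<or> q = 0"
  using mult_nonzero[of p q] by auto

lemma ordering_hom2_angle:
  assumes "inj (\<lambda>y. angle y \<tau>)"
  shows "ordering_hom2 (\<lambda>y. angle y \<tau>)"
  using assms by unfold_locales (auto simp: angle_add_left inj_on_def)

lemma phase_space_map_inv:
  assumes "phase_space_map \<Phi>"
  shows "phase_space_map (inv \<Phi>)"
proof -
  have lin: "linear \<Phi>" and bij: "bij \<Phi>" and tr: "\<And>y. \<Phi> \<circ> translate y = translate y \<circ> \<Phi>"
    using assms by (auto simp: phase_space_map_def)
  have i: "\<Phi> (inv \<Phi> x) = x" "inv \<Phi> (\<Phi> x) = x" for x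
    using bij by (simp_all add: bij_is_surj surj_f_inv_f bij_is_inj inv_f_f)
  have inv_eq: "inv \<Phi> x = y" if "\<Phi> y = x" for x y
    using i(2)[of y] that by simp
  have "linear (inv \<Phi>)"
    by (rule linearI; rule inv_eq) (simp_all add: linear_add[OF lin] linear_scale[OF lin] i)
  moreover have "inv \<Phi> (translate y x) = translate y (inv \<Phi> x)" for y x
    using fun_cong[OF tr[of y], of "inv \<Phi> x"] by (intro inv_eq) (simp add: i)
  then have "inv \<Phi> \<circ> translate y = translate y \<circ> inv \<Phi>" for y
    by (simp add: fun_eq_iff)
  moreover obtain S where "finite S"
    and "\<And>\<xi>. supp (\<Phi> \<xi>) \<subseteq> {x + s |x s. x \<in> supp \<xi> \<and> s \<in> S}"
    and "\<And>\<xi>. supp (inv \<Phi> \<xi>) \<subseteq> {x + s |x s. x \<in> supp \<xi> \<and> s \<in> S}"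
    using assms unfolding phase_space_map_def by blast
  ultimately show ?thesis
    using bij bij_imp_bij_inv[OF bij] unfolding phase_space_map_def inv_inv_eq[OF bij]
    by (intro conjI exI[of _ S]) auto
qed

section \<open>Parallel iterates and regularity\<close>

text \<open>\<Phi> is linear over the Laurent polynomials. So
  \<open>\<Phi> \<xi> = \<zeta> \<xi>\<close> over the fraction field implies that the
  \<open>k\<close>-th iterate is \<open>\<zeta>^k \<xi>\<close>; the nonzero component
  \<open>phase_comp j \<xi>\<close> serves as denominator.\<close>

lemma phase_comp_iterate_geometric:
  fixes h :: "'d::finite lattice \<Rightarrow> real" and \<Phi> :: "'d phase \<Rightarrow> 'd phase"
  assumes oh: "ordering_hom h" and \<Phi>: "phase_space_map \<Phi>" and f: "phase_comp j \<xi> \<noteq> 0"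
    and par: "\<And>i. phase_comp j \<xi> * phase_comp i (\<Phi> \<xi>) = phase_comp j (\<Phi> \<xi>) * phase_comp i \<xi>"
  shows "geometric_seq (phase_comp j \<xi>) (\<lambda>k. phase_comp j ((\<Phi> ^^ k) \<xi>))"
proof -
  interpret ordering_hom h by fact
  let ?f = "phase_comp j \<xi>"
  define X where "X k i = phase_comp i ((\<Phi> ^^ k) \<xi>)" for k i
  define s where "s = transfer_entry \<Phi>"
  have X0: "X 0 i = phase_comp i \<xi>" and X1: "X 1 i = phase_comp i (\<Phi> \<xi>)" for i by (simp_all add: X_def)
  have XS: "X (Suc k) i = s i 1 * X k 1 + s i 2 * X k 2" for k i
    by (simp add: X_def phase_comp_apply[OF \<Phi>] s_def)
  \<comment> \<open>Applying the matrix of \<Phi> to the statement that the \<open>k\<close>-th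
    iterate is parallel to \<open>\<xi>\<close> compares the next iterate with
    \<open>\<Phi> \<xi>\<close>.\<close>
  have step: "?f * X (Suc k) i = X k j * X 1 i" if "\<And>i. ?f * X k i = X k j * X 0 i" for k i
  proof -
    have "?f * X (Suc k) i = s i 1 * (?f * X k 1) + s i 2 * (?f * X k 2)"
      by (simp add: XS algebra_simps)
    also have "\<dots> = X k j * (s i 1 * X 0 1 + s i 2 * X 0 2)"
      by (simp only: that) (simp add: algebra_simps)
    finally show ?thesis using XS[of 0 i] by simp
  qed
  have "?f * X k i = X k j * X 0 i" for k i
  proof (induction k arbitrary: i)
    case 0
    show ?case by (simp add: X0)
  next
    case (Suc k)
    have "?f * (?f * X (Suc k) i) = X k j * (?f * X 1 i)" by (simp add: step[OF Suc] algebra_simps)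
    also have "\<dots> = (X k j * X 1 j) * X 0 i" using par[of i] by (simp only: X1 X0 mult_ac)
    also have "\<dots> = ?f * (X (Suc k) j * X 0 i)" using step[OF Suc, of j] by (simp flip: mult.assoc)
    finally show ?case by (rule mult_left_cancel[OF f])
  qed
  then show ?thesis
    using step[of _ j] unfolding geometric_seq_def X1[symmetric] X_def by simp
qed

text \<open>Besides the iterates of \<Phi>, those of its inverse enter: they supply the negative
  powers of \<zeta>, without which \<zeta> could be an arbitrary Laurent polynomial instead of a
  monomial.\<close>

lemma regular_imp_not_parallel:
  fixes \<Phi> :: "'d::finite phase \<Rightarrow> 'd phase"
  assumes \<Phi>: "phase_space_map \<Phi>" and reg: "regular \<Phi>" and \<xi>: "\<xi> \<noteq> 0"
  shows "phase_comp 1 \<xi> * phase_comp 2 (\<Phi> \<xi>) - phase_comp 2 \<xi> * phase_comp 1 (\<Phi> \<xi>) \<noteq> 0"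
proof
  assume "phase_comp 1 \<xi> * phase_comp 2 (\<Phi> \<xi>) - phase_comp 2 \<xi> * phase_comp 1 (\<Phi> \<xi>) = 0"
  then have eq: "phase_comp 1 \<xi> * phase_comp 2 (\<Phi> \<xi>) = phase_comp 2 \<xi> * phase_comp 1 (\<Phi> \<xi>)" by simp
  obtain \<tau> :: "real^'d" where \<tau>: "inj (\<lambda>y. angle y \<tau>)" by (rule ex_rationally_independent)
  interpret ordering_hom2 "\<lambda>y. angle y \<tau>" by (rule ordering_hom2_angle[OF \<tau>])
  have oh: "ordering_hom (\<lambda>y. angle y \<tau>)" ..
  have par: "phase_comp j \<xi> * phase_comp i (\<Phi> \<xi>) = phase_comp j (\<Phi> \<xi>) * phase_comp i \<xi>" for i j
    using exhaust_2[of i] exhaust_2[of j] eq by (auto simp: mult_ac)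
  obtain j where f: "phase_comp j \<xi> \<noteq> 0"
    using \<xi> phase_eqI[of \<xi> 0] by (metis phase_comp_def map_eq_zero_iff keys_zero empty_iff)
  have i: "\<Phi> (inv \<Phi> x) = x" "inv \<Phi> (\<Phi> x) = x" for x
    using \<Phi> by (simp_all add: phase_space_map_def bij_is_surj surj_f_inv_f bij_is_inj inv_f_f)
  note \<Psi> = phase_space_map_inv[OF \<Phi>]
  let ?f = "phase_comp j \<xi>" and ?F1 = "phase_comp j (\<Phi> \<xi>)"
  \<comment> \<open>The inverse of \<Phi> applied to \<open>par\<close>: in the fraction field this
    reads \<open>\<xi> = \<zeta> (inv \<Phi> \<xi>)\<close>.\<close>
  have bk: "?f * phase_comp i \<xi> = ?F1 * phase_comp i (inv \<Phi> \<xi>)" for i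
  proof -
    have "?f * phase_comp i (inv \<Phi> (\<Phi> \<xi>)) = transfer_entry (inv \<Phi>) i 1 * (?f * phase_comp 1 (\<Phi> \<xi>))
        + transfer_entry (inv \<Phi>) i 2 * (?f * phase_comp 2 (\<Phi> \<xi>))"
      by (subst phase_comp_apply[OF \<Psi>]) (simp add: algebra_simps)
    also have "\<dots> = ?F1 * phase_comp i (inv \<Phi> \<xi>)"
      by (simp only: par phase_comp_apply[OF \<Psi>, of i \<xi>]) (simp add: algebra_simps)
    finally show ?thesis by (simp add: i)
  qed
  have F1: "?F1 \<noteq> 0"
    using bk[of j] f by (auto simp: mult_eq_0_iff')
  have par': "?f * phase_comp i (inv \<Phi> \<xi>) = phase_comp j (inv \<Phi> \<xi>) * phase_comp i \<xi>" for i
  proof (rule mult_left_cancel[OF F1])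
    have "?F1 * (?f * phase_comp i (inv \<Phi> \<xi>)) = ?f * (?F1 * phase_comp i (inv \<Phi> \<xi>))" by (simp only: mult_ac)
    also have "\<dots> = ?f * ?f * phase_comp i \<xi>" by (simp only: bk[symmetric] mult.assoc)
    also have "\<dots> = ?F1 * (phase_comp j (inv \<Phi> \<xi>) * phase_comp i \<xi>)" by (simp only: bk[of j] mult.assoc)
    finally show "?F1 * (?f * phase_comp i (inv \<Phi> \<xi>)) = ?F1 * (phase_comp j (inv \<Phi> \<xi>) * phase_comp i \<xi>)" .
  qed
  obtain r a where r: "r \<noteq> 0" and ra: "?F1 = Poly_Mapping.single a r * ?f"
  proof (rule geometric_seq_monomial[OF phase_comp_iterate_geometric[OF oh \<Phi> f par]
        phase_comp_iterate_geometric[OF oh \<Psi> f par'] f])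
    show "phase_comp j ((\<Phi> ^^ 1) \<xi>) * phase_comp j ((inv \<Phi> ^^ 1) \<xi>) = ?f * ?f"
      using bk[of j] by simp
  qed (auto intro: that)
  have "phase_comp i (\<Phi> \<xi>) = Poly_Mapping.single a r * phase_comp i \<xi>" for i
    by (rule mult_left_cancel[OF f]) (simp only: par ra mult_ac)
  then have "val (\<Phi> \<xi>) x $ i = r * val \<xi> (x - a) $ i" for x i
    using val_phase_comp[of i "\<Phi> \<xi>" x] by (simp add: lookup_mult_superset[of "{a}"])
  then have "\<Phi> \<xi> = r *\<^sub>R translate a \<xi>"
    by (intro poly_mapping_eqI) (simp add: vec_eq_iff val_translate)
  then show False using reg \<xi> r by (auto simp: regular_def)
qed

section \<open>The characteristic polynomial of the symbol\<close>

lemma eigenvalue_2x2: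
  fixes A :: "complex^2^2"
  assumes "\<zeta>\<^sup>2 - (A $ 1 $ 1 + A $ 2 $ 2) * \<zeta> + (A $ 1 $ 1 * A $ 2 $ 2 - A $ 1 $ 2 * A $ 2 $ 1) = 0"
  shows "eigenvalue A \<zeta>"
proof -
  define a b c d where "a = A $ 1 $ 1" "b = A $ 1 $ 2" "c = A $ 2 $ 1" "d = A $ 2 $ 2"
  note abcd = this
  have eq: "\<zeta> * \<zeta> + (a * d - b * c) = (a + d) * \<zeta>"
    using assms by (simp add: abcd power2_eq_square algebra_simps)
  have I: "eigenvalue A \<zeta>" if "w \<noteq> 0" "a * w $ 1 + b * w $ 2 = \<zeta> * w $ 1" "c * w $ 1 + d * w $ 2 = \<zeta> * w $ 2"
    for w :: "complex^2"
    using that unfolding eigenvalue_def abcd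
    by (intro exI[of _ w]) (simp add: vec_eq_iff forall_2 matrix_vector_mult_def sum_2)
  have nz: "vector [x, y] \<noteq> (0::complex^2) \<longleftrightarrow> x \<noteq> 0 \<or> y \<noteq> 0" for x y
    by (simp add: vec_eq_iff forall_2 vector_2)
  \<comment> \<open>The vector \<open>(b, \<zeta> - a)\<close> solves the first row and
    \<open>(\<zeta> - d, c)\<close> the second; the characteristic equation gives the other row.
    Both vanish only for a scalar matrix, for which every vector works.\<close>
  consider "b \<noteq> 0 \<or> \<zeta> - a \<noteq> 0" | "\<zeta> - d \<noteq> 0 \<or> c \<noteq> 0" | "b = 0" "\<zeta> = a" "c = 0" "\<zeta> = d" by auto
  then show ?thesis
  proof cases
    case 1
    then show ?thesis
      by (intro I[of "vector [b, \<zeta> - a]"]) (use eq in \<open>auto simp: nz algebra_simps\<close>)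
  next
    case 2
    then show ?thesis
      by (intro I[of "vector [\<zeta> - d, c]"]) (use eq in \<open>auto simp: nz algebra_simps\<close>)
  next
    case 3
    then show ?thesis
      by (intro I[of "vector [1, 0]"]) (auto simp: nz)
  qed
qed

lemma ex_roots_sum_prod:
  obtains z w :: complex where "z + w = t" "z * w = D"
proof -
  define s where "s = csqrt (t\<^sup>2 - 4 * D)"
  have "s\<^sup>2 = t\<^sup>2 - 4 * D" by (simp add: s_def)
  then have "((t + s) / 2) * ((t - s) / 2) = D"
    by (simp add: power2_eq_square field_simps)
  then show ?thesis using that[of "(t + s) / 2" "(t - s) / 2"] by (simp add: field_simps)
qed

text \<open>The modulus of the characteristic polynomial has a positive minimum on the compact unit
  circle, and small changes of its two coefficients move the values there by less than this minimum.
  So the absence of unimodular eigenvalues survives near the hyperbolic point.\<close>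

lemma no_unit_root_open:
  fixes t D :: "real \<Rightarrow> complex"
  assumes "isCont t 0" "isCont D 0" and nz: "\<And>z. cmod z = 1 \<Longrightarrow> z\<^sup>2 - t 0 * z + D 0 \<noteq> 0"
  obtains \<epsilon> where "\<epsilon> > 0" "\<And>x z. \<bar>x\<bar> < \<epsilon> \<Longrightarrow> cmod z = 1 \<Longrightarrow> z\<^sup>2 - t x * z + D x \<noteq> 0"
proof -
  have "\<exists>z\<in>sphere 0 1. \<forall>w\<in>sphere 0 1. cmod (z\<^sup>2 - t 0 * z + D 0) \<le> cmod (w\<^sup>2 - t 0 * w + D 0)"
    by (intro continuous_attains_inf) (auto intro!: continuous_intros)
  then obtain z0 where z0: "cmod z0 = 1"
      "\<And>w. cmod w = 1 \<Longrightarrow> cmod (z0\<^sup>2 - t 0 * z0 + D 0) \<le> cmod (w\<^sup>2 - t 0 * w + D 0)"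
    by (auto simp: dist_norm)
  define m where "m = cmod (z0\<^sup>2 - t 0 * z0 + D 0)"
  have m: "m > 0" using nz[OF z0(1)] by (simp add: m_def)
  obtain d1 where d1: "d1 > 0" "\<And>x. \<bar>x\<bar> < d1 \<Longrightarrow> cmod (t x - t 0) < m / 2"
    using assms(1) m unfolding continuous_at_eps_delta dist_norm
    by (metis diff_0_right half_gt_zero real_norm_def)
  obtain d2 where d2: "d2 > 0" "\<And>x. \<bar>x\<bar> < d2 \<Longrightarrow> cmod (D x - D 0) < m / 2"
    using assms(2) m unfolding continuous_at_eps_delta dist_norm
    by (metis diff_0_right half_gt_zero real_norm_def)
  show ?thesis
  proof (rule that[of "min d1 d2"])
    fix x z assume x: "\<bar>x\<bar> < min d1 d2" and z: "cmod z = 1"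
    show "z\<^sup>2 - t x * z + D x \<noteq> 0"
    proof
      assume eq: "z\<^sup>2 - t x * z + D x = 0"
      have "z\<^sup>2 - t 0 * z + D 0 = (t x - t 0) * z - (D x - D 0)"
        using eq by (simp add: algebra_simps)
      then have "cmod (z\<^sup>2 - t 0 * z + D 0) \<le> cmod (t x - t 0) + cmod (D x - D 0)"
        by (metis norm_triangle_ineq4 norm_mult z mult.right_neutral)
      also have "\<dots> < m" using d1(2)[of x] d2(2)[of x] x by simp
      finally show False using z0(2)[OF z] by (simp add: m_def)
    qed
  qed (use d1 d2 in auto)
qed

section \<open>Growth of the iterates in phase space\<close>

lemma poly_over_exponential_tendsto_0:
  fixes b :: real
  assumes "b > 1"
  shows "(\<lambda>k. real (Suc k) ^ n / b ^ k) \<longlonglongrightarrow> 0"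
proof -
  define L where "L = ln b"
  have L: "L > 0" using assms by (simp add: L_def)
  have "filterlim (\<lambda>k. real (Suc k) * L) at_top sequentially"
    using L by (intro filterlim_tendsto_pos_mult_at_top[OF tendsto_const] filterlim_compose[OF filterlim_real_sequentially filterlim_Suc]
        | subst mult.commute)+
  then have "(\<lambda>k. (real (Suc k) * L) ^ n / exp (real (Suc k) * L)) \<longlonglongrightarrow> 0"
    by (rule filterlim_compose[OF tendsto_power_div_exp_0])
  then have "(\<lambda>k. b / L ^ n * ((real (Suc k) * L) ^ n / exp (real (Suc k) * L))) \<longlonglongrightarrow> b / L ^ n * 0"
    by (rule tendsto_mult_left)
  moreover have "exp (real (Suc k) * L) = b * b ^ k" for k
    using assms unfolding L_def exp_of_nat_mult by simp
  then have "b / L ^ n * ((real (Suc k) * L) ^ n / exp (real (Suc k) * L)) = real (Suc k) ^ n / b ^ k" for k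
    using L assms unfolding power_mult_distrib by (simp add: divide_simps del: of_nat_Suc)
  ultimately show ?thesis by (simp only: mult_zero_right)
qed

lemma card_box_le:
  "finite {y::'d::finite lattice. \<forall>i. \<bar>y $ i\<bar> \<le> int N}"
  "card {y::'d lattice. \<forall>i. \<bar>y $ i\<bar> \<le> int N} \<le> (2 * N + 1) ^ CARD('d)"
proof -
  let ?B = "{y::'d lattice. \<forall>i. \<bar>y $ i\<bar> \<le> int N}"
  let ?P = "PiE (UNIV::'d set) (\<lambda>_. {- int N..int N})"
  have inj: "inj_on vec_nth ?B" by (auto simp: inj_on_def vec_eq_iff)
  have sub: "vec_nth ` ?B \<subseteq> ?P" by (auto simp: abs_le_iff) (smt (verit))
  have fin: "finite ?P" by (intro finite_PiE) auto
  show "finite ?B" using finite_imageD[OF finite_subset[OF sub fin] inj] .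
  have "card ?B \<le> card ?P" using card_inj_on_le[OF inj sub fin] .
  also have "card ?P = card {- int N..int N} ^ CARD('d)" by (simp add: card_PiE)
  also have "card {- int N..int N} = 2 * N + 1" unfolding card_atLeastAtMost_int by linarith
  finally show "card ?B \<le> (2 * N + 1) ^ CARD('d)" .
qed

lemma finite_lattice_bounded:
  fixes S :: "'d::finite lattice set"
  assumes "finite S"
  obtains N :: nat where "\<And>y i. y \<in> S \<Longrightarrow> \<bar>y $ i\<bar> \<le> int N"
proof -
  have "\<bar>y $ i\<bar> \<le> int (\<Sum>y\<in>S. \<Sum>i\<in>UNIV. nat \<bar>y $ i\<bar>)" if "y \<in> S" for y i
  proof -
    have "nat \<bar>y $ i\<bar> \<le> (\<Sum>i\<in>UNIV. nat \<bar>y $ i\<bar>)" by (rule member_le_sum) auto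
    also have "\<dots> \<le> (\<Sum>y\<in>S. \<Sum>i\<in>UNIV. nat \<bar>y $ i\<bar>)" using assms that by (intro member_le_sum) auto
    finally show ?thesis by linarith
  qed
  then show ?thesis using that by blast
qed

text \<open>Each step enlarges a box around the support by the fixed range of \<Phi>, so the side
  length grows linearly in \<open>k\<close>.\<close>

lemma card_supp_iterate:
  fixes \<Phi> :: "'d::finite phase \<Rightarrow> 'd phase"
  assumes "phase_space_map \<Phi>"
  obtains M where "M > 0" "\<And>k. real (card (supp ((\<Phi> ^^ k) \<xi>))) \<le> M * real (Suc k) ^ CARD('d)"
proof -
  obtain S where S: "finite S" "\<And>\<xi>. supp (\<Phi> \<xi>) \<subseteq> {x + s |x s. x \<in> supp \<xi> \<and> s \<in> S}"
    using assms unfolding phase_space_map_def by blast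
  obtain R where R: "\<And>y i. y \<in> S \<Longrightarrow> \<bar>y $ i\<bar> \<le> int R" using finite_lattice_bounded[OF S(1)] by blast
  obtain R0 where R0: "\<And>y i. y \<in> supp \<xi> \<Longrightarrow> \<bar>y $ i\<bar> \<le> int R0"
    using finite_lattice_bounded[OF finite_keys] by blast
  have sub: "supp ((\<Phi> ^^ k) \<xi>) \<subseteq> {y. \<forall>i. \<bar>y $ i\<bar> \<le> int (R0 + k * R)}" for k
  proof (induction k)
    case 0
    then show ?case using R0 by auto
  next
    case (Suc k)
    show ?case
    proof
      fix y assume "y \<in> supp ((\<Phi> ^^ Suc k) \<xi>)"
      then obtain x s where xs: "y = x + s" "x \<in> supp ((\<Phi> ^^ k) \<xi>)" "s \<in> S"
        using S(2)[of "(\<Phi> ^^ k) \<xi>"] by auto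
      have "\<bar>y $ i\<bar> \<le> int (R0 + Suc k * R)" for i
      proof -
        have "\<bar>x $ i\<bar> \<le> int (R0 + k * R)" using Suc xs(2) by blast
        then show ?thesis using R[OF xs(3), of i] by (simp add: xs(1) algebra_simps)
      qed
      then show "y \<in> {y. \<forall>i. \<bar>y $ i\<bar> \<le> int (R0 + Suc k * R)}" by blast
    qed
  qed
  define M where "M = 2 * R0 + 2 * R + 1"
  have "real (card (supp ((\<Phi> ^^ k) \<xi>))) \<le> real M ^ CARD('d) * real (Suc k) ^ CARD('d)" for k
  proof -
    have "card (supp ((\<Phi> ^^ k) \<xi>)) \<le> (2 * (R0 + k * R) + 1) ^ CARD('d)"
      using card_mono[OF card_box_le(1) sub] card_box_le(2) by (rule le_trans)
    also have "\<dots> \<le> (M * Suc k) ^ CARD('d)"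
      by (intro power_mono) (auto simp: M_def algebra_simps)
    finally have "real (card (supp ((\<Phi> ^^ k) \<xi>))) \<le> real ((M * Suc k) ^ CARD('d))" by (rule of_nat_mono)
    then show ?thesis by (simp only: power_mult_distrib of_nat_mult of_nat_power)
  qed
  then show ?thesis using that[of "real M ^ CARD('d)"] by (simp add: M_def)
qed

text \<open>The combination \<open>f (Suc k) - w * f k\<close> filters out the mode of the root
  \<open>w\<close> and is geometric with ratio \<open>z\<close>.\<close>

lemma two_term_recurrence_lower_bound:
  fixes f :: "nat \<Rightarrow> complex"
  assumes "\<And>k. f (Suc (Suc k)) = (z + w) * f (Suc k) - z * w * f k"
  shows "cmod z ^ k * cmod (f 1 - w * f 0) \<le> cmod (f (Suc k)) + cmod w * cmod (f k)"
proof -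
  have eq: "f (Suc k) - w * f k = z ^ k * (f 1 - w * f 0)" for k
  proof (induction k)
    case (Suc k)
    have "f (Suc (Suc k)) - w * f (Suc k) = z * (f (Suc k) - w * f k)"
      by (simp only: assms[of k]) (simp add: algebra_simps)
    then show ?case by (simp only: Suc power_Suc mult.assoc)
  qed simp
  have "cmod z ^ k * cmod (f 1 - w * f 0) = cmod (f (Suc k) - w * f k)"
    by (simp only: eq norm_mult norm_power)
  also have "\<dots> \<le> cmod (f (Suc k)) + cmod w * cmod (f k)"
    using norm_triangle_ineq4[of "f (Suc k)" "w * f k"] by (simp add: norm_mult)
  finally show ?thesis .
qed

theorem phase_space_iterates_unbounded:
  fixes \<Phi> :: "'d::finite phase \<Rightarrow> 'd phase"
  assumes \<Phi>: "phase_space_map \<Phi>" and sympl: "\<And>\<xi> \<eta>. sympl (\<Phi> \<xi>) (\<Phi> \<eta>) = sympl \<xi> \<eta>"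
    and reg: "regular \<Phi>" and hyp: "locally_hyperbolic \<Phi>" and \<xi>: "\<xi> \<noteq> 0"
  shows "\<forall>\<^sub>F k in sequentially. \<exists>x i. \<bar>val ((\<Phi> ^^ k) \<xi>) x $ i\<bar> \<ge> C"
proof -
  obtain \<theta>0 \<delta> where \<delta>: "\<delta> > 0"
    and noev: "\<And>\<zeta>. eigenvalue (symbol \<Phi> \<theta>0) \<zeta> \<Longrightarrow> \<not> (exp (- \<delta>) < cmod \<zeta> \<and> cmod \<zeta> < exp \<delta>)"
    using hyp unfolding locally_hyperbolic_def by blast
  obtain \<tau> :: "real^'d" where \<tau>: "inj (\<lambda>y. angle y \<tau>)" by (rule ex_rationally_independent)
  define s where "s \<theta> i j = fourier \<theta> (transfer_entry \<Phi> i j)" for \<theta> i j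
  define t where "t \<theta> = s \<theta> 1 1 + s \<theta> 2 2" for \<theta>
  define D where "D \<theta> = s \<theta> 1 1 * s \<theta> 2 2 - s \<theta> 1 2 * s \<theta> 2 1" for \<theta>
  have sym: "symbol \<Phi> \<theta> $ i $ j = s \<theta> i j" for \<theta> i j
    by (simp add: s_def symbol_eq_fourier[OF \<Phi>])
  have D1: "cmod (D \<theta>) = 1" for \<theta>
    using cmod_det_symbol[OF \<Phi> sympl, of \<theta>] by (simp add: sym D_def)
  obtain \<epsilon> where \<epsilon>: "\<epsilon> > 0"
    and nz: "\<And>x z. \<bar>x\<bar> < \<epsilon> \<Longrightarrow> cmod z = 1 \<Longrightarrow> z\<^sup>2 - t (\<theta>0 + x *\<^sub>R \<tau>) * z + D (\<theta>0 + x *\<^sub>R \<tau>) \<noteq> 0"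
  proof (rule no_unit_root_open)
    show "isCont (\<lambda>x. t (\<theta>0 + x *\<^sub>R \<tau>)) 0" "isCont (\<lambda>x. D (\<theta>0 + x *\<^sub>R \<tau>)) 0"
      unfolding t_def D_def s_def by (intro continuous_intros isCont_fourier_line)+
  next
    fix z :: complex assume z: "cmod z = 1"
    show "z\<^sup>2 - t (\<theta>0 + 0 *\<^sub>R \<tau>) * z + D (\<theta>0 + 0 *\<^sub>R \<tau>) \<noteq> 0"
      using noev[OF eigenvalue_2x2, of z] z \<delta> by (auto simp: sym t_def D_def)
  qed blast
  \<comment> \<open>On the torus \<open>p\<close> is the determinant of the transform of
    \<open>\<xi>\<close> and its image under the symbol, so \<open>px\<close> below is their linear
    independence.\<close>
  define p where "p = phase_comp 1 \<xi> * phase_comp 2 (\<Phi> \<xi>) - phase_comp 2 \<xi> * phase_comp 1 (\<Phi> \<xi>)"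
  have "p \<noteq> 0" unfolding p_def by (rule regular_imp_not_parallel[OF \<Phi> reg \<xi>])
  then obtain x where x: "\<bar>x\<bar> < \<epsilon>" and px: "fourier (\<theta>0 + x *\<^sub>R \<tau>) p \<noteq> 0"
    using fourier_zero_imp_zero[OF \<tau> \<epsilon>] by blast
  define \<theta> where "\<theta> = \<theta>0 + x *\<^sub>R \<tau>"
  obtain z w where zw: "z + w = t \<theta>" "z * w = D \<theta>" "cmod z > 1" "cmod w \<le> 1"
  proof -
    obtain z w where zw: "z + w = t \<theta>" "z * w = D \<theta>" by (rule ex_roots_sum_prod)
    have "z\<^sup>2 - t \<theta> * z + D \<theta> = 0"
      by (simp add: zw[symmetric] algebra_simps power2_eq_square)
    then have "cmod z \<noteq> 1" using nz[OF x] by (auto simp: \<theta>_def)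
    have zw1: "cmod z * cmod w = 1" using D1 zw(2) by (metis norm_mult)
    then have z0: "cmod z > 0" by auto
    have inv: "cmod w = inverse (cmod z)" using inverse_unique[OF zw1] by simp
    have "cmod z > 1 \<and> cmod w \<le> 1 \<or> cmod w > 1 \<and> cmod z \<le> 1"
      unfolding inv inverse_le_1_iff one_less_inverse_iff using z0 \<open>cmod z \<noteq> 1\<close> by linarith
    then show ?thesis using that[of z w] that[of w z] zw by (auto simp: ac_simps)
  qed
  define f where "f i k = fourier \<theta> (phase_comp i ((\<Phi> ^^ k) \<xi>))" for i k
  have fS: "f i (Suc k) = s \<theta> i 1 * f 1 k + s \<theta> i 2 * f 2 k" for i k
    by (simp add: f_def phase_comp_apply[OF \<Phi>] fourier_add fourier_mult s_def)
  \<comment> \<open>Cayley-Hamilton for the symbol at \<theta>, whose trace is \<open>z + w\<close>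
    and whose determinant is \<open>z * w\<close>.\<close>
  have rec: "f i (Suc (Suc k)) = (z + w) * f i (Suc k) - z * w * f i k" for i k
    using exhaust_2[of i] unfolding zw t_def D_def by (auto simp: fS algebra_simps)
  \<comment> \<open>If \<open>f i 1 = w * f i 0\<close> held for both components, the transform and
    its image would be parallel, contrary to \<open>px\<close>. So some component contains the
    growing mode.\<close>
  obtain i0 where i0: "f i0 1 - w * f i0 0 \<noteq> 0"
  proof -
    have "fourier \<theta> p = f 1 0 * f 2 1 - f 2 0 * f 1 1"
      by (simp add: p_def f_def fourier_diff fourier_mult)
    also have "\<dots> = f 1 0 * (f 2 1 - w * f 2 0) - f 2 0 * (f 1 1 - w * f 1 0)" by (simp add: algebra_simps)
    finally have "f 1 1 - w * f 1 0 \<noteq> 0 \<or> f 2 1 - w * f 2 0 \<noteq> 0"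
      using px by (auto simp: \<theta>_def)
    then show ?thesis using that by blast
  qed
  define c where "c = cmod (f i0 1 - w * f i0 0)"
  have c: "c > 0" using i0 by (simp add: c_def)
  define n where "n k = cmod (f 1 k) + cmod (f 2 k)" for k
  \<comment> \<open>Row \<open>i0\<close> of the symbol bounds \<open>f i0 (Suc k)\<close> by its
    two entries times \<open>n k\<close>; the summand 1 accounts for \<open>w * f i0 k\<close>, as
    \<open>cmod w \<le> 1\<close>.\<close>
  define K where "K = 1 + cmod (s \<theta> i0 1) + cmod (s \<theta> i0 2)"
  have lower: "cmod z ^ k * c \<le> K * n k" for k
  proof -
    have "cmod (f i0 (Suc k)) \<le> cmod (s \<theta> i0 1) * cmod (f 1 k) + cmod (s \<theta> i0 2) * cmod (f 2 k)"
      unfolding fS by (rule order_trans[OF norm_triangle_ineq]) (simp add: norm_mult)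
    also have "\<dots> \<le> cmod (s \<theta> i0 1) * n k + cmod (s \<theta> i0 2) * n k"
      unfolding n_def by (intro add_mono mult_left_mono) auto
    finally have "cmod (f i0 (Suc k)) \<le> cmod (s \<theta> i0 1) * n k + cmod (s \<theta> i0 2) * n k" .
    moreover have "cmod (f i0 k) \<le> n k"
      using exhaust_2[of i0] by (auto simp: n_def)
    then have "cmod w * cmod (f i0 k) \<le> 1 * n k"
      using zw(4) by (intro mult_mono) auto
    ultimately show ?thesis
      using two_term_recurrence_lower_bound[of "f i0" z w k, OF rec]
      by (simp add: K_def c_def algebra_simps)
  qed
  have K: "K > 0" by (simp add: K_def add_pos_nonneg)
  obtain M where M: "M > 0" "\<And>k. real (card (supp ((\<Phi> ^^ k) \<xi>))) \<le> M * real (Suc k) ^ CARD('d)"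
    using card_supp_iterate[OF \<Phi>] by blast
  have upper: "n k \<le> 2 * \<bar>C\<bar> * (M * real (Suc k) ^ CARD('d))"
    if "\<not> (\<exists>x i. \<bar>val ((\<Phi> ^^ k) \<xi>) x $ i\<bar> \<ge> C)" for k
  proof -
    have "cmod (f i k) \<le> (M * real (Suc k) ^ CARD('d)) * \<bar>C\<bar>" for i
    proof -
      have "cmod (f i k) \<le> (\<Sum>y\<in>supp (phase_comp i ((\<Phi> ^^ k) \<xi>)). \<bar>val (phase_comp i ((\<Phi> ^^ k) \<xi>)) y\<bar>)"
        unfolding f_def by (rule norm_fourier_le)
      also have "\<dots> \<le> (\<Sum>y\<in>supp (phase_comp i ((\<Phi> ^^ k) \<xi>)). \<bar>C\<bar>)"
      proof (rule sum_mono)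
        fix y
        have "\<bar>val ((\<Phi> ^^ k) \<xi>) y $ i\<bar> < C" using that by (meson not_le)
        then show "\<bar>val (phase_comp i ((\<Phi> ^^ k) \<xi>)) y\<bar> \<le> \<bar>C\<bar>" by simp
      qed
      also have "\<dots> = real (card (supp (phase_comp i ((\<Phi> ^^ k) \<xi>)))) * \<bar>C\<bar>" by simp
      also have "\<dots> \<le> real (card (supp ((\<Phi> ^^ k) \<xi>))) * \<bar>C\<bar>"
        by (intro mult_right_mono of_nat_mono card_mono supp_phase_comp) auto
      also have "\<dots> \<le> (M * real (Suc k) ^ CARD('d)) * \<bar>C\<bar>"
        by (intro mult_right_mono M) auto
      finally show ?thesis .
    qed
    from this[of 1] this[of 2] show ?thesis by (simp only: n_def mult.commute[of _ "\<bar>C\<bar>"])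
  qed
  have "(\<lambda>k. K * (2 * \<bar>C\<bar> * M) * (real (Suc k) ^ CARD('d) / cmod z ^ k)) \<longlonglongrightarrow> K * (2 * \<bar>C\<bar> * M) * 0"
    by (intro tendsto_mult_left poly_over_exponential_tendsto_0 zw)
  then have "\<forall>\<^sub>F k in sequentially. K * (2 * \<bar>C\<bar> * M) * (real (Suc k) ^ CARD('d) / cmod z ^ k) < c"
    using c by (intro order_tendstoD(2)) auto
  then show ?thesis
  proof (rule eventually_mono)
    fix k assume k: "K * (2 * \<bar>C\<bar> * M) * (real (Suc k) ^ CARD('d) / cmod z ^ k) < c"
    have "cmod z ^ k > 0" using zw(3) by (intro zero_less_power) linarith
    then have k': "K * (2 * \<bar>C\<bar> * (M * real (Suc k) ^ CARD('d))) < cmod z ^ k * c"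
      using k by (simp add: field_simps)
    show "\<exists>x i. \<bar>val ((\<Phi> ^^ k) \<xi>) x $ i\<bar> \<ge> C"
    proof (rule ccontr)
      assume "\<not> ?thesis"
      then have "K * n k \<le> K * (2 * \<bar>C\<bar> * (M * real (Suc k) ^ CARD('d)))"
        using K by (intro mult_left_mono upper) auto
      then show False using lower[of k] k' by linarith
    qed
  qed
qed

section \<open>States and Weyl operators\<close>

lemma state_linear: "state \<omega> \<Longrightarrow> \<omega> (a + b) = \<omega> a + \<omega> b" "state \<omega> \<Longrightarrow> \<omega> (c *\<^sub>C a) = c * \<omega> a"
  unfolding state_def by (metis Vector_Spaces.linear_iff)+

text \<open>The quadratic is a positive form evaluated at \<open>a + t * cnj z * b\<close> with
  mixed term \<open>z\<close>; putting the phase into the coefficient leaves a real variable. The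
  optimal \<open>t\<close> is \<open>-1 / y\<close>, and for \<open>y = 0\<close> the linear term
  forces \<open>z = 0\<close>. It yields Cauchy-Schwarz both for states and for
  \<open>psd_form\<close>.\<close>

lemma nonneg_quadratic_imp_le:
  fixes z :: complex
  assumes x: "0 \<le> x" and y: "0 \<le> y"
    and q: "\<And>t::real. 0 \<le> x + 2 * t * (cmod z)\<^sup>2 + t\<^sup>2 * (cmod z)\<^sup>2 * y"
  shows "(cmod z)\<^sup>2 \<le> x * y"
proof (cases "y = 0")
  case True
  have "cmod z = 0"
  proof (rule ccontr)
    assume z: "cmod z \<noteq> 0"
    have "0 \<le> x + 2 * (- (x + 1) / (cmod z)\<^sup>2) * (cmod z)\<^sup>2"
      using q[of "- (x + 1) / (cmod z)\<^sup>2"] True by simp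
    then have "x \<le> - 2" using z by simp
    then show False using x by simp
  qed
  then show ?thesis using True by simp
next
  case False
  have "0 \<le> x + 2 * (- 1 / y) * (cmod z)\<^sup>2 + (- 1 / y)\<^sup>2 * (cmod z)\<^sup>2 * y" by (rule q)
  also have "\<dots> = x - (cmod z)\<^sup>2 / y" using False by (simp add: power2_eq_square field_simps)
  finally show ?thesis using False y by (simp add: field_simps)
qed

lemma state_star_mult_self:
  assumes \<omega>: "state \<omega>"
  shows "Im (\<omega> (star a * a)) = 0" "Re (\<omega> (star a * a)) \<ge> 0"
  using assms complex_nonneg_Reals_iff[of "\<omega> (star a * a)"] unfolding state_def by auto

lemma star_one: "star 1 = 1"
  by (metis star_W W_zero add.inverse_neutral)

text \<open>Positivity makes \<omega> real on \<open>star (1 + c a) * (1 + c a)\<close>; comparing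
  \<open>c = 1\<close> with \<open>c = \<i>\<close> gives hermiticity.\<close>

lemma state_star:
  assumes \<omega>: "state \<omega>"
  shows "\<omega> (star a) = cnj (\<omega> a)"
proof -
  have exp: "\<omega> (star (1 + c *\<^sub>C a) * (1 + c *\<^sub>C a)) =
      1 + c * \<omega> a + cnj c * \<omega> (star a) + c * cnj c * \<omega> (star a * a)" for c
  proof -
    have "star (1 + c *\<^sub>C a) * (1 + c *\<^sub>C a) = 1 + c *\<^sub>C a + cnj c *\<^sub>C star a + (c * cnj c) *\<^sub>C (star a * a)"
      by (simp add: star_add star_cscale star_one algebra_simps cscale_mult_left cscale_mult_right)
    then show ?thesis using \<omega> by (simp add: state_linear state_def[of \<omega>])
  qed
  have "Im (c * \<omega> a + cnj c * \<omega> (star a)) = 0" for c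
  proof -
    have "Im (c * cnj c * \<omega> (star a * a)) = 0"
      using state_star_mult_self(1)[OF \<omega>, of a] by (simp add: complex_mult_cnj)
    then show ?thesis
      using state_star_mult_self(1)[OF \<omega>, of "1 + c *\<^sub>C a"]
      by (simp only: exp plus_complex.simps one_complex.simps)
  qed
  from this[of 1] this[of \<i>] show ?thesis by (simp add: complex_eq_iff)
qed

lemma state_Cauchy_Schwarz:
  assumes \<omega>: "state \<omega>"
  shows "(cmod (\<omega> (star a * b)))\<^sup>2 \<le> Re (\<omega> (star a * a)) * Re (\<omega> (star b * b))"
proof -
  define x y z where "x = Re (\<omega> (star a * a))" and "y = Re (\<omega> (star b * b))" and "z = \<omega> (star a * b)"
  have zc: "\<omega> (star b * a) = cnj z"
    using state_star[OF \<omega>, of "star a * b"] by (simp add: star_mult star_star z_def)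
  have xx: "\<omega> (star a * a) = of_real x" and yy: "\<omega> (star b * b) = of_real y"
    using state_star_mult_self[OF \<omega>] by (simp_all add: x_def y_def complex_eq_iff)
  have q: "0 \<le> x + 2 * t * (cmod z)\<^sup>2 + t\<^sup>2 * (cmod z)\<^sup>2 * y" for t :: real
  proof -
    define c where "c = of_real t * cnj z"
    have "star (a + c *\<^sub>C b) * (a + c *\<^sub>C b) =
        star a * a + c *\<^sub>C (star a * b) + cnj c *\<^sub>C (star b * a) + (c * cnj c) *\<^sub>C (star b * b)"
      by (simp add: star_add star_cscale algebra_simps cscale_mult_left cscale_mult_right)
    then have "\<omega> (star (a + c *\<^sub>C b) * (a + c *\<^sub>C b)) = of_real x + c * z + cnj c * cnj z + c * cnj c * of_real y"
      using \<omega> by (simp add: state_linear zc z_def[symmetric] xx yy)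
    also have "\<dots> = of_real x + 2 * of_real t * (z * cnj z) + of_real t ^ 2 * (z * cnj z) * of_real y"
      by (simp add: c_def power2_eq_square algebra_simps)
    also have "\<dots> = of_real (x + 2 * t * (cmod z)\<^sup>2 + t\<^sup>2 * (cmod z)\<^sup>2 * y)"
      by (simp add: complex_norm_square[symmetric])
    finally show ?thesis
      using state_star_mult_self(2)[OF \<omega>, of "a + c *\<^sub>C b"] by simp
  qed
  have "(cmod z)\<^sup>2 \<le> x * y"
    by (rule nonneg_quadratic_imp_le[OF _ _ q]) (simp_all add: x_def y_def state_star_mult_self(2)[OF \<omega>])
  then show ?thesis by (simp add: x_def y_def z_def)
qed

text \<open>If \<open>W(\<xi>)\<close> and \<open>W(\<eta>)\<close> anticommute, then \<open>2 W(\<xi>) = W(\<xi>)(1 - W(\<eta>)) + (1 - W(\<eta>))W(\<xi>)\<close>, and both terms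
  are small in a state that does not distinguish \<open>W(\<eta>)\<close> from \<open>1\<close>.\<close>

lemma state_W_le:
  assumes \<omega>: "state \<omega>" and pi: "sympl \<xi> \<eta> = pi"
  shows "(cmod (\<omega> (W \<xi>)))\<^sup>2 \<le> 2 * cmod (\<omega> (W \<eta>) - 1)"
proof -
  have om1: "\<omega> 1 = 1" using \<omega> by (simp add: state_def)
  define b where "b = 1 + (-1) *\<^sub>C W \<eta>"
  define b' where "b' = 1 + (-1) *\<^sub>C W (- \<eta>)"
  have sb: "star b = b'" "star b' = b" unfolding b_def b'_def star_add star_cscale star_W star_one by simp_all
  have WW: "W \<zeta> * W (- \<zeta>) = 1" "W (- \<zeta>) * W \<zeta> = 1" for \<zeta> :: "'a phase"
    by (simp_all add: W_mult W_zero)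
  have bb: "b' * b = 1 + 1 + (-1) *\<^sub>C W \<eta> + (-1) *\<^sub>C W (- \<eta>)" "b * b' = 1 + 1 + (-1) *\<^sub>C W \<eta> + (-1) *\<^sub>C W (- \<eta>)"
    by (simp_all add: b_def b'_def algebra_simps cscale_mult_left cscale_mult_right WW)
  \<comment> \<open>\<open>e\<close> is the value of \<omega> at \<open>star b * b\<close>, the
    squared size of \<open>1 - W(\<eta>)\<close> in the state.\<close>
  define e where "e = 2 - 2 * Re (\<omega> (W \<eta>))"
  have "\<omega> (W (- \<eta>)) = cnj (\<omega> (W \<eta>))" by (simp add: state_star[OF \<omega>] flip: star_W)
  then have be: "Re (\<omega> (b' * b)) = e" "Re (\<omega> (b * b')) = e"
    unfolding bb e_def state_linear[OF \<omega>] om1 by simp_all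
  \<comment> \<open>The two orders carry the phases \<open>exp (\<i> pi / 2)\<close> and
    \<open>exp (- \<i> pi / 2)\<close>, which differ by a sign; this is why the symplectic product
    is taken to be \<open>pi\<close>.\<close>
  have anti: "W \<eta> * W \<xi> = (-1) *\<^sub>C (W \<xi> * W \<eta>)"
  proof -
    have "exp (\<i> / 2 * of_real (sympl \<eta> \<xi>)) = - exp (\<i> / 2 * of_real (sympl \<xi> \<eta>))"
    proof -
      have "exp (\<i> / 2 * of_real pi) = exp (\<i> * of_real pi + (\<i> / 2 * of_real (- pi)))"
        by (simp add: field_simps)
      also have "\<dots> = - exp (\<i> / 2 * of_real (- pi))" unfolding exp_add by simp
      finally show ?thesis using pi by (simp add: sympl_swap[of \<eta>])
    qed
    then show ?thesis by (simp add: W_mult add.commute)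
  qed
  have dec: "W \<xi> * b + b * W \<xi> = W \<xi> + W \<xi>"
    by (simp add: b_def algebra_simps cscale_mult_left cscale_mult_right anti)
  have W1: "star (W (- \<xi>)) = W \<xi>" "star (W (- \<xi>)) * W (- \<xi>) = 1" "star (W \<xi>) * W \<xi> = 1" by (simp_all add: star_W WW)
  have n1: "(cmod (\<omega> (W \<xi> * b)))\<^sup>2 \<le> e"
    using state_Cauchy_Schwarz[OF \<omega>, of "W (- \<xi>)" b] unfolding W1 sb be om1 WW by simp
  have n2: "(cmod (\<omega> (b * W \<xi>)))\<^sup>2 \<le> e"
    using state_Cauchy_Schwarz[OF \<omega>, of b' "W \<xi>"] unfolding W1 sb be om1 by simp
  have "2 * \<omega> (W \<xi>) = \<omega> (W \<xi> * b) + \<omega> (b * W \<xi>)"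
    by (simp only: state_linear(1)[OF \<omega>, symmetric] dec) (simp add: state_linear(1)[OF \<omega>])
  then have "2 * cmod (\<omega> (W \<xi>)) \<le> cmod (\<omega> (W \<xi> * b)) + cmod (\<omega> (b * W \<xi>))"
    by (metis norm_mult norm_numeral norm_triangle_ineq)
  also have "\<dots> \<le> sqrt e + sqrt e"
    using n1 n2 by (intro add_mono real_le_rsqrt) auto
  finally have "cmod (\<omega> (W \<xi>)) \<le> sqrt e" by simp
  then have "(cmod (\<omega> (W \<xi>)))\<^sup>2 \<le> (sqrt e)\<^sup>2" by (intro power_mono) auto
  also have "(sqrt e)\<^sup>2 = e" using n1 by (smt (verit) real_sqrt_pow2 zero_le_power2)
  also have "e \<le> 2 * cmod (\<omega> (W \<eta>) - 1)"
    using abs_Re_le_cmod[of "\<omega> (W \<eta>) - 1"] by (simp add: e_def)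
  finally show ?thesis .
qed

section \<open>Gaussian automata\<close>

text \<open>The phases of \<alpha> cancel in the Weyl relations, which leaves only the equality of
  \<open>exp (\<i> / 2 * sympl)\<close> before and after \<Phi>. Real linearity removes the
  ambiguity: rescaling \<open>\<xi>\<close> would turn any defect into the phase -1.\<close>

lemma gaussian_qca_sympl:
  fixes \<alpha> :: "'d::finite weyl \<Rightarrow> 'd weyl"
  assumes "gaussian_qca \<alpha> \<Phi>"
  shows "sympl (\<Phi> \<xi>) (\<Phi> \<eta>) = sympl \<xi> \<eta>"
proof -
  have lin: "linear \<Phi>" using assms by (simp add: gaussian_qca_def phase_space_map_def)
  obtain \<kappa> :: "'d phase \<Rightarrow> real" where \<kappa>: "\<And>\<xi> \<eta>. [\<kappa> (\<xi> + \<eta>) = \<kappa> \<xi> + \<kappa> \<eta>] (rmod (2 * pi))"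
    and \<alpha>: "\<And>\<xi>. \<alpha> (W \<xi>) = exp (\<i> * of_real (\<kappa> \<xi>)) *\<^sub>C W (\<Phi> \<xi>)"
    using assms unfolding gaussian_qca_def by blast
  have mult: "\<alpha> (a * b) = \<alpha> a * \<alpha> b" and al: "Vector_Spaces.linear cscale cscale \<alpha>" for a b
    using assms by (auto simp: gaussian_qca_def star_automorphism_def)
  have scal: "\<alpha> (c *\<^sub>C a) = c *\<^sub>C \<alpha> a" for c a using al by (metis Vector_Spaces.linear_iff)
  have exp_eq: "exp (\<i> / 2 * of_real (sympl \<xi> \<eta>)) = exp (\<i> / 2 * of_real (sympl (\<Phi> \<xi>) (\<Phi> \<eta>)))" for \<xi> \<eta>
  proof -
    obtain n where "\<kappa> (\<xi> + \<eta>) = \<kappa> \<xi> + \<kappa> \<eta> + of_int n * (2 * pi)"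
      using \<kappa>[of \<xi> \<eta>] unfolding rcong_altdef by (metis rcong_altdef rcong_sym mult.commute)
    then have "exp (\<i> * of_real (\<kappa> (\<xi> + \<eta>))) = exp (\<i> * of_real (\<kappa> \<xi>) + \<i> * of_real (\<kappa> \<eta>) + of_real (2 * real_of_int n * pi) * \<i>)"
      by (simp add: algebra_simps)
    also have "\<dots> = exp (\<i> * of_real (\<kappa> \<xi>)) * exp (\<i> * of_real (\<kappa> \<eta>))"
      using exp_integer_2pi[OF Ints_of_int, of n] by (simp only: exp_add mult_1_right)
    finally have k: "exp (\<i> * of_real (\<kappa> (\<xi> + \<eta>))) = exp (\<i> * of_real (\<kappa> \<xi>)) * exp (\<i> * of_real (\<kappa> \<eta>))" .
    have "\<alpha> (W \<xi> * W \<eta>) = (exp (\<i> / 2 * of_real (sympl \<xi> \<eta>)) * exp (\<i> * of_real (\<kappa> (\<xi> + \<eta>)))) *\<^sub>C W (\<Phi> (\<xi> + \<eta>))"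
      by (simp add: W_mult scal \<alpha>)
    moreover have "\<alpha> (W \<xi>) * \<alpha> (W \<eta>) = (exp (\<i> * of_real (\<kappa> \<xi>)) * exp (\<i> * of_real (\<kappa> \<eta>)) *
        exp (\<i> / 2 * of_real (sympl (\<Phi> \<xi>) (\<Phi> \<eta>)))) *\<^sub>C W (\<Phi> (\<xi> + \<eta>))"
      by (simp add: \<alpha> cscale_mult_left cscale_mult_right W_mult linear_add[OF lin])
    ultimately have "coeff_at ((exp (\<i> / 2 * of_real (sympl \<xi> \<eta>)) * exp (\<i> * of_real (\<kappa> (\<xi> + \<eta>)))) *\<^sub>C W (\<Phi> (\<xi> + \<eta>))) (\<Phi> (\<xi> + \<eta>))
       = coeff_at ((exp (\<i> * of_real (\<kappa> \<xi>)) * exp (\<i> * of_real (\<kappa> \<eta>)) *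
        exp (\<i> / 2 * of_real (sympl (\<Phi> \<xi>) (\<Phi> \<eta>)))) *\<^sub>C W (\<Phi> (\<xi> + \<eta>))) (\<Phi> (\<xi> + \<eta>))"
      by (simp only: mult)
    then show ?thesis unfolding k by (simp add: coeff_at_W)
  qed
  have scale: "sympl (s *\<^sub>R \<xi>) \<eta> = s * sympl \<xi> \<eta>" for s and \<xi> \<eta> :: "'d phase"
  proof -
    have "supp (s *\<^sub>R \<xi>) \<union> supp \<eta> \<subseteq> supp \<xi> \<union> supp \<eta>" by (auto simp: in_keys_iff)
    from sympl_superset[OF _ this] show ?thesis
      by (simp add: sympl_def sum_distrib_left right_diff_distrib mult_ac)
  qed
  show ?thesis
  proof (rule ccontr)
    define D where "D = sympl (\<Phi> \<xi>) (\<Phi> \<eta>) - sympl \<xi> \<eta>"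
    assume "\<not> ?thesis"
    then have D: "D \<noteq> 0" by (simp add: D_def)
    define s where "s = 2 * pi / D"
    have "exp (\<i> / 2 * of_real (s * sympl \<xi> \<eta>)) = exp (\<i> / 2 * of_real (s * sympl (\<Phi> \<xi>) (\<Phi> \<eta>)))"
      using exp_eq[of "s *\<^sub>R \<xi>" \<eta>] by (simp add: linear_scale[OF lin] scale)
    also have "s * sympl (\<Phi> \<xi>) (\<Phi> \<eta>) = s * sympl \<xi> \<eta> + 2 * pi"
      using D by (simp add: s_def D_def field_simps)
    also have "exp (\<i> / 2 * of_real (s * sympl \<xi> \<eta> + 2 * pi)) = exp (\<i> / 2 * of_real (s * sympl \<xi> \<eta>) + \<i> * of_real pi)"
      by (simp add: algebra_simps)
    also have "\<dots> = - exp (\<i> / 2 * of_real (s * sympl \<xi> \<eta>))" unfolding exp_add by simp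
    finally show False by simp
  qed
qed

lemma gaussian_qca_iterate:
  fixes \<alpha> :: "'d::finite weyl \<Rightarrow> 'd weyl"
  assumes "gaussian_qca \<alpha> \<Phi>"
  obtains c where "cmod c = 1" "(\<alpha> ^^ k) (W \<xi>) = c *\<^sub>C W ((\<Phi> ^^ k) \<xi>)"
proof -
  obtain \<kappa> :: "'d phase \<Rightarrow> real" where \<alpha>: "\<And>\<xi>. \<alpha> (W \<xi>) = exp (\<i> * of_real (\<kappa> \<xi>)) *\<^sub>C W (\<Phi> \<xi>)"
    using assms unfolding gaussian_qca_def by blast
  have "Vector_Spaces.linear cscale cscale \<alpha>"
    using assms by (auto simp: gaussian_qca_def star_automorphism_def)
  then have scal: "\<alpha> (c *\<^sub>C a) = c *\<^sub>C \<alpha> a" for c a by (metis Vector_Spaces.linear_iff)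
  have "\<exists>c. cmod c = 1 \<and> (\<alpha> ^^ k) (W \<xi>) = c *\<^sub>C W ((\<Phi> ^^ k) \<xi>)"
  proof (induction k)
    case 0
    show ?case by (intro exI[of _ 1]) simp
  next
    case (Suc k)
    then obtain c where c: "cmod c = 1" "(\<alpha> ^^ k) (W \<xi>) = c *\<^sub>C W ((\<Phi> ^^ k) \<xi>)" by blast
    show ?case
      by (intro exI[of _ "c * exp (\<i> * of_real (\<kappa> ((\<Phi> ^^ k) \<xi>)))"]) (simp add: c scal \<alpha> norm_mult)
  qed
  then show ?thesis using that by blast
qed

section \<open>Positive semidefinite forms\<close>

text \<open>Possibly degenerate forms on a carrier of functions. The instances below are the inner
  product of L2, the form of a density operator, \<open>ceil_defect\<close>, and finite positive
  semidefinite matrices.\<close>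

locale psd_form =
  fixes V :: "('a \<Rightarrow> complex) set" and s :: "('a \<Rightarrow> complex) \<Rightarrow> ('a \<Rightarrow> complex) \<Rightarrow> complex"
  assumes V_add: "f \<in> V \<Longrightarrow> g \<in> V \<Longrightarrow> (\<lambda>q. f q + g q) \<in> V"
    and V_scale: "f \<in> V \<Longrightarrow> (\<lambda>q. c * f q) \<in> V"
    and add_right: "f \<in> V \<Longrightarrow> g \<in> V \<Longrightarrow> h \<in> V \<Longrightarrow> s f (\<lambda>q. g q + h q) = s f g + s f h"
    and scale_right: "f \<in> V \<Longrightarrow> g \<in> V \<Longrightarrow> s f (\<lambda>q. c * g q) = c * s f g"
    and swap: "f \<in> V \<Longrightarrow> g \<in> V \<Longrightarrow> s g f = cnj (s f g)"
    and nonneg: "f \<in> V \<Longrightarrow> Re (s f f) \<ge> 0"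
begin

lemma add_left: "f \<in> V \<Longrightarrow> g \<in> V \<Longrightarrow> h \<in> V \<Longrightarrow> s (\<lambda>q. f q + g q) h = s f h + s g h"
  using swap[of h "\<lambda>q. f q + g q"] swap[of h f] swap[of h g] by (simp add: V_add add_right)

lemma scale_left: "f \<in> V \<Longrightarrow> g \<in> V \<Longrightarrow> s (\<lambda>q. c * f q) g = cnj c * s f g"
  using swap[of g "\<lambda>q. c * f q"] swap[of g f] by (simp add: V_scale scale_right)

lemma self_real: "f \<in> V \<Longrightarrow> s f f = of_real (Re (s f f))"
  using swap[of f f] by (simp add: complex_eq_iff)

lemma V_diff: "f \<in> V \<Longrightarrow> g \<in> V \<Longrightarrow> (\<lambda>q. f q - g q) \<in> V"
  using V_add[of f "\<lambda>q. (-1) * g q"] V_scale[of g "-1"] by simp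

lemma diff_right: "f \<in> V \<Longrightarrow> g \<in> V \<Longrightarrow> h \<in> V \<Longrightarrow> s f (\<lambda>q. g q - h q) = s f g - s f h"
  using add_right[of f g "\<lambda>q. (-1) * h q"] V_scale[of h "-1"] scale_right[of f h "-1"] by simp

lemma diff_left: "f \<in> V \<Longrightarrow> g \<in> V \<Longrightarrow> h \<in> V \<Longrightarrow> s (\<lambda>q. f q - g q) h = s f h - s g h"
  using add_left[of f "\<lambda>q. (-1) * g q" h] V_scale[of g "-1"] scale_left[of g h "-1"] by simp

lemma V_sum:
  assumes "finite I" "I \<noteq> {}" "\<And>i. i \<in> I \<Longrightarrow> g i \<in> V"
  shows "(\<lambda>q. \<Sum>i\<in>I. c i * g i q) \<in> V"
  using assms
proof (induction I rule: finite_ne_induct)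
  case (insert i I)
  then show ?case using V_add[of "\<lambda>q. c i * g i q" "\<lambda>q. \<Sum>i\<in>I. c i * g i q"] V_scale[of "g i" "c i"] by simp
qed (simp add: V_scale)

lemma sum_right_nonempty:
  assumes "finite I" "I \<noteq> {}" "f \<in> V" "\<And>i. i \<in> I \<Longrightarrow> g i \<in> V"
  shows "s f (\<lambda>q. \<Sum>i\<in>I. c i * g i q) = (\<Sum>i\<in>I. c i * s f (g i))"
  using assms(1,2,4)
  by (induction I rule: finite_ne_induct)
     (auto simp: add_right scale_right V_sum V_scale assms(3))

lemma Cauchy_Schwarz:
  assumes f: "f \<in> V" and g: "g \<in> V"
  shows "(cmod (s f g))\<^sup>2 \<le> Re (s f f) * Re (s g g)"
proof -
  define x y z where "x = Re (s f f)" and "y = Re (s g g)" and "z = s f g"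
  have zc: "s g f = cnj z" unfolding z_def by (rule swap[OF f g])
  have xx: "s f f = of_real x" and yy: "s g g = of_real y"
    using self_real[OF f] self_real[OF g] by (simp_all add: x_def y_def)
  have q: "0 \<le> x + 2 * t * (cmod z)\<^sup>2 + t\<^sup>2 * (cmod z)\<^sup>2 * y" for t :: real
  proof -
    define c where "c = of_real t * cnj z"
    have "s (\<lambda>q. f q + c * g q) (\<lambda>q. f q + c * g q) = s f f + c * s f g + cnj c * s g f + c * cnj c * s g g"
      using f g by (simp add: add_left add_right scale_left scale_right V_add V_scale algebra_simps)
    also have "\<dots> = of_real x + c * z + cnj c * cnj z + c * cnj c * of_real y"
      by (simp only: xx yy zc) (simp add: z_def)
    also have "\<dots> = of_real x + 2 * of_real t * (z * cnj z) + of_real t ^ 2 * (z * cnj z) * of_real y"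
      by (simp add: c_def power2_eq_square algebra_simps)
    also have "\<dots> = of_real (x + 2 * t * (cmod z)\<^sup>2 + t\<^sup>2 * (cmod z)\<^sup>2 * y)"
      by (simp add: complex_norm_square[symmetric])
    finally show ?thesis
      using nonneg[OF V_add[OF f V_scale[OF g, of c]]] by simp
  qed
  have x0: "x \<ge> 0" and y0: "y \<ge> 0" unfolding x_def y_def using nonneg f g by auto
  have "(cmod z)\<^sup>2 \<le> x * y" by (rule nonneg_quadratic_imp_le[OF x0 y0 q])
  then show ?thesis by (simp add: x_def y_def z_def)
qed

text \<open>Cauchy-Schwarz for each pair and then for the sum over \<open>I\<close>. With
  \<open>s\<close> the form of a density operator this plays the role of the Hilbert-Schmidt
  inequality for traces of \<open>\<rho> T\<close>.\<close>

lemma cmod_sum_le: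
  assumes "\<And>i. i \<in> I \<Longrightarrow> f i \<in> V" "\<And>i. i \<in> I \<Longrightarrow> g i \<in> V"
    and "(\<Sum>i\<in>I. Re (s (f i) (f i))) \<le> a" "(\<Sum>i\<in>I. Re (s (g i) (g i))) \<le> b"
  shows "(\<Sum>i\<in>I. cmod (s (f i) (g i))) \<le> sqrt (a * b)"
proof -
  have "(\<Sum>i\<in>I. cmod (s (f i) (g i))) \<le> (\<Sum>i\<in>I. sqrt (Re (s (f i) (f i))) * sqrt (Re (s (g i) (g i))))"
  proof (rule sum_mono)
    fix i assume "i \<in> I"
    then show "cmod (s (f i) (g i)) \<le> sqrt (Re (s (f i) (f i))) * sqrt (Re (s (g i) (g i)))"
      unfolding real_sqrt_mult[symmetric] using assms by (intro real_le_rsqrt Cauchy_Schwarz) auto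
  qed
  also have "\<dots> \<le> sqrt ((\<Sum>i\<in>I. (sqrt (Re (s (f i) (f i))))\<^sup>2) * (\<Sum>i\<in>I. (sqrt (Re (s (g i) (g i))))\<^sup>2))"
    by (intro real_le_rsqrt Cauchy_Schwarz_ineq_sum)
  also have "\<dots> = sqrt ((\<Sum>i\<in>I. Re (s (f i) (f i))) * (\<Sum>i\<in>I. Re (s (g i) (g i))))"
    using nonneg assms by simp
  also have "\<dots> \<le> sqrt (a * b)"
    using nonneg assms by (intro real_sqrt_le_mono mult_mono) (auto intro!: sum_nonneg order_trans[OF sum_nonneg assms(3)])
  finally show ?thesis .
qed

end

lemma hermitian_of_real_diagonal:
  fixes s :: "'v \<Rightarrow> 'v \<Rightarrow> complex"
  assumes "\<And>c. s f f + c * s f g + cnj c * s g f + c * cnj c * s g g \<in> \<real>" "s f f \<in> \<real>" "s g g \<in> \<real>"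
  shows "s g f = cnj (s f g)"
proof -
  have "Im (c * s f g + cnj c * s g f) = 0" for c
    using assms(1)[of c] assms(2,3) by (simp add: complex_is_Real_iff)
  from this[of 1] this[of \<i>] show ?thesis by (simp add: complex_eq_iff)
qed

text \<open>A positive semidefinite matrix \<open>R\<close> is a sum of rank-one matrices, which are split off one by one;
  for \<open>R = v v\<^sup>*\<close> the claim says that the conjugate transpose of \<open>T\<close> has operator norm at most \<open>C\<close>.\<close>

lemma psd_trace_contraction:
  fixes R :: "'k \<Rightarrow> 'k \<Rightarrow> complex" and T :: "'k \<Rightarrow> 'i \<Rightarrow> complex"
  assumes K: "finite K" and I: "finite I"
    and herm: "\<And>k l. k \<in> K \<Longrightarrow> l \<in> K \<Longrightarrow> R l k = cnj (R k l)"
    and psd: "\<And>c. Re (\<Sum>k\<in>K. \<Sum>l\<in>K. cnj (c k) * c l * R k l) \<ge> 0"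
    and T: "\<And>c. (\<Sum>k\<in>K. (cmod (\<Sum>i\<in>I. T k i * c i))\<^sup>2) \<le> C\<^sup>2 * (\<Sum>i\<in>I. (cmod (c i))\<^sup>2)"
  shows "(\<Sum>i\<in>I. Re (\<Sum>k\<in>K. \<Sum>l\<in>K. cnj (T k i) * T l i * R k l)) \<le> C\<^sup>2 * (\<Sum>k\<in>K. Re (R k k))"
proof -
  \<comment> \<open>An operator and its adjoint have the same norm: for \<open>c\<close> the
    conjugate of the left-hand vector, the sum of squares \<open>A\<close> is the pairing of
    \<open>v\<close> with \<open>T c\<close>.\<close>
  have T': "(\<Sum>i\<in>I. (cmod (\<Sum>k\<in>K. cnj (v k) * T k i))\<^sup>2) \<le> C\<^sup>2 * (\<Sum>k\<in>K. (cmod (v k))\<^sup>2)" for v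
  proof -
    define c where "c i = cnj (\<Sum>k\<in>K. cnj (v k) * T k i)" for i
    define A where "A = (\<Sum>i\<in>I. (cmod (c i))\<^sup>2)"
    define B where "B = (\<Sum>k\<in>K. (cmod (v k))\<^sup>2)"
    have A0: "A \<ge> 0" and B0: "B \<ge> 0" by (simp_all add: A_def B_def sum_nonneg)
    have "complex_of_real A = (\<Sum>i\<in>I. c i * (\<Sum>k\<in>K. cnj (v k) * T k i))"
      unfolding A_def of_real_sum by (intro sum.cong refl) (simp only: complex_norm_square c_def complex_cnj_cnj)
    also have "\<dots> = (\<Sum>k\<in>K. cnj (v k) * (\<Sum>i\<in>I. T k i * c i))"
      unfolding sum_distrib_left by (subst sum.swap) (simp add: mult_ac)
    finally have "A = cmod (\<Sum>k\<in>K. cnj (v k) * (\<Sum>i\<in>I. T k i * c i))"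
      using A0 by (metis norm_of_real abs_of_nonneg)
    also have "\<dots> \<le> (\<Sum>k\<in>K. cmod (v k) * cmod (\<Sum>i\<in>I. T k i * c i))"
      by (rule order_trans[OF norm_sum]) (simp add: norm_mult)
    finally have "A\<^sup>2 \<le> (\<Sum>k\<in>K. cmod (v k) * cmod (\<Sum>i\<in>I. T k i * c i))\<^sup>2"
      using A0 by (intro power_mono) auto
    also have "\<dots> \<le> B * (\<Sum>k\<in>K. (cmod (\<Sum>i\<in>I. T k i * c i))\<^sup>2)"
      unfolding B_def by (rule Cauchy_Schwarz_ineq_sum)
    also have "\<dots> \<le> B * (C\<^sup>2 * A)"
      unfolding A_def by (intro mult_left_mono T B0)
    finally have "A * A \<le> C\<^sup>2 * B * A" by (simp add: power2_eq_square mult_ac)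
    then have "A \<le> C\<^sup>2 * B"
      using A0 B0 by (cases "A = 0") auto
    then show ?thesis by (simp only: A_def B_def c_def complex_mod_cnj)
  qed
  have "finite {k\<in>K. R k k \<noteq> 0}" using K by simp
  then show ?thesis using herm psd
  \<comment> \<open>Induction on the number of nonzero diagonal entries. A zero diagonal entry of a
    positive semidefinite matrix annihilates its row and column, so \<open>R\<close> vanishes on
    \<open>K\<close> once none is left.\<close>
  proof (induction "card {k\<in>K. R k k \<noteq> 0}" arbitrary: R rule: less_induct)
    case less
    note herm = less.prems(2) and psd = less.prems(3)
    interpret F: psd_form UNIV "\<lambda>f g. \<Sum>k\<in>K. \<Sum>l\<in>K. cnj (f k) * g l * R k l"
    proof
      fix f g h :: "'k \<Rightarrow> complex" and c
      show "(\<Sum>k\<in>K. \<Sum>l\<in>K. cnj (f k) * (g l + h l) * R k l) =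
        (\<Sum>k\<in>K. \<Sum>l\<in>K. cnj (f k) * g l * R k l) + (\<Sum>k\<in>K. \<Sum>l\<in>K. cnj (f k) * h l * R k l)"
        by (simp add: algebra_simps sum.distrib)
      show "(\<Sum>k\<in>K. \<Sum>l\<in>K. cnj (f k) * (c * g l) * R k l) = c * (\<Sum>k\<in>K. \<Sum>l\<in>K. cnj (f k) * g l * R k l)"
        by (simp add: sum_distrib_left mult_ac)
      show "(\<Sum>k\<in>K. \<Sum>l\<in>K. cnj (g k) * f l * R k l) = cnj (\<Sum>k\<in>K. \<Sum>l\<in>K. cnj (f k) * g l * R k l)"
        unfolding cnj_sum by (subst sum.swap) (intro sum.cong refl, simp add: herm[symmetric])
    qed (use psd in auto)
    define s where "s f g = (\<Sum>k\<in>K. \<Sum>l\<in>K. cnj (f k) * g l * R k l)" for f g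
    define \<delta> where "\<delta> k = (\<lambda>l. if l = k then 1 else 0::complex)" for k :: 'k
    have s\<delta>: "s (\<delta> k) g = (\<Sum>l\<in>K. g l * R k l)" if "k \<in> K" for k g
    proof -
      have "s (\<delta> k) g = (\<Sum>k'\<in>K. if k' = k then (\<Sum>l\<in>K. g l * R k l) else 0)"
        unfolding s_def \<delta>_def by (intro sum.cong refl) auto
      then show ?thesis using that K by simp
    qed
    have s\<delta>\<delta>: "s (\<delta> k) (\<delta> l) = R k l" if "k \<in> K" "l \<in> K" for k l
    proof -
      have "(\<Sum>l'\<in>K. \<delta> l l' * R k l') = (\<Sum>l'\<in>K. if l' = l then R k l else 0)"
        unfolding \<delta>_def by (intro sum.cong refl) auto
      then show ?thesis using that K by (simp add: s\<delta>)
    qed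
    note CS = F.Cauchy_Schwarz[OF UNIV_I UNIV_I, folded s_def]
    have diag: "R k k = of_real (Re (R k k))" "Re (R k k) \<ge> 0" if "k \<in> K" for k
      using F.self_real[OF UNIV_I, folded s_def, of "\<delta> k"] F.nonneg[OF UNIV_I, folded s_def, of "\<delta> k"] that
      by (simp_all add: s\<delta>\<delta>)
    show ?case
    proof (cases "{k\<in>K. R k k \<noteq> 0} = {}")
      case True
      have "R k l = 0" if "k \<in> K" "l \<in> K" for k l
        using CS[of "\<delta> k" "\<delta> l"] True that by (auto simp: s\<delta>\<delta>)
      then show ?thesis by simp
    next
      case False
      then obtain k0 where k0: "k0 \<in> K" "R k0 k0 \<noteq> 0" by auto
      define r where "r = Re (R k0 k0)"
      have r: "r > 0" using diag[OF k0(1)] k0(2) by (auto simp: r_def order_less_le)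
      have Rr: "R k0 k0 = of_real r" using diag(1)[OF k0(1)] by (simp add: r_def)
      \<comment> \<open>Schur complement: the rank-one matrix built from column \<open>k0\<close> is
        subtracted. Cauchy-Schwarz keeps the rest positive semidefinite, the diagonal entry at
        \<open>k0\<close> becomes zero, and zero diagonal entries stay zero.\<close>
      define R' where "R' k l = R k l - R k k0 * R k0 l / of_real r" for k l
      have quad: "(\<Sum>k\<in>K. \<Sum>l\<in>K. cnj (c k) * c l * R' k l) = s c c - of_real ((cmod (s (\<delta> k0) c))\<^sup>2 / r)" for c
      proof -
        have "(\<Sum>k\<in>K. \<Sum>l\<in>K. cnj (c k) * c l * R' k l) =
            s c c - (\<Sum>k\<in>K. \<Sum>l\<in>K. (cnj (c k) * R k k0) * (c l * R k0 l)) / of_real r"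
          unfolding R'_def s_def by (simp add: right_diff_distrib sum_subtractf sum_divide_distrib mult_ac)
        also have "(\<Sum>k\<in>K. \<Sum>l\<in>K. (cnj (c k) * R k k0) * (c l * R k0 l)) = cnj (s (\<delta> k0) c) * s (\<delta> k0) c"
          unfolding sum_product[symmetric] using k0 by (simp add: s\<delta> cnj_sum herm[symmetric])
        also have "\<dots> = of_real ((cmod (s (\<delta> k0) c))\<^sup>2)" by (simp only: complex_norm_square mult.commute)
        finally show ?thesis by simp
      qed
      have R'0: "R' k k = 0" if "k \<in> K" "R k k = 0" for k
        using CS[of "\<delta> k0" "\<delta> k"] that k0 by (simp add: s\<delta>\<delta> R'_def)
      have "{k\<in>K. R' k k \<noteq> 0} \<subset> {k\<in>K. R k k \<noteq> 0}"
      proof (rule psubsetI)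
        show "{k\<in>K. R' k k \<noteq> 0} \<subseteq> {k\<in>K. R k k \<noteq> 0}" using R'0 by auto
        have "R' k0 k0 = 0" using r by (simp add: R'_def Rr)
        then show "{k\<in>K. R' k k \<noteq> 0} \<noteq> {k\<in>K. R k k \<noteq> 0}" using k0 by auto
      qed
      then have smaller: "card {k\<in>K. R' k k \<noteq> 0} < card {k\<in>K. R k k \<noteq> 0}"
        using K by (intro psubset_card_mono) auto
      have IH: "(\<Sum>i\<in>I. Re (\<Sum>k\<in>K. \<Sum>l\<in>K. cnj (T k i) * T l i * R' k l)) \<le> C\<^sup>2 * (\<Sum>k\<in>K. Re (R' k k))"
      proof (rule less.hyps[of R', OF smaller])
        show "R' l k = cnj (R' k l)" if "k \<in> K" "l \<in> K" for k l
          using that k0 by (simp add: R'_def herm[symmetric])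
        show "0 \<le> Re (\<Sum>k\<in>K. \<Sum>l\<in>K. cnj (c k) * c l * R' k l)" for c
          using CS[of "\<delta> k0" c] r unfolding quad by (simp add: s\<delta>\<delta> k0 r_def[symmetric] field_simps)
      qed (use K in auto)
      have "(\<Sum>i\<in>I. (cmod (s (\<delta> k0) (\<lambda>k. T k i)))\<^sup>2) \<le> C\<^sup>2 * (\<Sum>k\<in>K. (cmod (R k k0))\<^sup>2)"
      proof -
        have "s (\<delta> k0) (\<lambda>k. T k i) = (\<Sum>k\<in>K. cnj (R k k0) * T k i)" for i
          using k0 by (simp add: s\<delta> mult.commute herm[symmetric])
        then show ?thesis using T'[of "\<lambda>k. R k k0"] by simp
      qed
      then have rank1: "(\<Sum>i\<in>I. (cmod (s (\<delta> k0) (\<lambda>k. T k i)))\<^sup>2 / r) \<le> C\<^sup>2 * (\<Sum>k\<in>K. (cmod (R k k0))\<^sup>2 / r)"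
        unfolding sum_divide_distrib[symmetric] times_divide_eq_right using r by (intro divide_right_mono) auto
      have tr: "Re (R' k k) = Re (R k k) - (cmod (R k k0))\<^sup>2 / r" if "k \<in> K" for k
      proof -
        have "R k k0 * R k0 k = of_real ((cmod (R k k0))\<^sup>2)"
          using herm[of k k0] that k0 by (simp only: complex_norm_square)
        then show ?thesis by (simp add: R'_def flip: of_real_divide)
      qed
      have "(\<Sum>i\<in>I. Re (s (\<lambda>k. T k i) (\<lambda>k. T k i))) =
         (\<Sum>i\<in>I. Re (\<Sum>k\<in>K. \<Sum>l\<in>K. cnj (T k i) * T l i * R' k l)) + (\<Sum>i\<in>I. (cmod (s (\<delta> k0) (\<lambda>k. T k i)))\<^sup>2 / r)"
        unfolding quad by (simp add: sum_subtractf)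
      also have "\<dots> \<le> C\<^sup>2 * (\<Sum>k\<in>K. Re (R' k k)) + C\<^sup>2 * (\<Sum>k\<in>K. (cmod (R k k0))\<^sup>2 / r)"
        by (intro add_mono IH rank1)
      also have "\<dots> = C\<^sup>2 * (\<Sum>k\<in>K. Re (R k k))"
        by (simp add: tr sum_subtractf distrib_left[symmetric])
      finally show ?thesis by (simp add: s_def)
    qed
  qed
qed

section \<open>Square-integrable functions\<close>

lemma L2_measurable [measurable_dest]: "f \<in> L2 M \<Longrightarrow> f \<in> borel_measurable M"
  by (simp add: L2_def)

lemma L2_integrable: "f \<in> L2 M \<Longrightarrow> integrable M (\<lambda>q. (cmod (f q))\<^sup>2)"
  by (simp add: L2_def)

lemma borel_measurable_cnj [measurable]: "f \<in> borel_measurable M \<Longrightarrow> (\<lambda>x. cnj (f x)) \<in> borel_measurable M"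
  by (rule measurable_compose[OF _ borel_measurable_continuous_onI]) (auto intro: continuous_intros)

lemma L2_I: "f \<in> borel_measurable M \<Longrightarrow> integrable M (\<lambda>q. (cmod (f q))\<^sup>2) \<Longrightarrow> f \<in> L2 M"
  by (simp add: L2_def)

lemma L2_bound:
  assumes "f \<in> borel_measurable M" "g \<in> L2 M" "AE q in M. cmod (f q) \<le> K * cmod (g q)"
  shows "f \<in> L2 M"
proof (rule L2_I)
  show "integrable M (\<lambda>q. (cmod (f q))\<^sup>2)"
  proof (rule Bochner_Integration.integrable_bound)
    show "integrable M (\<lambda>q. K\<^sup>2 * (cmod (g q))\<^sup>2)" using L2_integrable[OF assms(2)] by simp
    show "AE q in M. norm ((cmod (f q))\<^sup>2) \<le> norm (K\<^sup>2 * (cmod (g q))\<^sup>2)"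
      using assms(3)
    proof (rule eventually_mono)
      fix q assume "cmod (f q) \<le> K * cmod (g q)"
      then have "(cmod (f q))\<^sup>2 \<le> (K * cmod (g q))\<^sup>2" by (intro power_mono) auto
      then show "norm ((cmod (f q))\<^sup>2) \<le> norm (K\<^sup>2 * (cmod (g q))\<^sup>2)" by (simp add: power_mult_distrib)
    qed
  qed (use assms in measurable)
qed fact

lemma L2_zero [simp]: "(\<lambda>_. 0) \<in> L2 M"
  by (simp add: L2_def)

lemma L2_scale: "f \<in> L2 M \<Longrightarrow> (\<lambda>q. c * f q) \<in> L2 M"
  by (rule L2_bound[of _ _ f "cmod c"]) (auto simp: norm_mult intro: L2_measurable)

lemma L2_add:
  assumes "f \<in> L2 M" "g \<in> L2 M"
  shows "(\<lambda>q. f q + g q) \<in> L2 M"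
proof (rule L2_I)
  show m: "(\<lambda>q. f q + g q) \<in> borel_measurable M" using assms by (auto intro: L2_measurable)
  show "integrable M (\<lambda>q. (cmod (f q + g q))\<^sup>2)"
  proof (rule Bochner_Integration.integrable_bound)
    show "integrable M (\<lambda>q. 2 * (cmod (f q))\<^sup>2 + 2 * (cmod (g q))\<^sup>2)"
      using L2_integrable[OF assms(1)] L2_integrable[OF assms(2)] by simp
    show "AE q in M. norm ((cmod (f q + g q))\<^sup>2) \<le> norm (2 * (cmod (f q))\<^sup>2 + 2 * (cmod (g q))\<^sup>2)"
    proof (rule AE_I2)
      fix q
      have "(cmod (f q + g q))\<^sup>2 \<le> (cmod (f q) + cmod (g q))\<^sup>2"
        by (intro power_mono norm_triangle_ineq) auto
      also have "\<dots> \<le> 2 * (cmod (f q))\<^sup>2 + 2 * (cmod (g q))\<^sup>2"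
        using sum_squares_bound[of "cmod (f q)" "cmod (g q)"] by (simp add: power2_sum)
      finally show "norm ((cmod (f q + g q))\<^sup>2) \<le> norm (2 * (cmod (f q))\<^sup>2 + 2 * (cmod (g q))\<^sup>2)" by simp
    qed
  qed (use m in measurable)
qed

lemma L2_inner_integrable:
  assumes "f \<in> L2 M" "g \<in> L2 M"
  shows "integrable M (\<lambda>q. cnj (f q) * g q)"
proof (rule Bochner_Integration.integrable_bound)
  show "integrable M (\<lambda>q. (cmod (f q))\<^sup>2 + (cmod (g q))\<^sup>2)"
    using L2_integrable[OF assms(1)] L2_integrable[OF assms(2)] by simp
  show "(\<lambda>q. cnj (f q) * g q) \<in> borel_measurable M"
    using assms by measurable
  show "AE q in M. norm (cnj (f q) * g q) \<le> norm ((cmod (f q))\<^sup>2 + (cmod (g q))\<^sup>2)"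
  proof (rule AE_I2)
    fix q
    have "2 * (cmod (f q) * cmod (g q)) \<le> (cmod (f q))\<^sup>2 + (cmod (g q))\<^sup>2"
      using sum_squares_bound[of "cmod (f q)" "cmod (g q)"] by simp
    moreover have "0 \<le> cmod (f q) * cmod (g q)" by simp
    ultimately have "cmod (f q) * cmod (g q) \<le> (cmod (f q))\<^sup>2 + (cmod (g q))\<^sup>2" by linarith
    then show "norm (cnj (f q) * g q) \<le> norm ((cmod (f q))\<^sup>2 + (cmod (g q))\<^sup>2)"
      by (simp add: norm_mult)
  qed
qed

lemma l2_inner_self: "l2_inner M f f = of_real ((l2_norm M f)\<^sup>2)"
proof -
  have "l2_inner M f f = (LINT q|M. of_real ((cmod (f q))\<^sup>2))"
    unfolding l2_inner_def by (intro Bochner_Integration.integral_cong refl) (simp only: complex_norm_square mult.commute)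
  then show ?thesis by (simp add: l2_norm_def integral_complex_of_real del: of_real_power)
qed

lemma l2_norm_nonneg [simp]: "l2_norm M f \<ge> 0"
  by (simp add: l2_norm_def)

interpretation l2: psd_form "L2 M" "l2_inner M" for M :: "'a measure"
proof
  fix f g h :: "'a \<Rightarrow> complex" and c
  assume f: "f \<in> L2 M"
  show "(\<lambda>q. c * f q) \<in> L2 M" using f by (rule L2_scale)
  show "0 \<le> Re (l2_inner M f f)" by (simp add: l2_inner_self)
  assume g: "g \<in> L2 M"
  show "(\<lambda>q. f q + g q) \<in> L2 M" using f g by (rule L2_add)
  show "l2_inner M f (\<lambda>q. c * g q) = c * l2_inner M f g"
    unfolding l2_inner_def by (subst integral_mult_right_zero[symmetric]) (simp add: mult_ac)
  show "l2_inner M g f = cnj (l2_inner M f g)"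
    unfolding l2_inner_def
    using Bochner_Integration.integral_cnj[of M "\<lambda>q. cnj (f q) * g q"] by (simp add: mult.commute)
  assume h: "h \<in> L2 M"
  show "l2_inner M f (\<lambda>q. g q + h q) = l2_inner M f g + l2_inner M f h"
    unfolding l2_inner_def
    by (subst Bochner_Integration.integral_add[symmetric])
       (auto intro: L2_inner_integrable f g h simp: distrib_left)
qed

lemma l2_inner_cong:
  assumes "f \<in> L2 M" "f' \<in> L2 M" "AE q in M. f q = f' q"
    and "g \<in> L2 M" "g' \<in> L2 M" "AE q in M. g q = g' q"
  shows "l2_inner M f g = l2_inner M f' g'"
  unfolding l2_inner_def
proof (rule integral_cong_AE)
  show "AE q in M. cnj (f q) * g q = cnj (f' q) * g' q"
    using assms(3,6) by eventually_elim simp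
qed (use assms(1,2,4,5) in measurable)

lemma l2_inner_cong_right:
  "f \<in> L2 M \<Longrightarrow> g \<in> L2 M \<Longrightarrow> g' \<in> L2 M \<Longrightarrow> AE q in M. g q = g' q \<Longrightarrow> l2_inner M f g = l2_inner M f g'"
  by (rule l2_inner_cong) auto

lemma l2_inner_cong_left:
  "f \<in> L2 M \<Longrightarrow> f' \<in> L2 M \<Longrightarrow> g \<in> L2 M \<Longrightarrow> AE q in M. f q = f' q \<Longrightarrow> l2_inner M f g = l2_inner M f' g"
  by (rule l2_inner_cong) auto

lemma l2_norm_cong:
  assumes "f \<in> L2 M" "g \<in> L2 M" "AE q in M. f q = g q"
  shows "l2_norm M f = l2_norm M g"
proof -
  have "of_real ((l2_norm M f)\<^sup>2) = (of_real ((l2_norm M g)\<^sup>2) :: complex)"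
    unfolding l2_inner_self[symmetric] by (rule l2_inner_cong) (use assms in auto)
  then have "(l2_norm M f)\<^sup>2 = (l2_norm M g)\<^sup>2" by (simp only: of_real_eq_iff)
  then show ?thesis by simp
qed

lemma l2_Re_self [simp]: "Re (l2_inner M f f) = (l2_norm M f)\<^sup>2"
  by (simp add: l2_inner_self)

lemma l2_Cauchy_Schwarz:
  assumes "f \<in> L2 M" "g \<in> L2 M"
  shows "cmod (l2_inner M f g) \<le> l2_norm M f * l2_norm M g"
proof (rule power2_le_imp_le)
  show "(cmod (l2_inner M f g))\<^sup>2 \<le> (l2_norm M f * l2_norm M g)\<^sup>2"
    using l2.Cauchy_Schwarz[OF assms] by (simp add: power_mult_distrib)
qed simp

lemma l2_norm_scale: "f \<in> L2 M \<Longrightarrow> l2_norm M (\<lambda>q. c * f q) = cmod c * l2_norm M f"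
  unfolding l2_norm_def by (simp add: norm_mult power_mult_distrib real_sqrt_mult)

lemma l2_norm_triangle:
  assumes f: "f \<in> L2 M" and g: "g \<in> L2 M"
  shows "l2_norm M (\<lambda>q. f q + g q) \<le> l2_norm M f + l2_norm M g"
proof (rule power2_le_imp_le)
  have "(l2_norm M (\<lambda>q. f q + g q))\<^sup>2 = (l2_norm M f)\<^sup>2 + (l2_norm M g)\<^sup>2 + 2 * Re (l2_inner M f g)"
    unfolding l2_Re_self[symmetric] using f g l2.swap[OF f g]
    by (simp add: l2.add_left l2.add_right L2_add del: l2_Re_self)
  also have "\<dots> \<le> (l2_norm M f)\<^sup>2 + (l2_norm M g)\<^sup>2 + 2 * (l2_norm M f * l2_norm M g)"
    using l2_Cauchy_Schwarz[OF f g] complex_Re_le_cmod[of "l2_inner M f g"] by simp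
  finally show "(l2_norm M (\<lambda>q. f q + g q))\<^sup>2 \<le> (l2_norm M f + l2_norm M g)\<^sup>2"
    by (simp add: power2_sum)
qed simp

lemma l2_norm_diff_triangle:
  assumes f: "f \<in> L2 M" and g: "g \<in> L2 M"
  shows "l2_norm M (\<lambda>q. f q - g q) \<le> l2_norm M f + l2_norm M g"
  using l2_norm_triangle[OF f L2_scale[OF g, of "-1"]] l2_norm_scale[OF g, of "-1"] by simp

lemma l2_norm_eq_0_iff:
  assumes "f \<in> L2 M"
  shows "l2_norm M f = 0 \<longleftrightarrow> (AE q in M. f q = 0)"
  unfolding l2_norm_def real_sqrt_eq_0_iff
  by (subst integral_nonneg_eq_0_iff_AE) (auto intro: L2_integrable assms)

lemma l2_norm_eq_0_iff_inner:
  assumes "f \<in> L2 M"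
  shows "l2_inner M f f = 0 \<longleftrightarrow> (AE q in M. f q = 0)"
  using l2_norm_eq_0_iff[OF assms] by (simp add: l2_inner_self)

lemma AE_eq_if_l2_inner_eq:
  assumes f: "f \<in> L2 M" and g: "g \<in> L2 M" and "\<And>h. h \<in> L2 M \<Longrightarrow> l2_inner M h f = l2_inner M h g"
  shows "AE q in M. f q = g q"
proof -
  let ?d = "\<lambda>q. f q - g q"
  have d: "?d \<in> L2 M" using f g by (rule l2.V_diff)
  have "l2_inner M ?d ?d = 0" using assms(3)[OF d] by (simp add: l2.diff_right[OF d f g])
  then show ?thesis using l2_norm_eq_0_iff_inner[OF d] by simp
qed

lemma L2_sum: "(\<And>i. i \<in> I \<Longrightarrow> g i \<in> L2 M) \<Longrightarrow> (\<lambda>q. \<Sum>i\<in>I. c i * g i q) \<in> L2 M"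
proof (induction I rule: infinite_finite_induct)
  case (insert i I)
  then show ?case using L2_add[of "\<lambda>q. c i * g i q" M "\<lambda>q. \<Sum>i\<in>I. c i * g i q"] L2_scale[of "g i" M "c i"] by simp
qed simp_all

lemma l2_inner_zero [simp]: "l2_inner M f (\<lambda>_. 0) = 0" "l2_inner M (\<lambda>_. 0) f = 0"
  by (simp_all add: l2_inner_def)

lemma l2_inner_sum_right:
  assumes "f \<in> L2 M" "\<And>i. i \<in> I \<Longrightarrow> g i \<in> L2 M"
  shows "l2_inner M f (\<lambda>q. \<Sum>i\<in>I. c i * g i q) = (\<Sum>i\<in>I. c i * l2_inner M f (g i))"
  using assms(2)
  by (induction I rule: infinite_finite_induct) (auto simp: l2.add_right l2.scale_right L2_sum L2_scale assms(1))

lemma l2_inner_sum_left: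
  assumes "f \<in> L2 M" "\<And>i. i \<in> I \<Longrightarrow> g i \<in> L2 M"
  shows "l2_inner M (\<lambda>q. \<Sum>i\<in>I. c i * g i q) f = (\<Sum>i\<in>I. cnj (c i) * l2_inner M (g i) f)"
  using l2.swap[OF assms(1) L2_sum[of I g M c]] l2_inner_sum_right[OF assms, of I] assms
  by (auto simp: l2.swap[OF assms(1)] cnj_sum intro!: sum.cong)

definition orthonormal :: "'a measure \<Rightarrow> ('a \<Rightarrow> complex) set \<Rightarrow> bool" where
  "orthonormal M B \<longleftrightarrow> B \<subseteq> L2 M \<and> (\<forall>e\<in>B. \<forall>f\<in>B. l2_inner M e f = (if e = f then 1 else 0))"

lemma orthonormal_norm_sum:
  assumes B: "orthonormal M B" and G: "finite G" "G \<subseteq> B"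
  shows "(l2_norm M (\<lambda>q. \<Sum>g\<in>G. c g * g q))\<^sup>2 = (\<Sum>g\<in>G. (cmod (c g))\<^sup>2)"
proof -
  have GL: "\<And>g. g \<in> G \<Longrightarrow> g \<in> L2 M" using B G by (auto simp: orthonormal_def)
  have inner: "l2_inner M g h = (if h = g then 1 else 0)" if "g \<in> G" "h \<in> G" for g h
    using B G(2) that unfolding orthonormal_def by (metis subsetD)
  have "complex_of_real ((l2_norm M (\<lambda>q. \<Sum>g\<in>G. c g * g q))\<^sup>2) =
      (\<Sum>g\<in>G. cnj (c g) * (\<Sum>h\<in>G. c h * l2_inner M g h))"
    unfolding l2_inner_self[symmetric] using GL
    by (subst l2_inner_sum_left) (auto intro!: L2_sum sum.cong simp: l2_inner_sum_right)
  also have "\<dots> = (\<Sum>g\<in>G. cnj (c g) * (\<Sum>h\<in>G. if h = g then c h else 0))"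
    by (intro sum.cong refl arg_cong2[where f = "(*)"]) (auto simp: inner)
  also have "\<dots> = (\<Sum>g\<in>G. of_real ((cmod (c g))\<^sup>2))"
    using G by (intro sum.cong refl) (simp only: complex_norm_square, simp add: mult.commute)
  finally show ?thesis by (simp only: of_real_sum[symmetric] of_real_eq_iff)
qed

text \<open>Zorn's lemma inside \<open>X\<close>. The choice \<open>X = L2 M\<close> completes a
  finite system to a basis, so that \<open>has_trace\<close> applies; spectral subspaces as
  \<open>X\<close> give the pieces of \<open>adapted_basis\<close>.\<close>

lemma orthonormal_extend:
  assumes GX: "G \<subseteq> X" and X: "X \<subseteq> L2 M" "\<And>f c. f \<in> X \<Longrightarrow> (\<lambda>q. c * f q) \<in> X" and G: "orthonormal M G"
  obtains B where "G \<subseteq> B" "B \<subseteq> X" "orthonormal M B"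
    "\<And>f. f \<in> X \<Longrightarrow> (\<And>e. e \<in> B \<Longrightarrow> l2_inner M e f = 0) \<Longrightarrow> AE q in M. f q = 0"
proof -
  define \<A> where "\<A> = {B. G \<subseteq> B \<and> B \<subseteq> X \<and> orthonormal M B}"
  have "\<exists>B\<in>\<A>. \<forall>Y\<in>\<A>. B \<subseteq> Y \<longrightarrow> Y = B"
  proof (rule subset_Zorn_nonempty)
    show "\<A> \<noteq> {}" using GX G by (auto simp: \<A>_def)
    fix \<C> assume C: "\<C> \<noteq> {}" "subset.chain \<A> \<C>"
    have CA: "\<And>B. B \<in> \<C> \<Longrightarrow> B \<in> \<A>" using C(2) by (auto simp: subset.chain_def)
    have "l2_inner M e f = (if e = f then 1 else 0)" if ef: "e \<in> \<Union>\<C>" "f \<in> \<Union>\<C>" for e f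
    proof -
      obtain B B' where "B \<in> \<C>" "e \<in> B" "B' \<in> \<C>" "f \<in> B'" using ef by auto
      moreover have "B \<subseteq> B' \<or> B' \<subseteq> B"
        using C(2) \<open>B \<in> \<C>\<close> \<open>B' \<in> \<C>\<close> by (auto simp: subset.chain_def)
      ultimately obtain B'' where "B'' \<in> \<C>" "e \<in> B''" "f \<in> B''" by blast
      then show ?thesis using CA[of B''] unfolding \<A>_def orthonormal_def by auto
    qed
    moreover obtain B0 where "B0 \<in> \<C>" using C(1) by auto
    then have "G \<subseteq> \<Union>\<C>" using CA[of B0] unfolding \<A>_def by blast
    moreover have "\<Union>\<C> \<subseteq> X" "\<Union>\<C> \<subseteq> L2 M"
      using CA X(1) unfolding \<A>_def by blast+
    ultimately show "\<Union>\<C> \<in> \<A>" by (auto simp: \<A>_def orthonormal_def)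
  qed
  then obtain B where B: "B \<in> \<A>" and max: "\<And>Y. Y \<in> \<A> \<Longrightarrow> B \<subseteq> Y \<Longrightarrow> Y = B" by blast
  show ?thesis
  proof (rule that[of B])
    show "G \<subseteq> B" "B \<subseteq> X" "orthonormal M B" using B by (auto simp: \<A>_def)
    fix f assume f: "f \<in> X" and orth: "\<And>e. e \<in> B \<Longrightarrow> l2_inner M e f = 0"
    have fL: "f \<in> L2 M" using f X by auto
    have BL: "B \<subseteq> L2 M" using \<open>B \<subseteq> X\<close> X by auto
    show "AE q in M. f q = 0"
    proof (rule ccontr)
      assume "\<not> ?thesis"
      then have n: "l2_norm M f \<noteq> 0" using l2_norm_eq_0_iff[OF fL] by simp
      define g where "g = (\<lambda>q. of_real (1 / l2_norm M f) * f q)"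
      have gX: "g \<in> X" and gL: "g \<in> L2 M" unfolding g_def using X(2)[OF f] X(1) by blast+
      have "l2_norm M g = 1"
        unfolding g_def l2_norm_scale[OF fL] norm_of_real using n by simp
      then have gg: "l2_inner M g g = 1" by (simp add: l2_inner_self)
      have eg: "l2_inner M e g = 0" if "e \<in> B" for e
        using l2.scale_right[of e M f] orth[OF that] that BL fL unfolding g_def by (simp only: mult_zero_right subsetD)
      then have ge: "l2_inner M g e = 0" if "e \<in> B" for e
        using that l2.swap[of e M g] BL gL by auto
      have gB: "g \<notin> B" using eg[of g] gg by auto
      have "orthonormal M (insert g B)"
        using \<open>orthonormal M B\<close> gL gg eg ge gB unfolding orthonormal_def by auto
      then have "insert g B \<in> \<A>" using B gX by (auto simp: \<A>_def)
      then show False using max[of "insert g B"] gB by auto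
    qed
  qed
qed

text \<open>Linearly dependent input is allowed: a residual that vanishes almost everywhere adds no
  new vector. On the span of \<open>G\<close> a density operator becomes a finite matrix.\<close>

lemma Gram_Schmidt:
  assumes "finite I" "\<And>i. i \<in> I \<Longrightarrow> t i \<in> L2 M"
  obtains G T where "finite G" "orthonormal M G" "\<And>i. i \<in> I \<Longrightarrow> AE q in M. t i q = (\<Sum>g\<in>G. T g i * g q)"
proof -
  have "\<exists>G T. finite G \<and> orthonormal M G \<and> (\<forall>i\<in>I. AE q in M. t i q = (\<Sum>g\<in>G. T g i * g q))"
    using assms
  proof (induction I rule: finite_induct)
    case empty
    show ?case by (intro exI[of _ "{}"]) (auto simp: orthonormal_def)
  next
    case (insert j I)
    then obtain G T where G: "finite G" "orthonormal M G"
      and T: "\<And>i. i \<in> I \<Longrightarrow> AE q in M. t i q = (\<Sum>g\<in>G. T g i * g q)" by auto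
    have GL: "\<And>g. g \<in> G \<Longrightarrow> g \<in> L2 M" using G by (auto simp: orthonormal_def)
    have tj: "t j \<in> L2 M" using insert.prems by simp
    define p where "p = (\<lambda>q. \<Sum>g\<in>G. l2_inner M g (t j) * g q)"
    define r where "r = (\<lambda>q. t j q - p q)"
    have pL: "p \<in> L2 M" unfolding p_def by (intro L2_sum GL)
    have rL: "r \<in> L2 M" unfolding r_def by (intro l2.V_diff tj pL)
    have gr: "l2_inner M g r = 0" if g: "g \<in> G" for g
    proof -
      have "l2_inner M g p = (\<Sum>h\<in>G. if h = g then l2_inner M g (t j) else 0)"
        unfolding p_def using G(2) g GL
        by (subst l2_inner_sum_right) (auto simp: orthonormal_def intro!: sum.cong)
      then show ?thesis
        unfolding r_def using g G(1) by (simp add: l2.diff_right GL tj pL)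
    qed
    show ?case
    proof (cases "l2_norm M r = 0")
      case True
      then have r0: "AE q in M. r q = 0" using l2_norm_eq_0_iff[OF rL] by simp
      show ?thesis
      proof (intro exI conjI ballI)
        fix i assume i: "i \<in> insert j I"
        show "AE q in M. t i q = (\<Sum>g\<in>G. (if i = j then l2_inner M g (t j) else T g i) * g q)"
        proof (cases "i = j")
          case True
          then show ?thesis using r0 by (auto simp: r_def p_def)
        qed (use T i in auto)
      qed (use G in auto)
    next
      case False
      define h where "h = (\<lambda>q. of_real (1 / l2_norm M r) * r q)"
      have hL: "h \<in> L2 M" unfolding h_def by (intro L2_scale rL)
      have "l2_norm M h = 1" unfolding h_def l2_norm_scale[OF rL] norm_of_real using False by simp
      then have hh: "l2_inner M h h = 1" by (simp add: l2_inner_self)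
      have gh: "l2_inner M g h = 0" if "g \<in> G" for g
        by (simp only: h_def l2.scale_right[OF GL[OF that] rL] gr[OF that] mult_zero_right)
      then have hg: "l2_inner M h g = 0" if "g \<in> G" for g
        using that l2.swap[OF GL hL] by auto
      have hG: "h \<notin> G" using gh[of h] hh by auto
      define T' where "T' = (\<lambda>g i. if g = h then (if i = j then of_real (l2_norm M r) else 0)
          else if i = j then l2_inner M g (t j) else T g i)"
      have T'G: "(\<Sum>g\<in>G. T' g i * g q) = (\<Sum>g\<in>G. (if i = j then l2_inner M g (t j) else T g i) * g q)" for i q
        using hG by (intro sum.cong) (auto simp: T'_def)
      show ?thesis
      proof (intro exI conjI ballI)
        show "finite (insert h G)" using G by simp
        show "orthonormal M (insert h G)"
          using G hL hh gh hg hG unfolding orthonormal_def by auto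
        fix i assume i: "i \<in> insert j I"
        show "AE q in M. t i q = (\<Sum>g\<in>insert h G. T' g i * g q)"
        proof (cases "i = j")
          case True
          have "t j q = (\<Sum>g\<in>insert h G. T' g j * g q)" for q
            using False G(1) hG by (simp add: T'G) (simp add: T'_def h_def r_def p_def)
          then show ?thesis using True by simp
        next
          case False
          then have ti: "AE q in M. t i q = (\<Sum>g\<in>G. T g i * g q)" using T i by auto
          show ?thesis
            using ti G(1) hG False by (simp add: T'G) (simp add: T'_def)
        qed
      qed
    qed
  qed
  then show ?thesis using that by blast
qed

section \<open>Density operators\<close>

lemma bounded_operator_L2: "bounded_operator M T \<Longrightarrow> f \<in> L2 M \<Longrightarrow> T f \<in> L2 M"
  by (simp add: bounded_operator_def)

lemma bounded_operator_inner_add: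
  assumes "bounded_operator M T" "f \<in> L2 M" "g \<in> L2 M" "h \<in> L2 M"
  shows "l2_inner M f (T (\<lambda>q. g q + h q)) = l2_inner M f (T g) + l2_inner M f (T h)"
proof -
  have "l2_inner M f (T (\<lambda>q. g q + h q)) = l2_inner M f (\<lambda>q. T g q + T h q)"
    using assms by (intro l2_inner_cong_right) (auto simp: bounded_operator_def L2_add)
  then show ?thesis using assms by (simp add: l2.add_right bounded_operator_L2)
qed

lemma bounded_operator_inner_scale:
  assumes "bounded_operator M T" "f \<in> L2 M" "g \<in> L2 M"
  shows "l2_inner M f (T (\<lambda>q. c * g q)) = c * l2_inner M f (T g)"
proof -
  have "l2_inner M f (T (\<lambda>q. c * g q)) = l2_inner M f (\<lambda>q. c * T g q)"
    using assms by (intro l2_inner_cong_right) (auto simp: bounded_operator_def L2_scale)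
  then show ?thesis using assms by (simp add: l2.scale_right bounded_operator_L2)
qed

text \<open>Operators act on functions rather than on classes modulo null sets. That they respect
  the classes follows from the norm bound applied to the difference.\<close>

lemma bounded_operator_cong:
  assumes T: "bounded_operator M T" and fg: "f \<in> L2 M" "g \<in> L2 M" "AE q in M. f q = g q" and h: "h \<in> L2 M"
  shows "l2_inner M h (T f) = l2_inner M h (T g)"
proof -
  let ?d = "\<lambda>q. f q + (-1) * g q"
  have d: "?d \<in> L2 M" by (intro L2_add L2_scale fg)
  have "AE q in M. ?d q = 0" using fg(3) by eventually_elim simp
  then have d0: "l2_norm M ?d = 0" using l2_norm_eq_0_iff[OF d] by simp
  obtain K where "l2_norm M (T ?d) \<le> K * l2_norm M ?d" using T d unfolding bounded_operator_def by blast
  then have "l2_norm M (T ?d) = 0" using d0 by (intro antisym) auto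
  then have "l2_inner M h (T ?d) = 0"
    using l2_Cauchy_Schwarz[OF h bounded_operator_L2[OF T d]] by simp
  then show ?thesis
    using bounded_operator_inner_add[OF T h fg(1) L2_scale[OF fg(2), of "-1"]]
      bounded_operator_inner_scale[OF T h fg(2), of "-1"] by simp
qed

text \<open>The main point is \<open>swap\<close>: hermiticity is not part of
  \<open>positive_operator\<close> and is obtained by polarization from the diagonal values being
  real.\<close>

lemma psd_form_positive_operator:
  assumes "positive_operator M \<rho>"
  shows "psd_form (L2 M) (\<lambda>f g. l2_inner M f (\<rho> g))"
proof
  have b: "bounded_operator M \<rho>" and pos: "\<And>f. f \<in> L2 M \<Longrightarrow> l2_inner M f (\<rho> f) \<in> \<real>\<^sub>\<ge>\<^sub>0"
    using assms by (auto simp: positive_operator_def)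
  have real: "l2_inner M f (\<rho> f) \<in> \<real>" if "f \<in> L2 M" for f
    using pos[OF that] by (auto simp: complex_nonneg_Reals_iff complex_is_Real_iff)
  fix f g h :: "'a \<Rightarrow> complex" and c
  assume f: "f \<in> L2 M"
  show "(\<lambda>q. c * f q) \<in> L2 M" using f by (rule L2_scale)
  show "0 \<le> Re (l2_inner M f (\<rho> f))" using pos[OF f] by (simp add: complex_nonneg_Reals_iff)
  assume g: "g \<in> L2 M"
  show "(\<lambda>q. f q + g q) \<in> L2 M" using f g by (rule L2_add)
  show "l2_inner M f (\<rho> (\<lambda>q. c * g q)) = c * l2_inner M f (\<rho> g)"
    by (rule bounded_operator_inner_scale[OF b f g])
  show "l2_inner M g (\<rho> f) = cnj (l2_inner M f (\<rho> g))"
  proof (rule hermitian_of_real_diagonal[of "\<lambda>f g. l2_inner M f (\<rho> g)"])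
    fix c
    note \<rho>L = bounded_operator_L2[OF b]
    let ?h = "\<lambda>q. f q + c * g q"
    have cg: "(\<lambda>q. c * g q) \<in> L2 M" by (rule L2_scale[OF g])
    have h: "?h \<in> L2 M" by (rule L2_add[OF f cg])
    have right: "l2_inner M u (\<rho> ?h) = l2_inner M u (\<rho> f) + c * l2_inner M u (\<rho> g)" if "u \<in> L2 M" for u
      by (simp only: bounded_operator_inner_add[OF b that f cg] bounded_operator_inner_scale[OF b that g])
    have "l2_inner M ?h (\<rho> ?h) = l2_inner M f (\<rho> ?h) + cnj c * l2_inner M g (\<rho> ?h)"
      by (simp only: l2.add_left[OF f cg \<rho>L[OF h]] l2.scale_left[OF g \<rho>L[OF h]])
    then have "l2_inner M ?h (\<rho> ?h) =
        l2_inner M f (\<rho> f) + c * l2_inner M f (\<rho> g) + cnj c * l2_inner M g (\<rho> f) + c * cnj c * l2_inner M g (\<rho> g)"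
      by (simp add: right f g distrib_left mult.assoc)
    then show "l2_inner M f (\<rho> f) + c * l2_inner M f (\<rho> g) + cnj c * l2_inner M g (\<rho> f) + c * cnj c * l2_inner M g (\<rho> g) \<in> \<real>"
      using real[OF L2_add[OF f L2_scale[OF g, of c]]] by simp
  qed (use real f g in auto)
  assume h: "h \<in> L2 M"
  show "l2_inner M f (\<rho> (\<lambda>q. g q + h q)) = l2_inner M f (\<rho> g) + l2_inner M f (\<rho> h)"
    by (rule bounded_operator_inner_add[OF b f g h])
qed

text \<open>Once \<open>G\<close> is completed to a basis, the left-hand side is a partial sum of a
  series of nonnegative terms with sum 1.\<close>

lemma density_operator_trace_le:
  assumes \<rho>: "density_operator M \<rho>" and G: "finite G" "orthonormal M G"
  shows "(\<Sum>g\<in>G. Re (l2_inner M g (\<rho> g))) \<le> 1"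
proof -
  have pos: "positive_operator M \<rho>" and tr: "has_trace M \<rho> 1" using \<rho> by (auto simp: density_operator_def)
  interpret R: psd_form "L2 M" "\<lambda>f g. l2_inner M f (\<rho> g)" by (rule psd_form_positive_operator[OF pos])
  obtain B where B: "G \<subseteq> B" "B \<subseteq> L2 M" "orthonormal M B"
    "\<And>f. f \<in> L2 M \<Longrightarrow> (\<And>e. e \<in> B \<Longrightarrow> l2_inner M e f = 0) \<Longrightarrow> AE q in M. f q = 0"
  proof (rule orthonormal_extend[of G "L2 M" M])
    show "G \<subseteq> L2 M" using G by (simp add: orthonormal_def)
  qed (use G L2_scale in auto)
  then have "orthonormal_basis M B" by (auto simp: orthonormal_basis_def orthonormal_def)
  then have "((\<lambda>e. l2_inner M e (\<rho> e)) has_sum 1) B" using tr by (auto simp: has_trace_def)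
  then have "((\<lambda>e. Re (l2_inner M e (\<rho> e))) has_sum Re 1) B" by (rule has_sum_Re)
  moreover have "Re (l2_inner M e (\<rho> e)) \<ge> 0" if "e \<in> B" for e using R.nonneg B that by auto
  ultimately have "(\<Sum>g\<in>G. Re (l2_inner M g (\<rho> g))) \<le> Re 1"
    using G B by (intro has_sum_mono_neutral[OF has_sum_finite[OF G(1)]]) auto
  then show ?thesis by simp
qed

text \<open>\<open>bessel\<close> bounds by \<open>C\<close> the norm of the map from coefficients
  to combinations of the \<open>t i\<close>; the claim is the trace inequality for \<rho> conjugated
  by this map, reduced to \<open>psd_trace_contraction\<close> by Gram-Schmidt. The
  \<open>t i\<close> may be far from orthogonal, as for the vectors \<open>U e - e\<close>
  later.\<close>

lemma density_operator_Bessel: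
  assumes \<rho>: "density_operator M \<rho>" and I: "finite I" and t: "\<And>i. i \<in> I \<Longrightarrow> t i \<in> L2 M"
    and bessel: "\<And>c. (l2_norm M (\<lambda>q. \<Sum>i\<in>I. c i * t i q))\<^sup>2 \<le> C\<^sup>2 * (\<Sum>i\<in>I. (cmod (c i))\<^sup>2)"
  shows "(\<Sum>i\<in>I. Re (l2_inner M (t i) (\<rho> (t i)))) \<le> C\<^sup>2"
proof -
  have pos: "positive_operator M \<rho>" using \<rho> by (auto simp: density_operator_def)
  then have b: "bounded_operator M \<rho>" by (simp add: positive_operator_def)
  interpret R: psd_form "L2 M" "\<lambda>f g. l2_inner M f (\<rho> g)" by (rule psd_form_positive_operator[OF pos])
  obtain G T where G: "finite G" "orthonormal M G"
    and T: "\<And>i. i \<in> I \<Longrightarrow> AE q in M. t i q = (\<Sum>g\<in>G. T g i * g q)"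
    by (rule Gram_Schmidt[OF I, of t M]) (erule t, rule that)
  have GL: "\<And>g. g \<in> G \<Longrightarrow> g \<in> L2 M" using G by (auto simp: orthonormal_def)
  have sumL: "(\<lambda>q. \<Sum>g\<in>G. c g * g q) \<in> L2 M" for c using GL by (rule L2_sum)
  have quad: "l2_inner M (\<lambda>q. \<Sum>g\<in>G. c g * g q) (\<rho> (\<lambda>q. \<Sum>g\<in>G. c g * g q)) =
      (\<Sum>k\<in>G. \<Sum>l\<in>G. cnj (c k) * c l * l2_inner M k (\<rho> l))" for c
  proof (cases "G = {}")
    case True
    have "l2_inner M (\<lambda>_. 0) (\<rho> (\<lambda>_. 0)) = 0" by simp
    then show ?thesis using True by simp
  next
    case False
    have "l2_inner M (\<lambda>q. \<Sum>g\<in>G. c g * g q) (\<rho> (\<lambda>q. \<Sum>g\<in>G. c g * g q)) =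
        (\<Sum>k\<in>G. cnj (c k) * l2_inner M k (\<rho> (\<lambda>q. \<Sum>g\<in>G. c g * g q)))"
      by (rule l2_inner_sum_left) (auto intro: bounded_operator_L2[OF b] sumL GL)
    also have "\<dots> = (\<Sum>k\<in>G. cnj (c k) * (\<Sum>l\<in>G. c l * l2_inner M k (\<rho> l)))"
      by (intro sum.cong refl arg_cong2[where f = "(*)"] R.sum_right_nonempty G False GL)
    finally show ?thesis by (simp add: sum_distrib_left mult_ac)
  qed
  have "(\<Sum>i\<in>I. Re (\<Sum>k\<in>G. \<Sum>l\<in>G. cnj (T k i) * T l i * l2_inner M k (\<rho> l))) \<le> C\<^sup>2 * (\<Sum>k\<in>G. Re (l2_inner M k (\<rho> k)))"
  proof (rule psd_trace_contraction[OF G(1) I])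
    show "l2_inner M l (\<rho> k) = cnj (l2_inner M k (\<rho> l))" if "k \<in> G" "l \<in> G" for k l
      using that GL by (intro R.swap) auto
    show "0 \<le> Re (\<Sum>k\<in>G. \<Sum>l\<in>G. cnj (c k) * c l * l2_inner M k (\<rho> l))" for c
      unfolding quad[symmetric] by (rule R.nonneg[OF sumL])
    show "(\<Sum>k\<in>G. (cmod (\<Sum>i\<in>I. T k i * c i))\<^sup>2) \<le> C\<^sup>2 * (\<Sum>i\<in>I. (cmod (c i))\<^sup>2)" for c
    proof -
      have "AE q in M. \<forall>i\<in>I. t i q = (\<Sum>g\<in>G. T g i * g q)"
        using T I by (intro AE_finite_allI) auto
      then have "AE q in M. (\<Sum>i\<in>I. c i * t i q) = (\<Sum>g\<in>G. (\<Sum>i\<in>I. T g i * c i) * g q)"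
      proof eventually_elim
        case (elim q)
        then have "(\<Sum>i\<in>I. c i * t i q) = (\<Sum>i\<in>I. \<Sum>g\<in>G. c i * (T g i * g q))"
          by (simp add: sum_distrib_left)
        also have "\<dots> = (\<Sum>g\<in>G. (\<Sum>i\<in>I. T g i * c i) * g q)"
          unfolding sum_distrib_right by (subst sum.swap) (simp add: mult_ac)
        finally show ?case .
      qed
      then have "l2_norm M (\<lambda>q. \<Sum>i\<in>I. c i * t i q) = l2_norm M (\<lambda>q. \<Sum>g\<in>G. (\<Sum>i\<in>I. T g i * c i) * g q)"
        by (intro l2_norm_cong L2_sum sumL t)
      then show ?thesis
        using bessel[of c] orthonormal_norm_sum[OF G(2,1) order_refl, of "\<lambda>g. \<Sum>i\<in>I. T g i * c i"] by simp
    qed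
  qed
  also have "\<dots> \<le> C\<^sup>2 * 1" by (intro mult_left_mono density_operator_trace_le[OF \<rho> G]) auto
  finally have "(\<Sum>i\<in>I. Re (\<Sum>k\<in>G. \<Sum>l\<in>G. cnj (T k i) * T l i * l2_inner M k (\<rho> l))) \<le> C\<^sup>2" by simp
  moreover have "l2_inner M (t i) (\<rho> (t i)) = (\<Sum>k\<in>G. \<Sum>l\<in>G. cnj (T k i) * T l i * l2_inner M k (\<rho> l))" if i: "i \<in> I" for i
  proof -
    let ?u = "\<lambda>q. \<Sum>g\<in>G. T g i * g q"
    have "l2_inner M (t i) (\<rho> (t i)) = l2_inner M (t i) (\<rho> ?u)"
      by (rule bounded_operator_cong[OF b t[OF i] sumL T[OF i] t[OF i]])
    also have "\<dots> = l2_inner M ?u (\<rho> ?u)"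
      by (rule l2_inner_cong_left[OF t[OF i] sumL bounded_operator_L2[OF b sumL] T[OF i]])
    finally show ?thesis by (simp add: quad)
  qed
  ultimately show ?thesis by simp
qed

section \<open>Projection-valued measures\<close>

locale pvm =
  fixes M :: "'a measure" and E :: "real set \<Rightarrow> 'a operator"
  assumes pvm: "projection_valued_measure M E"
begin

abbreviation ip where "ip \<equiv> l2_inner M"

definition ran :: "real set \<Rightarrow> ('a \<Rightarrow> complex) set" where
  "ran S = {f \<in> L2 M. AE q in M. E S f q = f q}"

lemma ran_L2: "f \<in> ran S \<Longrightarrow> f \<in> L2 M"
  by (simp add: ran_def)

lemma E_bounded: "S \<in> sets borel \<Longrightarrow> bounded_operator M (E S)"
  using pvm by (auto simp: projection_valued_measure_def orthogonal_projection_def)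

lemma E_L2: "S \<in> sets borel \<Longrightarrow> f \<in> L2 M \<Longrightarrow> E S f \<in> L2 M"
  by (rule bounded_operator_L2[OF E_bounded])

lemma E_sym: "S \<in> sets borel \<Longrightarrow> f \<in> L2 M \<Longrightarrow> g \<in> L2 M \<Longrightarrow> ip f (E S g) = ip (E S f) g"
  using pvm by (auto simp: projection_valued_measure_def orthogonal_projection_def)

lemma E_in_ran: "S \<in> sets borel \<Longrightarrow> f \<in> L2 M \<Longrightarrow> E S f \<in> ran S"
  using pvm E_L2[of S f] by (auto simp: ran_def projection_valued_measure_def orthogonal_projection_def)

lemma ran_right: "S \<in> sets borel \<Longrightarrow> f \<in> ran S \<Longrightarrow> g \<in> L2 M \<Longrightarrow> ip g (E S f) = ip g f"
  by (rule l2_inner_cong_right) (auto simp: ran_def E_L2)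

lemma ran_left: "S \<in> sets borel \<Longrightarrow> f \<in> ran S \<Longrightarrow> g \<in> L2 M \<Longrightarrow> ip (E S f) g = ip f g"
  by (rule l2_inner_cong_left) (auto simp: ran_def E_L2)

lemma E_self: "S \<in> sets borel \<Longrightarrow> f \<in> L2 M \<Longrightarrow> ip f (E S f) = of_real ((l2_norm M (E S f))\<^sup>2)"
  using ran_right[of S "E S f" f] E_sym[of S f "E S f"] by (simp add: E_in_ran E_L2 l2_inner_self)

lemma E_norm_le:
  assumes "S \<in> sets borel" "f \<in> L2 M"
  shows "l2_norm M (E S f) \<le> l2_norm M f"
proof -
  have "(l2_norm M (E S f))\<^sup>2 = cmod (ip f (E S f))" by (simp add: E_self assms norm_power)
  also have "\<dots> \<le> l2_norm M f * l2_norm M (E S f)" by (intro l2_Cauchy_Schwarz E_L2 assms)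
  finally have "l2_norm M (E S f) * l2_norm M (E S f) \<le> l2_norm M f * l2_norm M (E S f)"
    by (simp add: power2_eq_square)
  then show ?thesis
    by (cases "l2_norm M (E S f) = 0") (simp_all add: mult_le_cancel_right order_less_le)
qed

lemma E_sums:
  "range S \<subseteq> sets borel \<Longrightarrow> disjoint_family S \<Longrightarrow> f \<in> L2 M \<Longrightarrow> g \<in> L2 M \<Longrightarrow>
    (\<lambda>n::nat. ip f (E (S n) g)) sums ip f (E (\<Union>n. S n) g)"
  using pvm by (auto simp: projection_valued_measure_def)

lemma E_empty:
  assumes "f \<in> L2 M" "g \<in> L2 M"
  shows "ip f (E {} g) = 0"
proof -
  have "(\<lambda>n::nat. ip f (E {} g)) sums ip f (E {} g)"
    using E_sums[of "\<lambda>_. {}" f g] assms by (simp add: disjoint_family_on_def)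
  then have "(\<lambda>n::nat. ip f (E {} g)) \<longlonglongrightarrow> 0"
    using summable_LIMSEQ_zero sums_summable by blast
  then show ?thesis by (simp add: LIMSEQ_const_iff)
qed

lemma E_Un:
  assumes S: "S \<in> sets borel" "S' \<in> sets borel" "S \<inter> S' = {}" and fg: "f \<in> L2 M" "g \<in> L2 M"
  shows "ip f (E (S \<union> S') g) = ip f (E S g) + ip f (E S' g)"
proof -
  let ?S = "\<lambda>n::nat. if n = 0 then S else if n = 1 then S' else {}"
  have "(\<lambda>n. ip f (E (?S n) g)) sums ip f (E (\<Union>n. ?S n) g)"
    using S fg by (intro E_sums) (auto simp: disjoint_family_on_def)
  moreover have "(\<Union>n. ?S n) = S \<union> S'"
  proof
    show "(\<Union>n. ?S n) \<subseteq> S \<union> S'" by (auto split: if_splits)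
    have "S = ?S 0" "S' = ?S 1" by auto
    then show "S \<union> S' \<subseteq> (\<Union>n. ?S n)" by blast
  qed
  moreover have "(\<lambda>n. ip f (E (?S n) g)) sums (\<Sum>n\<in>{0, 1}. ip f (E (?S n) g))"
    by (rule sums_finite) (auto simp: E_empty fg)
  ultimately show ?thesis using sums_unique2 by fastforce
qed

text \<open>\<open>projection_valued_measure\<close> states additivity; multiplicativity starts
  here, from Pythagoras: \<open>E S\<close> already exhausts the norm of \<open>f\<close>, and
  \<open>E (S \<union> S')\<close> is a contraction, so nothing remains for
  \<open>E S' f\<close>.\<close>

lemma E_disjoint:
  assumes S: "S \<in> sets borel" "S' \<in> sets borel" "S \<inter> S' = {}" and f: "f \<in> ran S" and g: "g \<in> L2 M"
  shows "ip g (E S' f) = 0"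
proof -
  have fL: "f \<in> L2 M" using f by (rule ran_L2)
  have "ip f (E (S \<union> S') f) = ip f (E S f) + ip f (E S' f)" by (rule E_Un) (use S fL in auto)
  also have "ip f (E S f) = ip f f" by (rule ran_right[OF S(1) f fL])
  finally have "complex_of_real ((l2_norm M (E (S \<union> S') f))\<^sup>2) = of_real ((l2_norm M f)\<^sup>2 + (l2_norm M (E S' f))\<^sup>2)"
    using S fL by (simp add: E_self l2_inner_self)
  then have "(l2_norm M (E (S \<union> S') f))\<^sup>2 = (l2_norm M f)\<^sup>2 + (l2_norm M (E S' f))\<^sup>2"
    by (simp only: of_real_eq_iff)
  moreover have "(l2_norm M (E (S \<union> S') f))\<^sup>2 \<le> (l2_norm M f)\<^sup>2"
    using S fL by (intro power_mono E_norm_le) auto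
  ultimately have "l2_norm M (E S' f) = 0" by simp
  then show ?thesis using l2_Cauchy_Schwarz[OF g E_L2[OF S(2) fL]] by simp
qed

lemma E_inter:
  assumes S: "S \<in> sets borel" "S' \<in> sets borel" and f: "f \<in> ran S" and g: "g \<in> L2 M"
  shows "ip g (E S' f) = ip g (E (S \<inter> S') f)"
proof -
  have "ip g (E ((S \<inter> S') \<union> (S' - S)) f) = ip g (E (S \<inter> S') f) + ip g (E (S' - S) f)"
    using S ran_L2[OF f] g by (intro E_Un) auto
  moreover have "ip g (E (S' - S) f) = 0" using S by (intro E_disjoint[OF _ _ _ f g]) auto
  moreover have "(S \<inter> S') \<union> (S' - S) = S'" by auto
  ultimately show ?thesis by simp
qed

lemma ran_mono:
  assumes S: "S \<in> sets borel" "S' \<in> sets borel" "S \<subseteq> S'" and f: "f \<in> ran S"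
  shows "f \<in> ran S'"
proof -
  have fL: "f \<in> L2 M" using f by (rule ran_L2)
  have "AE q in M. E S' f q = f q"
  proof (rule AE_eq_if_l2_inner_eq)
    fix h assume h: "h \<in> L2 M"
    have "S \<inter> S' = S" using S by auto
    then show "ip h (E S' f) = ip h f"
      using E_inter[OF S(1,2) f h] ran_right[OF S(1) f h] by simp
  qed (use S fL E_L2 in auto)
  then show ?thesis using fL by (simp add: ran_def)
qed

lemma ran_scale:
  assumes S: "S \<in> sets borel" and f: "f \<in> ran S"
  shows "(\<lambda>q. c * f q) \<in> ran S"
proof -
  have fL: "f \<in> L2 M" using f by (rule ran_L2)
  have "AE q in M. E S (\<lambda>q. c * f q) q = c * E S f q"
    using E_bounded[OF S] fL by (auto simp: bounded_operator_def)
  moreover have "AE q in M. E S f q = f q" using f by (simp add: ran_def)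
  ultimately have "AE q in M. E S (\<lambda>q. c * f q) q = c * f q" by eventually_elim simp
  then show ?thesis using L2_scale[OF fL] by (simp add: ran_def)
qed

lemma ran_add:
  assumes S: "S \<in> sets borel" and f: "f \<in> ran S" and g: "g \<in> ran S"
  shows "(\<lambda>q. f q + g q) \<in> ran S"
proof -
  have L: "f \<in> L2 M" "g \<in> L2 M" using f g by (auto simp: ran_L2)
  have "AE q in M. E S (\<lambda>q. f q + g q) q = E S f q + E S g q"
    using E_bounded[OF S] L by (auto simp: bounded_operator_def)
  moreover have "AE q in M. E S f q = f q" "AE q in M. E S g q = g q" using f g by (auto simp: ran_def)
  ultimately have "AE q in M. E S (\<lambda>q. f q + g q) q = f q + g q" by eventually_elim simp
  then show ?thesis using L2_add[OF L] by (simp add: ran_def)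
qed

lemma ran_sum:
  assumes "S \<in> sets borel" "finite I" "I \<noteq> {}" "\<And>i. i \<in> I \<Longrightarrow> g i \<in> ran S"
  shows "(\<lambda>q. \<Sum>i\<in>I. c i * g i q) \<in> ran S"
  using assms(2,3,4)
proof (induction I rule: finite_ne_induct)
  case (insert i I)
  then show ?case
    using ran_add[OF assms(1), of "\<lambda>q. c i * g i q" "\<lambda>q. \<Sum>i\<in>I. c i * g i q"] ran_scale[OF assms(1), of "g i" "c i"] by simp
qed (simp add: ran_scale assms(1))

abbreviation \<mu> where "\<mu> \<equiv> diagonal_measure M E"

lemma sets_\<mu> [simp, measurable_cong]: "sets (\<mu> f) = sets borel" and space_\<mu> [simp]: "space (\<mu> f) = UNIV"
proof -
  have s: "sigma_sets UNIV (sets (borel :: real measure)) = sets borel"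
    using sets.sigma_sets_eq[of "borel :: real measure"] by simp
  show "sets (\<mu> f) = sets borel" "space (\<mu> f) = UNIV"
    by (simp_all add: diagonal_measure_def s)
qed

lemma emeasure_\<mu>:
  assumes f: "f \<in> L2 M" and S: "S \<in> sets borel"
  shows "emeasure (\<mu> f) S = ennreal ((l2_norm M (E S f))\<^sup>2)"
proof -
  let ?m = "\<lambda>S. ennreal (Re (ip f (E S f)))"
  \<comment> \<open>Without countable additivity \<open>measure_of\<close> would fall back to the
    zero measure.\<close>
  have ca: "countably_additive (sets borel) ?m"
  proof (rule countably_additiveI)
    fix A :: "nat \<Rightarrow> real set" assume A: "range A \<subseteq> sets borel" "disjoint_family A" "(\<Union>i. A i) \<in> sets borel"
    have "(\<lambda>n. ip f (E (A n) f)) sums ip f (E (\<Union>n. A n) f)" using A f by (intro E_sums)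
    then have "(\<lambda>n. Re (ip f (E (A n) f))) sums Re (ip f (E (\<Union>n. A n) f))" by (rule sums_Re)
    moreover have "0 \<le> Re (ip f (E (A n) f))" for n using A f by (subst E_self) auto
    ultimately show "suminf (\<lambda>n. ?m (A n)) = ?m (\<Union>n. A n)" by (intro suminf_ennreal_eq) auto
  qed
  have "emeasure (\<mu> f) S = ?m S"
    unfolding diagonal_measure_def
    by (rule emeasure_measure_of_sigma[OF _ _ ca S])
       (use sets.sigma_algebra_axioms[of "borel :: real measure"] E_empty[OF f f] in \<open>auto simp: positive_def\<close>)
  then show ?thesis using S f by (simp add: E_self)
qed

lemma finite_measure_\<mu>: "f \<in> L2 M \<Longrightarrow> finite_measure (\<mu> f)"
  by (rule finite_measureI) (simp add: emeasure_\<mu>)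

lemma measure_\<mu>: "f \<in> L2 M \<Longrightarrow> S \<in> sets borel \<Longrightarrow> measure (\<mu> f) S = (l2_norm M (E S f))\<^sup>2"
  by (simp add: measure_def emeasure_\<mu>)

lemma E_UNIV: "f \<in> L2 M \<Longrightarrow> l2_norm M (E UNIV f) = l2_norm M f"
  using pvm by (intro l2_norm_cong E_L2) (auto simp: projection_valued_measure_def)

lemma AE_\<mu>:
  assumes S: "S \<in> sets borel" and f: "f \<in> ran S"
  shows "AE s in \<mu> f. s \<in> S"
proof (rule AE_I[of _ _ "- S"])
  have fL: "f \<in> L2 M" using f by (rule ran_L2)
  have "ip f (E (- S) f) = 0" using S by (intro E_disjoint[OF S _ _ f fL]) auto
  then show "emeasure (\<mu> f) (- S) = 0"
    using S fL by (simp add: emeasure_\<mu> E_self)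
qed (use S in auto)

lemma integrable_bounded_\<mu>:
  assumes "S \<in> sets borel" "S \<subseteq> {a..b}" "f \<in> ran S"
  shows "integrable (\<mu> f) (\<lambda>s. s)" "integrable (\<mu> f) (\<lambda>s. s\<^sup>2)"
proof -
  interpret finite_measure "\<mu> f" using assms by (intro finite_measure_\<mu> ran_L2)
  have AE: "AE s in \<mu> f. \<bar>s\<bar> \<le> max \<bar>a\<bar> \<bar>b\<bar>" using AE_\<mu>[OF assms(1,3)]
  proof eventually_elim
    case (elim s)
    then have "a \<le> s" "s \<le> b" using assms(2) by auto
    then show ?case by linarith
  qed
  show "integrable (\<mu> f) (\<lambda>s. s)"
    by (rule integrable_const_bound[of _ "max \<bar>a\<bar> \<bar>b\<bar>"]) (use AE in auto)
  have "AE s in \<mu> f. \<bar>s\<^sup>2\<bar> \<le> (max \<bar>a\<bar> \<bar>b\<bar>)\<^sup>2"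
    using AE
  proof eventually_elim
    case (elim s)
    then have "\<bar>s\<bar>\<^sup>2 \<le> (max \<bar>a\<bar> \<bar>b\<bar>)\<^sup>2" by (intro power_mono) auto
    then show ?case by simp
  qed
  then show "integrable (\<mu> f) (\<lambda>s. s\<^sup>2)"
    by (intro integrable_const_bound[of _ "(max \<bar>a\<bar> \<bar>b\<bar>)\<^sup>2"]) auto
qed

text \<open>Cross terms between disjoint spectral subspaces vanish, so the measure of
  \<open>e\<close> is the restriction to \<open>S\<close> of the measure of the sum. First moments
  of \<open>e\<close> and \<open>f\<close> then become parts of one integral.\<close>

lemma \<mu>_density:
  assumes S: "S \<in> sets borel" "S' \<in> sets borel" "S \<inter> S' = {}" and e: "e \<in> ran S" and f: "f \<in> ran S'"
  shows "\<mu> e = density (\<mu> (\<lambda>q. e q + f q)) (\<lambda>s. ennreal (indicator S s))"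
proof (rule measure_eqI)
  let ?h = "\<lambda>q. e q + f q"
  have eL: "e \<in> L2 M" and fL: "f \<in> L2 M" using e f by (auto simp: ran_L2)
  have hL: "?h \<in> L2 M" by (rule L2_add[OF eL fL])
  fix A assume "A \<in> sets (\<mu> e)"
  then have A: "A \<in> sets borel" by simp
  then have SA: "S \<inter> A \<in> sets borel" using S by auto
  have dis: "ip g (E (S \<inter> A) f) = 0" if "g \<in> L2 M" for g
    using S by (intro E_disjoint[OF S(2) SA _ f that]) auto
  have "ip ?h (E (S \<inter> A) ?h) = ip ?h (E (S \<inter> A) e) + ip ?h (E (S \<inter> A) f)"
    by (rule bounded_operator_inner_add[OF E_bounded[OF SA] hL eL fL])
  also have "\<dots> = ip e (E (S \<inter> A) e) + ip f (E (S \<inter> A) e)"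
    using dis[OF hL] by (simp add: l2.add_left eL fL E_L2[OF SA])
  also have "ip f (E (S \<inter> A) e) = cnj (ip e (E (S \<inter> A) f))"
    using E_sym[OF SA fL eL] l2.swap[OF eL E_L2[OF SA fL]] by simp
  finally have "ip ?h (E (S \<inter> A) ?h) = ip e (E A e)"
    using dis[OF eL] E_inter[OF S(1) A e eL] by simp
  then have "complex_of_real ((l2_norm M (E (S \<inter> A) ?h))\<^sup>2) = of_real ((l2_norm M (E A e))\<^sup>2)"
    by (simp only: E_self[OF SA hL] E_self[OF A eL])
  then have eq: "(l2_norm M (E (S \<inter> A) ?h))\<^sup>2 = (l2_norm M (E A e))\<^sup>2" by (simp only: of_real_eq_iff)
  have "emeasure (density (\<mu> ?h) (\<lambda>s. ennreal (indicator S s))) A =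
      (\<integral>\<^sup>+ s. ennreal (indicator S s) * indicator A s \<partial>\<mu> ?h)"
    using S A by (intro emeasure_density) auto
  also have "\<dots> = (\<integral>\<^sup>+ s. indicator (S \<inter> A) s \<partial>\<mu> ?h)"
    by (intro nn_integral_cong) (auto simp: indicator_def)
  also have "\<dots> = emeasure (\<mu> ?h) (S \<inter> A)" using SA by simp
  finally show "emeasure (\<mu> e) A = emeasure (density (\<mu> ?h) (\<lambda>s. ennreal (indicator S s))) A"
    by (simp add: emeasure_\<mu> eL hL A SA eq)
qed simp

lemma integral_\<mu>_add:
  assumes S: "S \<in> sets borel" "S' \<in> sets borel" "S \<inter> S' = {}" "S \<subseteq> {a..b}" "S' \<subseteq> {a..b}"
    and e: "e \<in> ran S" and f: "f \<in> ran S'"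
  shows "(LINT s|\<mu> (\<lambda>q. e q + f q). s) = (LINT s|\<mu> e. s) + (LINT s|\<mu> f. s)"
proof -
  let ?h = "\<lambda>q. e q + f q"
  have SS: "S \<union> S' \<in> sets borel" using S by auto
  have h: "?h \<in> ran (S \<union> S')"
    using S by (intro ran_add[OF SS] ran_mono[OF S(1) SS _ e] ran_mono[OF S(2) SS _ f]) auto
  have int: "integrable (\<mu> ?h) (\<lambda>s. s)" by (rule integrable_bounded_\<mu>[OF SS _ h]) (use S in auto)
  have fd: "\<mu> f = density (\<mu> ?h) (\<lambda>s. ennreal (indicator S' s))"
    using \<mu>_density[OF S(2,1) _ f e] S(3) by (simp add: Int_commute add.commute)
  have "(LINT s|\<mu> e. s) = (LINT s|\<mu> ?h. indicator S s * s)"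
    unfolding \<mu>_density[OF S(1-3) e f] using S(1) by (subst integral_density) auto
  moreover have "(LINT s|\<mu> f. s) = (LINT s|\<mu> ?h. indicator S' s * s)"
    unfolding fd using S(2) by (subst integral_density) auto
  moreover have "integrable (\<mu> ?h) (\<lambda>s. indicator S s * s)" "integrable (\<mu> ?h) (\<lambda>s. indicator S' s * s)"
    using integrable_mult_indicator[OF _ int, of S] integrable_mult_indicator[OF _ int, of S'] S by simp_all
  moreover have "(LINT s|\<mu> ?h. s) = (LINT s|\<mu> ?h. indicator S s * s + indicator S' s * s)"
  proof (rule integral_cong_AE)
    show "AE s in \<mu> ?h. s = indicator S s * s + indicator S' s * s"
      using AE_\<mu>[OF SS h] by eventually_elim (use S(3) in \<open>auto simp: indicator_def\<close>)
  qed (use S in auto)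
  ultimately show ?thesis by simp
qed

end

section \<open>Nonnegative operators with a spectral measure\<close>

text \<open>The graph \<open>N\<close> is tied to \<open>E\<close> only by its domain and its
  quadratic form. Symmetry stands in for linearity of \<open>N\<close>.\<close>

locale nonneg_spectral =
  fixes M :: "'a measure" and N :: "'a graph" and E :: "real set \<Rightarrow> 'a operator"
  assumes spec: "spectral_measure_of M N E"
    and N_L2: "N f g \<Longrightarrow> f \<in> L2 M \<and> g \<in> L2 M"
    and N_sym: "N f g \<Longrightarrow> N f' g' \<Longrightarrow> l2_inner M f g' = l2_inner M g f'"
    and N_nonneg: "N f g \<Longrightarrow> Re (l2_inner M f g) \<ge> 0"
begin

sublocale pvm M E
  using spec by unfold_locales (simp add: spectral_measure_of_def)

abbreviation Nf where "Nf \<equiv> op_app N"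

lemma bounded_domain:
  assumes "S \<in> sets borel" "S \<subseteq> {a..b}" "f \<in> ran S"
  shows "N f (Nf f)"
proof -
  have "\<exists>g. N f g"
    using spec integrable_bounded_\<mu>(2)[OF assms] ran_L2[OF assms(3)] by (auto simp: spectral_measure_of_def)
  then show ?thesis unfolding op_app_def by (rule someI_ex)
qed

lemma form_eq_integral: "N f g \<Longrightarrow> ip f g = of_real (LINT s|\<mu> f. s)"
  using spec by (auto simp: spectral_measure_of_def)

text \<open>A nonzero vector with spectrum in the negative axis would have a negative first moment,
  against \<open>N_nonneg\<close>. Cutting the axis into bounded pieces puts the projected vectors
  into the domain of \<open>N\<close>.\<close>

lemma E_negative:
  assumes f: "f \<in> L2 M"
  shows "l2_norm M (E {..<0} f) = 0"
proof -
  define I where "I k = {- real k - 1..<- real k}" for k :: nat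
  have Ib: "I k \<in> sets borel" for k by (simp add: I_def)
  have zero: "l2_norm M (E (I k) f) = 0" for k
  proof -
    define g where "g = E (I k) f"
    have g: "g \<in> ran (I k)" unfolding g_def by (rule E_in_ran[OF Ib f])
    have gL: "g \<in> L2 M" by (rule ran_L2[OF g])
    have sub: "I k \<subseteq> {- real k - 1..0}" by (auto simp: I_def)
    note int = integrable_bounded_\<mu>(1)[OF Ib sub g]
    have neg: "AE s in \<mu> g. s < 0" using AE_\<mu>[OF Ib g] by eventually_elim (auto simp: I_def)
    have Ng: "N g (Nf g)" by (rule bounded_domain[OF Ib sub g])
    have "(LINT s|\<mu> g. s) \<ge> 0"
      using N_nonneg[OF Ng] form_eq_integral[OF Ng] by simp
    moreover have "(LINT s|\<mu> g. - s) \<ge> 0" using neg by (intro integral_nonneg_AE) auto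
    ultimately have "(LINT s|\<mu> g. - s) = 0" by simp
    then have "AE s in \<mu> g. - s = 0"
      using neg int by (subst (asm) integral_nonneg_eq_0_iff_AE) auto
    with neg have "AE s in \<mu> g. False" by eventually_elim simp
    then have "emeasure (\<mu> g) UNIV = 0"
      by (simp add: AE_iff_measurable[of UNIV])
    then show ?thesis
      by (simp add: emeasure_\<mu> gL E_UNIV g_def[symmetric])
  qed
  have "(\<Union>k. I k) = {..<0}"
  proof
    show "(\<Union>k. I k) \<subseteq> {..<0}" by (auto simp: I_def)
    show "{..<0} \<subseteq> (\<Union>k. I k)"
    proof
      fix s :: real assume "s \<in> {..<0}"
      then have "s \<in> I (nat (\<lceil>- s\<rceil> - 1))" unfolding I_def by auto linarith+
      then show "s \<in> (\<Union>k. I k)" by blast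
    qed
  qed
  moreover have "disjoint_family I"
  proof -
    have "x \<in> I m \<Longrightarrow> x \<in> I n \<Longrightarrow> m = n" for x m n
      unfolding I_def by simp
    then show ?thesis by (auto simp: disjoint_family_on_def)
  qed
  ultimately have "(\<lambda>k. ip f (E (I k) f)) sums ip f (E {..<0} f)"
    using E_sums[of I f f] f Ib by auto
  then have "(\<lambda>k. 0) sums ip f (E {..<0} f)" by (simp add: E_self f Ib zero)
  then have "ip f (E {..<0} f) = 0" using sums_unique2 sums_zero by blast
  then show ?thesis by (simp add: E_self f)
qed

text \<open>First moments add for disjoint spectral sets, so in the form on \<open>e + f'\<close>
  the cross terms have real part zero. This is the substitute for \<open>N\<close> commuting with
  \<open>E\<close>.\<close>

lemma N_orthogonal:
  assumes S: "S \<in> sets borel" "S' \<in> sets borel" "S \<inter> S' = {}" "S \<subseteq> {a..b}" "S' \<subseteq> {a..b}"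
    and e: "e \<in> ran S" and f: "f \<in> ran S'"
  shows "ip (Nf e) f = 0"
proof -
  have eL: "e \<in> L2 M" using e by (rule ran_L2)
  have Ne: "N e (Nf e)" by (rule bounded_domain[OF S(1,4) e])
  have NeL: "Nf e \<in> L2 M" using N_L2[OF Ne] by simp
  have SS: "S \<union> S' \<in> sets borel" using S by auto
  have "Re (ip (Nf e) f') = 0" if f': "f' \<in> ran S'" for f'
  proof -
    let ?h = "\<lambda>q. e q + f' q"
    have fL: "f' \<in> L2 M" using f' by (rule ran_L2)
    have Nf': "N f' (Nf f')" by (rule bounded_domain[OF S(2,5) f'])
    have NfL: "Nf f' \<in> L2 M" using N_L2[OF Nf'] by simp
    have h: "?h \<in> ran (S \<union> S')"
      using S by (intro ran_add[OF SS] ran_mono[OF S(1) SS _ e] ran_mono[OF S(2) SS _ f']) auto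
    have hL: "?h \<in> L2 M" using h by (rule ran_L2)
    have Nh: "N ?h (Nf ?h)" by (rule bounded_domain[OF SS _ h, of a b]) (use S in auto)
    have NhL: "Nf ?h \<in> L2 M" using N_L2[OF Nh] by simp
    have "ip ?h (Nf ?h) = ip e (Nf ?h) + ip f' (Nf ?h)" by (rule l2.add_left[OF eL fL NhL])
    also have "\<dots> = ip (Nf e) ?h + ip (Nf f') ?h" by (simp only: N_sym[OF Ne Nh] N_sym[OF Nf' Nh])
    also have "\<dots> = (ip (Nf e) e + ip (Nf e) f') + (ip (Nf f') e + ip (Nf f') f')"
      by (simp only: l2.add_right[OF NeL eL fL] l2.add_right[OF NfL eL fL])
    finally have eq: "ip ?h (Nf ?h) = (ip (Nf e) e + ip (Nf e) f') + (ip (Nf f') e + ip (Nf f') f')" .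
    have sw: "ip (Nf f') e = cnj (ip (Nf e) f')"
      using N_sym[OF Nf' Ne] l2.swap[OF NeL fL] by simp
    have "ip ?h (Nf ?h) = ip e (Nf e) + ip f' (Nf f')"
      by (simp only: form_eq_integral[OF Nh] form_eq_integral[OF Ne] form_eq_integral[OF Nf']
          integral_\<mu>_add[OF S e f'] of_real_add)
    then have "Re (ip (Nf e) f') + Re (ip (Nf f') e) = 0"
      using eq by (simp add: N_sym[OF Ne Ne] N_sym[OF Nf' Nf'] complex_eq_iff)
    then show ?thesis unfolding sw by simp
  qed
  \<comment> \<open>The multiple of \<open>f\<close> by \<open>\<i>\<close> yields the imaginary
    part.\<close>
  from this[OF f] this[OF ran_scale[OF S(2) f, of \<i>]] show ?thesis
    by (simp add: l2.scale_right[OF NeL ran_L2[OF f]] complex_eq_iff)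
qed

text \<open>The part of the nonnegative axis where the ceiling equals \<open>j\<close>, so
  \<open>E (level j)\<close> is a spectral projection of the ceiling of \<open>N\<close>; level 0 is
  the single point 0.\<close>

definition level :: "nat \<Rightarrow> real set" where
  "level j = (if j = 0 then {0} else {real j - 1<..real j})"

lemma level_borel [simp]: "level j \<in> sets borel"
  by (simp add: level_def)

lemma level_subset: "j \<le> n \<Longrightarrow> level j \<subseteq> {0..real n}"
  by (auto simp: level_def)

lemma level_iff: "s \<in> level j \<longleftrightarrow> s \<ge> 0 \<and> j = nat \<lceil>s\<rceil>"
  by (auto simp: level_def split: if_splits) linarith+

lemma level_disjoint: "i \<noteq> j \<Longrightarrow> level i \<inter> level j = {}"
  by (auto simp: level_iff)

lemma level_above: "j > n \<Longrightarrow> level j \<inter> {0..real n} = {}"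
  by (auto simp: level_def)

abbreviation below :: "nat \<Rightarrow> real set" where "below n \<equiv> {0..real n}"

lemma below_borel [simp]: "below n \<in> sets borel"
  by simp

lemma domain_below: "f \<in> ran (below n) \<Longrightarrow> N f (Nf f)"
  by (rule bounded_domain[of "below n" 0 "real n"]) auto

text \<open>On \<open>below n\<close> the function \<open>u\<close> of the proof is the ceiling,
  which exceeds \<open>s\<close> by at most 1; integrate against the spectral measure of
  \<open>f\<close>.\<close>

lemma ceiling_form:
  assumes f: "f \<in> ran (below n)"
  shows "(\<Sum>j\<le>n. real j * (l2_norm M (E (level j) f))\<^sup>2) - Re (ip f (Nf f)) \<in> {0..(l2_norm M f)\<^sup>2}"
proof -
  have fL: "f \<in> L2 M" using f by (rule ran_L2)
  interpret finite_measure "\<mu> f" by (rule finite_measure_\<mu>[OF fL])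
  define u where "u s = (\<Sum>j\<le>n. real j * indicator (level j) s)" for s :: real
  have us: "u s - 1 \<le> s \<and> s \<le> u s" if "s \<in> below n" for s
  proof -
    have "u s = (\<Sum>j\<le>n. if j = nat \<lceil>s\<rceil> then real j else 0)"
      unfolding u_def using that by (intro sum.cong) (auto simp: indicator_def level_iff)
    also have "\<dots> = real (nat \<lceil>s\<rceil>)" using that by (simp add: ceiling_le_iff nat_le_iff)
    finally show ?thesis using that by auto
  qed
  have int: "integrable (\<mu> f) (\<lambda>s. s)" by (rule integrable_bounded_\<mu>(1)[of "below n" 0 "real n"]) (use f in auto)
  have uint: "integrable (\<mu> f) u"
    unfolding u_def by (intro Bochner_Integration.integrable_sum integrable_mult_right integrable_real_indicator) (auto simp: emeasure_eq_measure)
  have "(LINT s|\<mu> f. u s) = (\<Sum>j\<le>n. real j * measure (\<mu> f) (level j))"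
    unfolding u_def
    by (subst Bochner_Integration.integral_sum)
       (auto intro!: integrable_mult_right integrable_real_indicator simp: emeasure_eq_measure)
  also have "\<dots> = (\<Sum>j\<le>n. real j * (l2_norm M (E (level j) f))\<^sup>2)" by (simp add: measure_\<mu> fL)
  finally have U: "(LINT s|\<mu> f. u s) = (\<Sum>j\<le>n. real j * (l2_norm M (E (level j) f))\<^sup>2)" .
  have AE: "AE s in \<mu> f. u s - 1 \<le> s \<and> s \<le> u s"
    using AE_\<mu>[OF below_borel f] by eventually_elim (rule us)
  have "(LINT s|\<mu> f. s) \<le> (LINT s|\<mu> f. u s)"
    using AE by (intro integral_mono_AE int uint) auto
  moreover have "(LINT s|\<mu> f. u s - 1) \<le> (LINT s|\<mu> f. s)"
    using AE by (intro integral_mono_AE int Bochner_Integration.integrable_diff uint) auto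
  moreover have "(LINT s|\<mu> f. u s - 1) = (LINT s|\<mu> f. u s) - (l2_norm M f)\<^sup>2"
    using uint measure_\<mu>[OF fL, of UNIV] by (simp add: E_UNIV fL)
  ultimately show ?thesis
    using form_eq_integral[OF domain_below[OF f]] by (simp add: U)
qed

text \<open>The form of the ceiling of \<open>N\<close> minus \<open>N\<close>. With
  \<open>Nf\<close> on the first argument, linearity in the second is automatic, and the symmetry of
  \<open>N\<close> transfers it to the first.\<close>

definition ceil_defect :: "nat \<Rightarrow> ('a \<Rightarrow> complex) \<Rightarrow> ('a \<Rightarrow> complex) \<Rightarrow> complex" where
  "ceil_defect n f g = (\<Sum>j\<le>n. of_nat j * ip f (E (level j) g)) - ip (Nf f) g"

lemma psd_form_ceil_defect: "psd_form (ran (below n)) (ceil_defect n)"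
proof
  fix f g h :: "'a \<Rightarrow> complex" and c
  assume f: "f \<in> ran (below n)"
  have fL: "f \<in> L2 M" using f by (rule ran_L2)
  have NfL: "Nf f \<in> L2 M" using N_L2[OF domain_below[OF f]] by simp
  show "(\<lambda>q. c * f q) \<in> ran (below n)" using f by (intro ran_scale) auto
  show "0 \<le> Re (ceil_defect n f f)"
  proof -
    have "Re (\<Sum>j\<le>n. of_nat j * ip f (E (level j) f)) = (\<Sum>j\<le>n. real j * (l2_norm M (E (level j) f))\<^sup>2)"
      unfolding Re_sum by (intro sum.cong refl) (simp add: E_self fL del: of_real_power)
    then show ?thesis
      using ceiling_form[OF f] N_sym[OF domain_below[OF f] domain_below[OF f]] by (simp add: ceil_defect_def)
  qed
  assume g: "g \<in> ran (below n)"
  have gL: "g \<in> L2 M" using g by (rule ran_L2)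
  show "(\<lambda>q. f q + g q) \<in> ran (below n)" using f g by (intro ran_add) auto
  show "ceil_defect n f (\<lambda>q. c * g q) = c * ceil_defect n f g"
    unfolding ceil_defect_def l2.scale_right[OF NfL gL] bounded_operator_inner_scale[OF E_bounded[OF level_borel] fL gL]
    by (simp add: right_diff_distrib sum_distrib_left mult_ac)
  show "ceil_defect n g f = cnj (ceil_defect n f g)"
  proof -
    have NgL: "Nf g \<in> L2 M" using N_L2[OF domain_below[OF g]] by simp
    have "ip (Nf g) f = cnj (ip (Nf f) g)"
      using N_sym[OF domain_below[OF g] domain_below[OF f]] l2.swap[OF NfL gL] by simp
    moreover have "ip g (E (level j) f) = cnj (ip f (E (level j) g))" for j
      using E_sym[OF level_borel fL gL] l2.swap[OF E_L2[OF level_borel fL] gL] by simp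
    ultimately show ?thesis unfolding ceil_defect_def by (simp add: cnj_sum)
  qed
  assume h: "h \<in> ran (below n)"
  have hL: "h \<in> L2 M" using h by (rule ran_L2)
  show "ceil_defect n f (\<lambda>q. g q + h q) = ceil_defect n f g + ceil_defect n f h"
    unfolding ceil_defect_def l2.add_right[OF NfL gL hL] bounded_operator_inner_add[OF E_bounded[OF level_borel] fL gL hL]
    by (simp add: distrib_left sum.distrib)
qed

lemma ceil_defect_le:
  assumes f: "f \<in> ran (below n)"
  shows "Re (ceil_defect n f f) \<le> (l2_norm M f)\<^sup>2"
proof -
  have fL: "f \<in> L2 M" using f by (rule ran_L2)
  have "Re (\<Sum>j\<le>n. of_nat j * ip f (E (level j) f)) = (\<Sum>j\<le>n. real j * (l2_norm M (E (level j) f))\<^sup>2)"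
    unfolding Re_sum by (intro sum.cong refl) (simp add: E_self fL del: of_real_power)
  then show ?thesis
    using ceiling_form[OF f] N_sym[OF domain_below[OF f] domain_below[OF f]] by (simp add: ceil_defect_def)
qed

lemma ran_level_orthogonal:
  assumes "i \<noteq> j" "e \<in> ran (level i)" "f \<in> L2 M"
  shows "ip f (E (level j) e) = 0"
  using assms by (intro E_disjoint[OF _ _ level_disjoint]) auto

text \<open>Takes the place of an eigenbasis of \<open>N\<close>: every member is an eigenvector of
  the ceiling of \<open>N\<close>. It is total because the levels and the negative axis exhaust the
  reals, and \<open>E_negative\<close> disposes of the latter.\<close>

lemma adapted_basis:
  obtains B idx where "orthonormal_basis M B" "orthonormal M B" "\<And>e. e \<in> B \<Longrightarrow> e \<in> ran (level (idx e))"
proof -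
  have "\<exists>B. B \<subseteq> ran (level j) \<and> orthonormal M B \<and>
      (\<forall>f\<in>ran (level j). (\<forall>e\<in>B. ip e f = 0) \<longrightarrow> (AE q in M. f q = 0))" for j
  proof -
    have sub: "ran (level j) \<subseteq> L2 M" using ran_L2 by blast
    obtain B where "B \<subseteq> ran (level j)" "orthonormal M B"
      "\<And>f. f \<in> ran (level j) \<Longrightarrow> (\<And>e. e \<in> B \<Longrightarrow> ip e f = 0) \<Longrightarrow> AE q in M. f q = 0"
      by (rule orthonormal_extend[of "{}", OF empty_subsetI sub ran_scale[OF level_borel]])
         (auto simp: orthonormal_def)
    then show ?thesis by (intro exI[of _ B]) simp
  qed
  then obtain B where B': "\<And>j. B j \<subseteq> ran (level j) \<and> orthonormal M (B j) \<and>
      (\<forall>f\<in>ran (level j). (\<forall>e\<in>B j. ip e f = 0) \<longrightarrow> (AE q in M. f q = 0))"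
    using choice[of "\<lambda>j B. B \<subseteq> ran (level j) \<and> orthonormal M B \<and>
      (\<forall>f\<in>ran (level j). (\<forall>e\<in>B. ip e f = 0) \<longrightarrow> (AE q in M. f q = 0))"] by auto
  then have B: "\<And>j. B j \<subseteq> ran (level j)" "\<And>j. orthonormal M (B j)"
    and max: "\<And>j f. f \<in> ran (level j) \<Longrightarrow> (\<And>e. e \<in> B j \<Longrightarrow> ip e f = 0) \<Longrightarrow> AE q in M. f q = 0"
    by blast+
  define idx where "idx e = (SOME j. e \<in> B j)" for e
  have idx: "e \<in> B (idx e)" if "e \<in> (\<Union>j. B j)" for e
    using that unfolding idx_def by (auto intro: someI)
  have BL: "B j \<subseteq> L2 M" for j using B(2) by (simp add: orthonormal_def)
  have orth: "orthonormal M (\<Union>j. B j)"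
    unfolding orthonormal_def
  proof (intro conjI ballI)
    show "(\<Union>j. B j) \<subseteq> L2 M" using BL by auto
    fix e f assume ef: "e \<in> (\<Union>j. B j)" "f \<in> (\<Union>j. B j)"
    show "ip e f = (if e = f then 1 else 0)"
    proof (cases "idx e = idx f")
      case True
      then show ?thesis using idx[OF ef(1)] idx[OF ef(2)] B(2)[of "idx e"] by (auto simp: orthonormal_def)
    next
      case False
      have e: "e \<in> ran (level (idx e))" and f: "f \<in> ran (level (idx f))" using idx ef B(1) by blast+
      have "ip e f = ip e (E (level (idx f)) f)" using ran_right[OF level_borel f ran_L2[OF e]] by simp
      also have "\<dots> = cnj (ip f (E (level (idx f)) e))"
        using E_sym[OF level_borel ran_L2[OF e] ran_L2[OF f], of "idx f"] l2.swap[OF ran_L2[OF f] E_L2[OF level_borel ran_L2[OF e]]] by simp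
      also have "\<dots> = 0" using ran_level_orthogonal[OF False e ran_L2[OF f]] by simp
      finally show ?thesis using False by auto
    qed
  qed
  have "AE q in M. f q = 0" if f: "f \<in> L2 M" and fB: "\<And>e. e \<in> (\<Union>j. B j) \<Longrightarrow> ip e f = 0" for f
  proof -
    have zero: "l2_norm M (E (level j) f) = 0" for j
    proof -
      have "AE q in M. E (level j) f q = 0"
      proof (rule max[OF E_in_ran[OF level_borel f]])
        fix e assume e: "e \<in> B j"
        then have "e \<in> ran (level j)" using B(1) by blast
        then have "ip e (E (level j) f) = ip e f"
          using E_sym[OF level_borel _ f] ran_left[OF level_borel _ f] ran_L2 by metis
        then show "ip e (E (level j) f) = 0" using fB e by auto
      qed
      then show ?thesis using l2_norm_eq_0_iff[OF E_L2[OF level_borel f]] by simp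
    qed
    define S where "S n = (case n of 0 \<Rightarrow> {..<0} | Suc j \<Rightarrow> level j)" for n :: nat
    have Sb: "S n \<in> sets borel" for n by (cases n) (auto simp: S_def)
    have "(\<Union>n. S n) = UNIV"
    proof -
      have "s \<in> (\<Union>n. S n)" for s :: real
      proof (cases "s < 0")
        case True
        then have "s \<in> S 0" by (simp add: S_def)
        then show ?thesis by blast
      next
        case False
        then have "s \<in> S (Suc (nat \<lceil>s\<rceil>))" by (simp add: S_def level_iff)
        then show ?thesis by blast
      qed
      then show ?thesis by blast
    qed
    moreover have "disjoint_family S"
      unfolding disjoint_family_on_def
      by (auto simp: S_def level_iff split: nat.splits)
    ultimately have "(\<lambda>n. ip f (E (S n) f)) sums ip f (E UNIV f)"
      using E_sums[of S f f] Sb f by auto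
    moreover have "ip f (E (S n) f) = 0" for n
      using zero E_negative[OF f] by (cases n) (simp_all add: S_def E_self f)
    ultimately have "(\<lambda>n. 0) sums ip f (E UNIV f)" by simp
    then have "ip f (E UNIV f) = 0" using sums_unique2 sums_zero by blast
    then have "l2_norm M f = 0" using E_UNIV[OF f] by (simp add: E_self f)
    then show ?thesis using l2_norm_eq_0_iff[OF f] by simp
  qed
  note total = this
  have "orthonormal_basis M (\<Union>j. B j)"
    unfolding orthonormal_basis_def
  proof (intro conjI ballI impI)
    show "(\<Union>j. B j) \<subseteq> L2 M" using BL by auto
    show "ip e f = (if e = f then 1 else 0)" if "e \<in> (\<Union>j. B j)" "f \<in> (\<Union>j. B j)" for e f
      using orth that unfolding orthonormal_def by blast
    show "AE q in M. f q = 0" if "f \<in> L2 M" "\<forall>e\<in>(\<Union>j. B j). ip e f = 0" for f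
      by (rule total[OF that(1)]) (use that(2) in blast)
  qed
  moreover have "e \<in> ran (level (idx e))" if "e \<in> (\<Union>j. B j)" for e using idx[OF that] B(1) by blast
  ultimately show ?thesis using that orth by blast
qed

end

lemma has_sum_cmod_le:
  fixes f :: "'a \<Rightarrow> complex"
  assumes "(f has_sum w) B" "\<And>F. finite F \<Longrightarrow> F \<subseteq> B \<Longrightarrow> cmod (sum f F) \<le> K"
  shows "cmod w \<le> K"
proof (rule tendsto_upperbound)
  show "((\<lambda>F. cmod (sum f F)) \<longlongrightarrow> cmod w) (finite_subsets_at_top B)"
    using assms(1) unfolding has_sum_def by (rule tendsto_norm)
  show "\<forall>\<^sub>F F in finite_subsets_at_top B. cmod (sum f F) \<le> K"
    using assms(2) by (intro eventually_finite_subsets_at_top_weakI) auto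
qed simp

context nonneg_spectral
begin

text \<open>\<open>t e\<close> is minus the defect operator applied to \<open>e\<close>, compressed
  to \<open>below n\<close>. With \<open>h\<close> the combination of the \<open>t e\<close> and
  \<open>f\<close> that of the \<open>e\<close>, one has
  \<open>ceil_defect n h f = - ip h h\<close>; Cauchy-Schwarz for a form between 0 and 1 bounds the
  norm of \<open>h\<close> by that of \<open>f\<close>.\<close>

lemma Bessel_ceil_defect:
  assumes B: "orthonormal M B" "\<And>e. e \<in> B \<Longrightarrow> e \<in> ran (level (idx e))"
    and F: "finite F" "F \<subseteq> B" "\<And>e. e \<in> F \<Longrightarrow> idx e \<le> n"
  defines "t \<equiv> \<lambda>e q. E (below n) (Nf e) q - of_nat (idx e) * e q"
  shows "(l2_norm M (\<lambda>q. \<Sum>e\<in>F. c e * t e q))\<^sup>2 \<le> (\<Sum>e\<in>F. (cmod (c e))\<^sup>2)"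
proof (cases "F = {}")
  case True
  then show ?thesis by (simp add: l2_norm_def)
next
  case False
  interpret D: psd_form "ran (below n)" "ceil_defect n" by (rule psd_form_ceil_defect)
  have e_ran: "e \<in> ran (below n)" if "e \<in> F" for e
    using B(2) F that by (intro ran_mono[OF level_borel below_borel level_subset[of "idx e"]]) auto
  have eL: "e \<in> L2 M" if "e \<in> F" for e using e_ran[OF that] by (rule ran_L2)
  have NeL: "Nf e \<in> L2 M" if "e \<in> F" for e using N_L2[OF domain_below[OF e_ran[OF that]]] by simp
  have ENe: "E (below n) (Nf e) \<in> ran (below n)" if "e \<in> F" for e
    by (rule E_in_ran[OF below_borel NeL[OF that]])
  have t_ran: "t e \<in> ran (below n)" if "e \<in> F" for e
  proof -
    have "(\<lambda>q. E (below n) (Nf e) q + (- of_nat (idx e)) * e q) \<in> ran (below n)"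
      by (intro ran_add below_borel ENe ran_scale e_ran that)
    then show ?thesis by (simp add: t_def)
  qed
  define f where "f = (\<lambda>q. \<Sum>e\<in>F. c e * e q)"
  define h where "h = (\<lambda>q. \<Sum>e\<in>F. c e * t e q)"
  have h_ran: "h \<in> ran (below n)" unfolding h_def by (intro ran_sum below_borel F False t_ran)
  have f_ran: "f \<in> ran (below n)" unfolding f_def using ran_sum[OF below_borel F(1) False, of "\<lambda>e. e"] e_ran by simp
  have hL: "h \<in> L2 M" and fL: "f \<in> L2 M" using h_ran f_ran by (auto simp: ran_L2)
  have Nh: "N h (Nf h)" by (rule domain_below[OF h_ran])
  have "ceil_defect n h e = - ip h (t e)" if e: "e \<in> F" for e
  proof -
    have ip_level: "ip h (E (level j) e) = (if j = idx e then ip h e else 0)" for j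
      using ran_level_orthogonal[of "idx e" j e h] ran_right[OF level_borel, of e "idx e" h] B(2) F(2) e hL by auto
    have "(\<Sum>j\<le>n. of_nat j * ip h (E (level j) e)) = (\<Sum>j\<le>n. if j = idx e then of_nat (idx e) * ip h e else 0)"
      by (intro sum.cong refl) (simp add: ip_level)
    also have "\<dots> = of_nat (idx e) * ip h e" using F(3)[OF e] by simp
    finally have 1: "(\<Sum>j\<le>n. of_nat j * ip h (E (level j) e)) = of_nat (idx e) * ip h e" .
    have "ip (Nf h) e = ip h (Nf e)" using N_sym[OF Nh domain_below[OF e_ran[OF e]]] by simp
    also have "\<dots> = ip h (E (below n) (Nf e))"
      using E_sym[OF below_borel hL NeL[OF e]] ran_left[OF below_borel h_ran NeL[OF e]] by simp
    finally show ?thesis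
      unfolding ceil_defect_def 1 t_def
      using l2.diff_right[OF hL E_L2[OF below_borel NeL[OF e]] L2_scale[OF eL[OF e]], of n "of_nat (idx e)"]
      by (simp add: l2.scale_right[OF hL eL[OF e]])
  qed
  moreover have "ceil_defect n h f = (\<Sum>e\<in>F. c e * ceil_defect n h e)"
    unfolding f_def using D.sum_right_nonempty[OF F(1) False h_ran, of "\<lambda>e. e" c] e_ran by simp
  moreover have "ip h h = (\<Sum>e\<in>F. c e * ip h (t e))"
    using l2_inner_sum_right[OF hL, of F t c] t_ran ran_L2 unfolding h_def[symmetric] by blast
  ultimately have "ceil_defect n h f = - ip h h" by (simp add: sum_negf)
  then have "(l2_norm M h)\<^sup>2 * (l2_norm M h)\<^sup>2 = (cmod (ceil_defect n h f))\<^sup>2"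
    by (simp add: l2_inner_self norm_mult power2_eq_square)
  also have "\<dots> \<le> Re (ceil_defect n h h) * Re (ceil_defect n f f)"
    by (rule D.Cauchy_Schwarz[OF h_ran f_ran])
  also have "\<dots> \<le> (l2_norm M h)\<^sup>2 * (l2_norm M f)\<^sup>2"
    by (intro mult_mono ceil_defect_le h_ran f_ran D.nonneg) auto
  finally have le: "(l2_norm M h)\<^sup>2 * (l2_norm M h)\<^sup>2 \<le> (l2_norm M h)\<^sup>2 * (l2_norm M f)\<^sup>2" .
  have "(l2_norm M h)\<^sup>2 \<le> (l2_norm M f)\<^sup>2"
  proof (cases "l2_norm M h = 0")
    case False
    then have "(l2_norm M h)\<^sup>2 > 0" by simp
    with le show ?thesis by (rule mult_left_le_imp_le)
  qed simp
  also have "(l2_norm M f)\<^sup>2 = (\<Sum>e\<in>F. (cmod (c e))\<^sup>2)"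
    unfolding f_def by (rule orthonormal_norm_sum[OF B(1) F(1,2)])
  finally show ?thesis by (simp add: h_def)
qed

text \<open>The trace of \<open>\<lceil>N\<rceil>\<rho>\<close> dominates \<open>m\<close> times the weight of \<open>\<rho>\<close> on the vectors of level above \<open>m\<close>, and
  replacing \<open>N\<close> by \<open>\<lceil>N\<rceil>\<close> costs at most the trace of \<open>\<rho>\<close>.\<close>

lemma density_tail_le:
  assumes \<rho>: "density_operator M \<rho>"
    and tr: "\<And>n. has_trace M (\<lambda>f. Nf (E (below n) (\<rho> f))) (of_real (\<tau> n))" and \<tau>: "\<And>n. \<tau> n \<le> \<nu>"
    and B: "orthonormal_basis M B" "orthonormal M B" "\<And>e. e \<in> B \<Longrightarrow> e \<in> ran (level (idx e))"
    and F0: "finite F0" "F0 \<subseteq> B" "\<And>e. e \<in> F0 \<Longrightarrow> idx e > m"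
  shows "real m * (\<Sum>e\<in>F0. Re (ip e (\<rho> e))) \<le> \<nu> + 2"
proof -
  have pos: "positive_operator M \<rho>" using \<rho> by (auto simp: density_operator_def)
  then have b: "bounded_operator M \<rho>" by (simp add: positive_operator_def)
  interpret R: psd_form "L2 M" "\<lambda>f g. ip f (\<rho> g)" by (rule psd_form_positive_operator[OF pos])
  \<comment> \<open>The cutoff is chosen so that all levels occurring in \<open>F0\<close> lie below
    it.\<close>
  define n where "n = Max (insert 0 (idx ` F0))"
  have n: "idx e \<le> n" if "e \<in> F0" for e unfolding n_def using F0(1) that by (intro Max_ge) auto
  have BL: "e \<in> L2 M" if "e \<in> B" for e using B(2) that by (auto simp: orthonormal_def)
  define tm where "tm e = ip e (Nf (E (below n) (\<rho> e)))" for e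
  define t where "t = (\<lambda>e q. E (below n) (Nf e) q - of_nat (idx e) * e q)"
  have p: "E (below n) (\<rho> e) \<in> ran (below n)" if "e \<in> B" for e
    by (rule E_in_ran[OF below_borel bounded_operator_L2[OF b BL[OF that]]])
  \<comment> \<open>Basis vectors above the cutoff contribute exactly nothing, because their level
    is disjoint from \<open>below n\<close>.\<close>
  have term_above: "tm e = 0" if e: "e \<in> B" "idx e > n" for e
  proof -
    have Je: "level (idx e) \<subseteq> {0..real (idx e)}" by (rule level_subset) simp
    have Ne: "N e (Nf e)" by (rule bounded_domain[OF level_borel Je B(3)[OF e(1)]])
    have "ip (Nf e) (E (below n) (\<rho> e)) = 0"
      by (rule N_orthogonal[OF level_borel below_borel level_above[OF e(2)] Je _ B(3)[OF e(1)] p[OF e(1)]])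
         (use e(2) in auto)
    then show ?thesis unfolding tm_def using N_sym[OF Ne domain_below[OF p[OF e(1)]]] by simp
  qed
  have e_ran: "e \<in> ran (below n)" if "e \<in> B" "idx e \<le> n" for e
    using B(3) that by (intro ran_mono[OF level_borel below_borel level_subset[of "idx e"]]) auto
  have NeL: "Nf e \<in> L2 M" if "e \<in> B" "idx e \<le> n" for e using N_L2[OF domain_below[OF e_ran[OF that]]] by simp
  have tL: "t e \<in> L2 M" if "e \<in> B" "idx e \<le> n" for e
    unfolding t_def by (intro l2.V_diff E_L2 below_borel NeL L2_scale BL that)
  have term_below: "tm e = of_nat (idx e) * ip e (\<rho> e) + ip (t e) (\<rho> e)" if e: "e \<in> B" "idx e \<le> n" for e
  proof -
    note \<rho>L = bounded_operator_L2[OF b BL[OF e(1)]]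
    have "tm e = ip (Nf e) (E (below n) (\<rho> e))"
      unfolding tm_def by (rule N_sym[OF domain_below[OF e_ran[OF e]] domain_below[OF p[OF e(1)]]])
    also have "\<dots> = ip (E (below n) (Nf e)) (\<rho> e)" by (rule E_sym[OF below_borel NeL[OF e] \<rho>L])
    finally show ?thesis
      unfolding t_def
      by (simp only: l2.diff_left[OF E_L2[OF below_borel NeL[OF e]] L2_scale[OF BL[OF e(1)]] \<rho>L]
          l2.scale_left[OF BL[OF e(1)] \<rho>L]) simp
  qed
  have "(tm has_sum of_real (\<tau> n)) B"
    using tr[of n] B(1) unfolding has_trace_def tm_def by auto
  \<comment> \<open>The trace is only a limit of finite sums, and an error of 1 is accepted. This is
    one of the two units in \<open>\<nu> + 2\<close>; the other bounds the contribution of the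
    vectors \<open>t e\<close>.\<close>
  then obtain F1 where F1: "finite F1" "F1 \<subseteq> B" and F1': "\<And>F. finite F \<Longrightarrow> F1 \<subseteq> F \<Longrightarrow> F \<subseteq> B \<Longrightarrow> dist (sum tm F) (of_real (\<tau> n)) < 1"
    using tendstoD[of "sum tm" _ "finite_subsets_at_top B" 1]
    unfolding has_sum_def eventually_finite_subsets_at_top by (metis zero_less_one)
  define F2 where "F2 = F0 \<union> F1"
  define F where "F = {e\<in>F2. idx e \<le> n}"
  have F2: "finite F2" "F2 \<subseteq> B" using F0 F1 by (auto simp: F2_def)
  have F: "finite F" "F \<subseteq> B" "\<And>e. e \<in> F \<Longrightarrow> idx e \<le> n" "F0 \<subseteq> F" using F2 n by (auto simp: F_def F2_def)
  have FL: "\<And>e. e \<in> F \<Longrightarrow> e \<in> L2 M" using F(2) BL by auto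
  have "sum tm F2 = sum tm F"
  proof (rule sum.mono_neutral_right)
    show "\<forall>e\<in>F2 - F. tm e = 0"
    proof
      fix e assume "e \<in> F2 - F"
      then have "e \<in> B" "idx e > n" using F2(2) by (auto simp: F_def)
      then show "tm e = 0" by (rule term_above)
    qed
  qed (use F2 in \<open>auto simp: F_def\<close>)
  then have "dist (sum tm F) (of_real (\<tau> n)) < 1"
    using F1'[of F2] F2 by (simp add: F2_def)
  then have "Re (sum tm F) \<le> \<tau> n + 1"
    using abs_Re_le_cmod[of "sum tm F - of_real (\<tau> n)"] by (simp add: dist_norm)
  moreover have "sum tm F = (\<Sum>e\<in>F. of_nat (idx e) * ip e (\<rho> e)) + (\<Sum>e\<in>F. ip (t e) (\<rho> e))"
    unfolding sum.distrib[symmetric] using F by (intro sum.cong refl term_below) auto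
  moreover have "Re (\<Sum>e\<in>F. of_nat (idx e) * ip e (\<rho> e)) = (\<Sum>e\<in>F. real (idx e) * Re (ip e (\<rho> e)))"
    by simp
  moreover have "- Re (\<Sum>e\<in>F. ip (t e) (\<rho> e)) \<le> 1"
  proof -
    have "orthonormal M F" using B(2) F(2) unfolding orthonormal_def by blast
    then have R1: "(\<Sum>e\<in>F. Re (ip e (\<rho> e))) \<le> 1" by (rule density_operator_trace_le[OF \<rho> F(1)])
    have R2: "(\<Sum>e\<in>F. Re (ip (t e) (\<rho> (t e)))) \<le> 1\<^sup>2"
    proof (rule density_operator_Bessel[OF \<rho> F(1)])
      show "t e \<in> L2 M" if "e \<in> F" for e using tL F that by auto
      show "(l2_norm M (\<lambda>q. \<Sum>e\<in>F. c e * t e q))\<^sup>2 \<le> 1\<^sup>2 * (\<Sum>e\<in>F. (cmod (c e))\<^sup>2)" for c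
        using Bessel_ceil_defect[OF B(2,3) F(1,2,3), of c] by (simp add: t_def)
    qed
    have "- Re (\<Sum>e\<in>F. ip (t e) (\<rho> e)) \<le> cmod (\<Sum>e\<in>F. ip (t e) (\<rho> e))"
      using abs_Re_le_cmod[of "\<Sum>e\<in>F. ip (t e) (\<rho> e)"] by linarith
    also have "\<dots> \<le> (\<Sum>e\<in>F. cmod (ip (t e) (\<rho> e)))" by (rule norm_sum)
    also have "\<dots> \<le> sqrt (1\<^sup>2 * 1)"
      using tL F by (intro R.cmod_sum_le R1 R2) (auto simp: FL)
    finally show ?thesis by simp
  qed
  ultimately have "(\<Sum>e\<in>F. real (idx e) * Re (ip e (\<rho> e))) \<le> \<nu> + 2" using \<tau>[of n] by simp
  moreover have "real m * (\<Sum>e\<in>F0. Re (ip e (\<rho> e))) \<le> (\<Sum>e\<in>F0. real (idx e) * Re (ip e (\<rho> e)))"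
    unfolding sum_distrib_left
  proof (rule sum_mono)
    fix e assume e: "e \<in> F0"
    show "real m * Re (ip e (\<rho> e)) \<le> real (idx e) * Re (ip e (\<rho> e))"
      using F0(3)[OF e] R.nonneg[of e] FL F(4) e by (intro mult_right_mono) auto
  qed
  moreover have "(\<Sum>e\<in>F0. real (idx e) * Re (ip e (\<rho> e))) \<le> (\<Sum>e\<in>F. real (idx e) * Re (ip e (\<rho> e)))"
    using F FL R.nonneg by (intro sum_mono2) auto
  ultimately show ?thesis by linarith
qed

text \<open>\<open>w - 1\<close> is the trace of \<open>\<rho> (U - 1)\<close>; the adapted basis is
  split at level \<open>m\<close>. Below, \<open>U - 1\<close> has norm at most
  \<open>\<epsilon>\<close>; above, it has norm at most 2 and \<rho> has weight at most
  \<open>(\<nu> + 2) / m\<close>, of which Cauchy-Schwarz takes the square root.\<close>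

theorem trace_isometry_minus_one_le:
  assumes \<rho>: "density_operator M \<rho>"
    and tr: "\<And>n. has_trace M (\<lambda>f. Nf (E (below n) (\<rho> f))) (of_real (\<tau> n))" and \<tau>: "\<And>n. \<tau> n \<le> \<nu>"
    and U: "\<And>f. f \<in> L2 M \<Longrightarrow> U f \<in> L2 M" "\<And>f. f \<in> L2 M \<Longrightarrow> l2_norm M (U f) = l2_norm M f"
    and U_sum: "\<And>F c. U (\<lambda>q. \<Sum>e\<in>F. c e * e q) = (\<lambda>q. \<Sum>e\<in>F. c e * U e q)"
    and m: "m > 0" and \<epsilon>: "\<epsilon> \<ge> 0" and small: "\<And>f. f \<in> ran (below m) \<Longrightarrow> l2_norm M (\<lambda>q. U f q - f q) \<le> \<epsilon> * l2_norm M f"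
    and w: "has_trace M (\<lambda>f. \<rho> (U f)) w"
  shows "cmod (w - 1) \<le> \<epsilon> + 2 * sqrt ((\<nu> + 2) / real m)"
proof -
  obtain B idx where B: "orthonormal_basis M B" "orthonormal M B" "\<And>e. e \<in> B \<Longrightarrow> e \<in> ran (level (idx e))"
    using adapted_basis by blast
  have pos: "positive_operator M \<rho>" and tr1: "has_trace M \<rho> 1" using \<rho> by (auto simp: density_operator_def)
  then have b: "bounded_operator M \<rho>" by (simp add: positive_operator_def)
  interpret R: psd_form "L2 M" "\<lambda>f g. ip f (\<rho> g)" by (rule psd_form_positive_operator[OF pos])
  have BL: "e \<in> L2 M" if "e \<in> B" for e using B(2) that by (auto simp: orthonormal_def)
  define D where "D e = (\<lambda>q. U e q - e q)" for e
  have DL: "D e \<in> L2 M" if "e \<in> B" for e unfolding D_def by (intro l2.V_diff U BL that)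
  have "((\<lambda>e. ip e (\<rho> (U e)) - ip e (\<rho> e)) has_sum (w - 1)) B"
    using has_sum_add[of "\<lambda>e. ip e (\<rho> (U e))" B w "\<lambda>e. - ip e (\<rho> e)" "- 1"] w tr1 B(1)
    unfolding has_trace_def by (auto simp: has_sum_uminus)
  moreover have "ip e (\<rho> (U e)) - ip e (\<rho> e) = ip e (\<rho> (D e))" if "e \<in> B" for e
    unfolding D_def using R.diff_right[OF BL U(1) BL, of e e e] that BL by simp
  ultimately have hs: "((\<lambda>e. ip e (\<rho> (D e))) has_sum (w - 1)) B"
    by (subst has_sum_cong[of B _ "\<lambda>e. ip e (\<rho> (U e)) - ip e (\<rho> e)"]) auto
  have D_sum: "(\<lambda>q. \<Sum>e\<in>F. c e * D e q) = (\<lambda>q. U (\<lambda>q. \<Sum>e\<in>F. c e * e q) q - (\<Sum>e\<in>F. c e * e q))" for F c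
    by (simp add: D_def U_sum right_diff_distrib sum_subtractf)
  have trace1: "(\<Sum>e\<in>F. Re (ip e (\<rho> e))) \<le> 1" if F: "finite F" "F \<subseteq> B" for F
  proof (rule density_operator_trace_le[OF \<rho> F(1)])
    show "orthonormal M F" using B(2) F(2) unfolding orthonormal_def by blast
  qed
  show ?thesis
  proof (rule has_sum_cmod_le[OF hs])
    fix F assume F: "finite F" "F \<subseteq> B"
    define F1 F2 where "F1 = {e\<in>F. idx e \<le> m}" and "F2 = {e\<in>F. idx e > m}"
    have F1: "finite F1" "F1 \<subseteq> B" and F2: "finite F2" "F2 \<subseteq> B" using F by (auto simp: F1_def F2_def)
    have sumL: "(\<lambda>q. \<Sum>e\<in>G. c e * e q) \<in> L2 M" if "G \<subseteq> B" for G c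
      using L2_sum[of G "\<lambda>e. e"] BL that by auto
    have norm_comb: "(l2_norm M (\<lambda>q. \<Sum>e\<in>G. c e * e q))\<^sup>2 = (\<Sum>e\<in>G. (cmod (c e))\<^sup>2)" if "finite G" "G \<subseteq> B" for G c
      by (rule orthonormal_norm_sum[OF B(2) that])
    have "(\<Sum>e\<in>F1. Re (ip (D e) (\<rho> (D e)))) \<le> \<epsilon>\<^sup>2"
    proof (rule density_operator_Bessel[OF \<rho> F1(1)])
      show "D e \<in> L2 M" if "e \<in> F1" for e using DL F1 that by auto
      fix c
      let ?f = "\<lambda>q. \<Sum>e\<in>F1. c e * e q"
      have "l2_norm M (\<lambda>q. \<Sum>e\<in>F1. c e * D e q) \<le> \<epsilon> * l2_norm M ?f"
      proof (cases "F1 = {}")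
        case True
        then show ?thesis by (simp add: l2_norm_def)
      next
        case False
        have "e \<in> ran (below m)" if "e \<in> F1" for e
          using B(3) that F1 by (intro ran_mono[OF level_borel below_borel level_subset[of "idx e"]]) (auto simp: F1_def)
        then have "?f \<in> ran (below m)" using ran_sum[OF below_borel F1(1) False, of "\<lambda>e. e"] by simp
        then show ?thesis unfolding D_sum by (rule small)
      qed
      then have "(l2_norm M (\<lambda>q. \<Sum>e\<in>F1. c e * D e q))\<^sup>2 \<le> (\<epsilon> * l2_norm M ?f)\<^sup>2" by (intro power_mono) auto
      then show "(l2_norm M (\<lambda>q. \<Sum>e\<in>F1. c e * D e q))\<^sup>2 \<le> \<epsilon>\<^sup>2 * (\<Sum>e\<in>F1. (cmod (c e))\<^sup>2)"
        by (simp only: power_mult_distrib norm_comb[OF F1])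
    qed
    then have S1: "(\<Sum>e\<in>F1. cmod (ip e (\<rho> (D e)))) \<le> sqrt (1 * \<epsilon>\<^sup>2)"
      using DL BL F1 by (intro R.cmod_sum_le trace1) auto
    have "(\<Sum>e\<in>F2. Re (ip (D e) (\<rho> (D e)))) \<le> 2\<^sup>2"
    proof (rule density_operator_Bessel[OF \<rho> F2(1)])
      show "D e \<in> L2 M" if "e \<in> F2" for e using DL F2 that by auto
      fix c
      let ?f = "\<lambda>q. \<Sum>e\<in>F2. c e * e q"
      have "l2_norm M (\<lambda>q. \<Sum>e\<in>F2. c e * D e q) \<le> 2 * l2_norm M ?f"
        unfolding D_sum using l2_norm_diff_triangle[OF U(1) , of ?f ?f] U(2)[of ?f] sumL[OF F2(2)] by simp
      then have "(l2_norm M (\<lambda>q. \<Sum>e\<in>F2. c e * D e q))\<^sup>2 \<le> (2 * l2_norm M ?f)\<^sup>2" by (intro power_mono) auto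
      then show "(l2_norm M (\<lambda>q. \<Sum>e\<in>F2. c e * D e q))\<^sup>2 \<le> 2\<^sup>2 * (\<Sum>e\<in>F2. (cmod (c e))\<^sup>2)"
        by (simp only: power_mult_distrib norm_comb[OF F2])
    qed
    moreover have "(\<Sum>e\<in>F2. Re (ip e (\<rho> e))) \<le> (\<nu> + 2) / real m"
      using density_tail_le[OF \<rho> tr \<tau> B F2, of m] m by (simp add: F2_def field_simps)
    ultimately have S2: "(\<Sum>e\<in>F2. cmod (ip e (\<rho> (D e)))) \<le> sqrt ((\<nu> + 2) / real m * 2\<^sup>2)"
      using DL BL F2 by (intro R.cmod_sum_le) auto
    have "F = F1 \<union> F2" "F1 \<inter> F2 = {}" by (auto simp: F1_def F2_def)
    then have "cmod (\<Sum>e\<in>F. ip e (\<rho> (D e))) \<le> (\<Sum>e\<in>F1. cmod (ip e (\<rho> (D e)))) + (\<Sum>e\<in>F2. cmod (ip e (\<rho> (D e))))"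
      using F1(1) F2(1) norm_sum[of "\<lambda>e. ip e (\<rho> (D e))" F] by (simp only: sum.union_disjoint)
    also have "\<dots> \<le> sqrt (1 * \<epsilon>\<^sup>2) + sqrt ((\<nu> + 2) / real m * 2\<^sup>2)" by (rule add_mono[OF S1 S2])
    also have "\<dots> = \<epsilon> + 2 * sqrt ((\<nu> + 2) / real m)" using \<epsilon> unfolding real_sqrt_mult by simp
    finally show "cmod (\<Sum>e\<in>F. ip e (\<rho> (D e))) \<le> \<epsilon> + 2 * sqrt ((\<nu> + 2) / real m)" .
  qed
qed

end

section \<open>One lattice site\<close>

lemma l2_norm_mono:
  assumes "f \<in> L2 M" "g \<in> L2 M" "AE q in M. cmod (f q) \<le> cmod (g q)"
  shows "l2_norm M f \<le> l2_norm M g"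
  unfolding l2_norm_def
proof (intro real_sqrt_le_mono integral_mono_AE L2_integrable assms)
  show "AE q in M. (cmod (f q))\<^sup>2 \<le> (cmod (g q))\<^sup>2"
    using assms(3) by eventually_elim (intro power_mono, auto)
qed

lemma cmod_exp_i_minus_one_le: "cmod (exp (\<i> * of_real t) - 1) \<le> \<bar>t\<bar>"
  using dist_exp_i_1[of t] abs_sin_x_le_abs_x[of "t / 2"] by simp

locale site =
  fixes x :: "'d::finite lattice"
begin

abbreviation M where "M \<equiv> config {x}"

definition shift :: "real \<Rightarrow> ('d lattice \<Rightarrow> real) \<Rightarrow> ('d lattice \<Rightarrow> real)" where
  "shift t q = q(x := q x + t)"

definition pullback :: "real \<Rightarrow> (('d lattice \<Rightarrow> real) \<Rightarrow> complex) \<Rightarrow> ('d lattice \<Rightarrow> real) \<Rightarrow> complex" where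
  "pullback t f = (\<lambda>q. f (shift t q))"

lemma shift_0 [simp]: "shift 0 q = q"
  by (simp add: shift_def)

lemma shift_sh [simp]: "shift s (shift t q) = shift (t + s) q"
  by (simp add: shift_def add.assoc)

lemma shift_apply [simp]: "shift t q x = q x + t"
  by (simp add: shift_def)

lemma pullback_tr: "pullback s (pullback t f) = pullback (t + s) f"
  by (simp add: pullback_def add.commute)

text \<open>Points of the configuration space are \<open>undefined\<close> off \<open>x\<close>, so
  there the restricted translation of \<open>schroedinger_W\<close> agrees with the function update
  of \<open>momentum\<close>; outside the space the two may differ.\<close>

lemma shift_restrict: "q \<in> space M \<Longrightarrow> (\<lambda>y\<in>{x}. q y + c y) = shift (c x) q"
  by (auto simp: config_def space_PiM PiE_def extensional_def shift_def fun_eq_iff)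

lemma coordinate_measurable [measurable]: "(\<lambda>q. q x) \<in> borel_measurable M"
  unfolding config_def using measurable_component_singleton[of x "{x}" "\<lambda>_. lborel :: real measure"] by simp

lemma shift_measurable [measurable]: "shift t \<in> measurable M M"
proof -
  have "(\<lambda>q. \<lambda>y\<in>{x}. q y + t) \<in> measurable M M"
    unfolding config_def by (intro measurable_restrict) (auto simp: config_def[symmetric])
  then show ?thesis
    by (subst measurable_cong[of M _ "\<lambda>q. \<lambda>y\<in>{x}. q y + t"]) (simp_all add: shift_restrict[where c = "\<lambda>_. t"])
qed

lemma distr_shift: "distr M M (shift t) = M"
proof -
  interpret product_sigma_finite "\<lambda>_::'d lattice. lborel :: real measure" by standard
  have "distr M M (shift t) = PiM {x} (\<lambda>_. lborel)"
  proof (rule PiM_eqI)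
    show "sets (distr M M (shift t)) = sets (PiM {x} (\<lambda>_. lborel))" by (simp add: config_def)
    fix A :: "'d lattice \<Rightarrow> real set" assume A: "\<And>i. i \<in> {x} \<Longrightarrow> A i \<in> sets lborel"
    have Ax: "A x \<in> sets borel" using A by simp
    have pre: "shift t -` Pi\<^sub>E {x} A \<inter> space M = Pi\<^sub>E {x} (\<lambda>_. (+) t -` A x)"
      by (auto simp: config_def space_PiM PiE_def Pi_def extensional_def shift_def add.commute split: if_splits)
    have meas: "(+) t -` A x \<in> sets borel" using measurable_sets[of "(+) t" borel borel "A x"] Ax by simp
    have "emeasure (distr M M (shift t)) (Pi\<^sub>E {x} A) = emeasure M (shift t -` Pi\<^sub>E {x} A \<inter> space M)"
      using A by (intro emeasure_distr shift_measurable) (auto simp: config_def intro!: sets_PiM_I_finite)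
    also have "\<dots> = emeasure lborel ((+) t -` A x)"
      unfolding pre unfolding config_def using meas by (subst emeasure_PiM) auto
    also have "\<dots> = emeasure (distr lborel borel ((+) t)) (A x)"
      using Ax by (simp add: emeasure_distr)
    also have "\<dots> = emeasure lborel (A x)" by (simp add: lborel_distr_plus)
    finally show "emeasure (distr M M (shift t)) (Pi\<^sub>E {x} A) = (\<Prod>i\<in>{x}. emeasure lborel (A i))" by simp
  qed simp
  then show ?thesis by (simp add: config_def)
qed

lemma AE_shift: "AE q in M. P q \<Longrightarrow> AE q in M. P (shift t q)"
  by (rule AE_distrD[OF shift_measurable]) (subst distr_shift)

lemma pullback_L2:
  assumes "f \<in> L2 M"
  shows "pullback t f \<in> L2 M"
proof (rule L2_I)
  show "pullback t f \<in> borel_measurable M"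
    unfolding pullback_def by (rule measurable_compose[OF shift_measurable L2_measurable[OF assms]])
  have "integrable (distr M M (shift t)) (\<lambda>q. (cmod (f q))\<^sup>2)" using L2_integrable[OF assms] by (simp add: distr_shift)
  then show "integrable M (\<lambda>q. (cmod (pullback t f q))\<^sup>2)"
    unfolding pullback_def by (rule integrable_distr[OF shift_measurable])
qed

lemma pullback_inner:
  assumes "f \<in> L2 M" "g \<in> L2 M"
  shows "l2_inner M (pullback t f) (pullback t g) = l2_inner M f g"
proof -
  have "(LINT q|distr M M (shift t). cnj (f q) * g q) = (LINT q|M. cnj (f (shift t q)) * g (shift t q))"
    by (rule integral_distr[OF shift_measurable borel_measurable_integrable[OF L2_inner_integrable[OF assms]]])
  then show ?thesis by (simp add: distr_shift l2_inner_def pullback_def)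
qed

lemma pullback_norm: "f \<in> L2 M \<Longrightarrow> l2_norm M (pullback t f) = l2_norm M f"
  using pullback_inner[of f f t] l2_Re_self[of M "pullback t f"] l2_Re_self[of M f] by simp

definition diff_quot :: "(('d lattice \<Rightarrow> real) \<Rightarrow> complex) \<Rightarrow> real \<Rightarrow> ('d lattice \<Rightarrow> real) \<Rightarrow> complex" where
  "diff_quot f t = (\<lambda>q. of_real (1 / t) * (pullback t f q - f q))"

lemma diff_quot_L2: "f \<in> L2 M \<Longrightarrow> diff_quot f t \<in> L2 M"
  unfolding diff_quot_def by (intro L2_scale l2.V_diff pullback_L2)

lemma momentum_diff_quot:
  assumes "momentum {x} x f h"
  shows "((\<lambda>t. l2_norm M (\<lambda>q. diff_quot f t q - \<i> * h q)) \<longlongrightarrow> 0) (at 0)"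
  using assms unfolding momentum_def diff_quot_def pullback_def shift_def by (simp add: field_simps)

lemma inner_diff_quot_tendsto:
  assumes p: "momentum {x} x f h" and u: "u \<in> L2 M"
  shows "((\<lambda>t. l2_inner M u (diff_quot f t)) \<longlongrightarrow> l2_inner M u (\<lambda>q. \<i> * h q)) (at 0)"
proof -
  have f: "f \<in> L2 M" and h: "h \<in> L2 M" using p by (auto simp: momentum_def)
  have ih: "(\<lambda>q. \<i> * h q) \<in> L2 M" by (rule L2_scale[OF h])
  have "((\<lambda>t. l2_inner M u (diff_quot f t) - l2_inner M u (\<lambda>q. \<i> * h q)) \<longlongrightarrow> 0) (at 0)"
  proof (rule Lim_null_comparison)
    show "\<forall>\<^sub>F t in at 0. norm (l2_inner M u (diff_quot f t) - l2_inner M u (\<lambda>q. \<i> * h q))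
        \<le> l2_norm M u * l2_norm M (\<lambda>q. diff_quot f t q - \<i> * h q)"
      using l2_Cauchy_Schwarz[OF u l2.V_diff[OF diff_quot_L2[OF f] ih]]
      by (simp add: l2.diff_right[OF u diff_quot_L2[OF f] ih])
    show "((\<lambda>t. l2_norm M u * l2_norm M (\<lambda>q. diff_quot f t q - \<i> * h q)) \<longlongrightarrow> 0) (at 0)"
      using tendsto_mult_left[OF momentum_diff_quot[OF p], of "l2_norm M u"] by simp
  qed
  then show ?thesis by (rule LIM_zero_cancel)
qed

text \<open>The commutation relation \<open>q \<partial> - \<partial> q = - 1\<close> in weak form, from the substitution \<open>q \<mapsto> q - t\<close>
  in the difference quotients.\<close>

lemma weak_CCR:
  assumes g: "position {x} x f g" and p: "momentum {x} x f h"
  shows "2 * Re (l2_inner M g (\<lambda>q. \<i> * h q)) = - (l2_norm M f)\<^sup>2"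
proof -
  have fL: "f \<in> L2 M" and gL: "g \<in> L2 M" and hL: "h \<in> L2 M" and gq: "AE q in M. g q = of_real (q x) * f q"
    using g p by (auto simp: position_def momentum_def)
  define f' where "f' = (\<lambda>q. \<i> * h q)"
  have f'L: "f' \<in> L2 M" unfolding f'_def by (rule L2_scale[OF hL])
  have gf: "l2_inner M g f = l2_inner M f g"
  proof -
    have "l2_inner M g f = (LINT q|M. cnj (f q) * g q)"
      unfolding l2_inner_def
    proof (rule integral_cong_AE)
      show "AE q in M. cnj (g q) * f q = cnj (f q) * g q" using gq by eventually_elim simp
    qed (use fL gL in measurable)
    then show ?thesis by (simp add: l2_inner_def)
  qed
  \<comment> \<open>Both arguments are translated by \<open>-t\<close>, which turns \<open>g\<close>
    into \<open>q x - t\<close> times the translate of \<open>f\<close>; the real factor then moves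
    to the other side. The term with \<open>t\<close> is the commutator.\<close>
  have pullback_swap: "l2_inner M g (pullback t f) = l2_inner M (pullback (-t) f) g - of_real t * l2_inner M (pullback (-t) f) f" for t
  proof -
    have "l2_inner M g (pullback t f) = l2_inner M (pullback (-t) g) (pullback (-t) (pullback t f))"
      by (simp add: pullback_inner pullback_L2 fL gL)
    also have "pullback (-t) (pullback t f) = f" by (simp add: pullback_tr) (simp add: pullback_def)
    also have "l2_inner M (pullback (-t) g) f = l2_inner M (pullback (-t) f) (\<lambda>q. g q - of_real t * f q)"
      unfolding l2_inner_def
    proof (rule integral_cong_AE)
      show "AE q in M. cnj (pullback (-t) g q) * f q = cnj (pullback (-t) f q) * (g q - of_real t * f q)"
        using gq AE_shift[OF gq, of "-t"]
      proof eventually_elim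
        case (elim q)
        show ?case unfolding pullback_def elim by (simp add: algebra_simps)
      qed
    qed (use pullback_L2[OF fL] pullback_L2[OF gL] fL gL in measurable)
    also have "\<dots> = l2_inner M (pullback (-t) f) g - of_real t * l2_inner M (pullback (-t) f) f"
      by (simp only: l2.diff_right[OF pullback_L2[OF fL] gL L2_scale[OF fL]] l2.scale_right[OF pullback_L2[OF fL] fL])
    finally show ?thesis .
  qed
  have quot_inner: "l2_inner M u (diff_quot f t) = of_real (1 / t) * (l2_inner M u (pullback t f) - l2_inner M u f)" if "u \<in> L2 M" for u t
    unfolding diff_quot_def using that
    by (simp only: l2.scale_right[OF that l2.V_diff[OF pullback_L2[OF fL] fL]] l2.diff_right[OF that pullback_L2[OF fL] fL])
  have trf: "l2_inner M u (pullback t f) = l2_inner M u f + of_real t * l2_inner M u (diff_quot f t)" if "u \<in> L2 M" "t \<noteq> 0" for u t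
    using quot_inner[OF that(1), of t] that(2) by simp
  have eq: "l2_inner M g (diff_quot f t) = - cnj (l2_inner M g (diff_quot f (-t))) - cnj (l2_inner M f f) + of_real t * cnj (l2_inner M f (diff_quot f (-t)))"
    if t: "t \<noteq> 0" for t
  proof -
    have s1: "l2_inner M (pullback (-t) f) g = cnj (l2_inner M g (pullback (-t) f))" by (rule l2.swap[OF gL pullback_L2[OF fL]])
    have s2: "l2_inner M (pullback (-t) f) f = cnj (l2_inner M f (pullback (-t) f))" by (rule l2.swap[OF fL pullback_L2[OF fL]])
    have s3: "cnj (l2_inner M g f) = l2_inner M g f" using gf l2.swap[OF gL fL] by simp
    have t': "- t \<noteq> 0" using t by simp
    have "l2_inner M g (diff_quot f t) = of_real (1 / t) * (cnj (l2_inner M g (pullback (-t) f)) - of_real t * cnj (l2_inner M f (pullback (-t) f)) - l2_inner M g f)"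
      by (simp only: quot_inner[OF gL] pullback_swap s1 s2)
    also have "\<dots> = of_real (1 / t) * (of_real t * (- cnj (l2_inner M g (diff_quot f (-t))) - cnj (l2_inner M f f)
        + of_real t * cnj (l2_inner M f (diff_quot f (-t)))))"
      unfolding trf[OF gL t'] trf[OF fL t'] using s3 by (simp add: algebra_simps)
    finally show ?thesis using t by simp
  qed
  have lim0: "((\<lambda>t. l2_inner M u (diff_quot f t)) \<longlongrightarrow> l2_inner M u f') (at 0)" if "u \<in> L2 M" for u
    unfolding f'_def by (rule inner_diff_quot_tendsto[OF p that])
  have lim0': "((\<lambda>t. l2_inner M u (diff_quot f (-t))) \<longlongrightarrow> l2_inner M u f') (at 0)" if "u \<in> L2 M" for u
  proof (rule filterlim_compose[OF lim0[OF that]])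
    have "(uminus \<longlongrightarrow> (- 0 :: real)) (at 0)" by (intro tendsto_intros)
    then show "filterlim uminus (at 0) (at (0::real))"
      by (simp add: filterlim_at eventually_at_filter)
  qed
  have "((\<lambda>t. - cnj (l2_inner M g (diff_quot f (-t))) - cnj (l2_inner M f f) + of_real t * cnj (l2_inner M f (diff_quot f (-t))))
      \<longlongrightarrow> - cnj (l2_inner M g f') - cnj (l2_inner M f f) + of_real 0 * cnj (l2_inner M f f')) (at 0)"
    by (intro tendsto_intros lim0' gL fL)
  moreover have "\<forall>\<^sub>F t in at 0. - cnj (l2_inner M g (diff_quot f (-t))) - cnj (l2_inner M f f) + of_real t * cnj (l2_inner M f (diff_quot f (-t))) = l2_inner M g (diff_quot f t)"
    unfolding eventually_at_filter by (intro always_eventually allI impI) (rule eq[symmetric])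
  ultimately have "((\<lambda>t. l2_inner M g (diff_quot f t)) \<longlongrightarrow> - cnj (l2_inner M g f') - cnj (l2_inner M f f) + of_real 0 * cnj (l2_inner M f f')) (at 0)"
    by (rule Lim_transform_eventually)
  then have "l2_inner M g f' = - cnj (l2_inner M g f') - cnj (l2_inner M f f) + of_real 0 * cnj (l2_inner M f f')"
    by (rule tendsto_unique[OF trivial_limit_at lim0[OF gL]])
  from arg_cong[OF this, of Re] have "Re (l2_inner M g f') = - Re (l2_inner M g f') - Re (l2_inner M f f)"
    by simp
  then show ?thesis unfolding f'_def by simp
qed

text \<open>A translation by \<open>u\<close> consists of \<open>n\<close> translations by
  \<open>u / n\<close>, each of which moves \<open>f\<close> by about |u| / n times the norm of
  \<open>h\<close>; the error of the difference quotient vanishes as \<open>n\<close> grows.\<close>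

lemma pullback_norm_diff_le:
  assumes p: "momentum {x} x f h"
  shows "l2_norm M (\<lambda>q. pullback u f q - f q) \<le> \<bar>u\<bar> * l2_norm M h"
proof -
  have fL: "f \<in> L2 M" and hL: "h \<in> L2 M" using p by (auto simp: momentum_def)
  have ihL: "(\<lambda>q. \<i> * h q) \<in> L2 M" by (rule L2_scale[OF hL])
  have dL: "(\<lambda>q. pullback t f q - f q) \<in> L2 M" for t by (intro l2.V_diff pullback_L2 fL)
  have tele: "l2_norm M (\<lambda>q. pullback (real n * s) f q - f q) \<le> real n * l2_norm M (\<lambda>q. pullback s f q - f q)" for n s
  proof (induction n)
    case 0
    then show ?case by (simp add: pullback_def l2_norm_def)
  next
    case (Suc n)
    let ?a = "pullback s (\<lambda>q. pullback (real n * s) f q - f q)" and ?b = "\<lambda>q. pullback s f q - f q"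
    have "(\<lambda>q. pullback (real (Suc n) * s) f q - f q) = (\<lambda>q. ?a q + ?b q)"
      by (simp add: pullback_def algebra_simps)
    then have "l2_norm M (\<lambda>q. pullback (real (Suc n) * s) f q - f q) \<le> l2_norm M ?a + l2_norm M ?b"
      using l2_norm_triangle[OF pullback_L2[OF dL] dL] by simp
    also have "l2_norm M ?a = l2_norm M (\<lambda>q. pullback (real n * s) f q - f q)" by (rule pullback_norm[OF dL])
    finally show ?case using Suc by (simp add: algebra_simps)
  qed
  show ?thesis
  proof (cases "u = 0")
    case True
    then show ?thesis by (simp add: pullback_def l2_norm_def)
  next
    case False
    define s where "s n = u / real (Suc n)" for n
    have s0: "s n \<noteq> 0" for n using False by (simp add: s_def)
    have "s \<longlonglongrightarrow> 0"
      unfolding s_def using LIMSEQ_Suc[OF lim_const_over_n[of u]] by simp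
    then have "filterlim s (at 0) sequentially"
      using s0 by (simp add: filterlim_at)
    then have "(\<lambda>n. l2_norm M (\<lambda>q. diff_quot f (s n) q - \<i> * h q)) \<longlonglongrightarrow> 0"
      by (rule filterlim_compose[OF momentum_diff_quot[OF p]])
    then have lim: "(\<lambda>n. \<bar>u\<bar> * (l2_norm M (\<lambda>q. diff_quot f (s n) q - \<i> * h q) + l2_norm M h)) \<longlonglongrightarrow> \<bar>u\<bar> * (0 + l2_norm M h)"
      by (intro tendsto_intros)
    have "l2_norm M (\<lambda>q. pullback u f q - f q) \<le> \<bar>u\<bar> * (l2_norm M (\<lambda>q. diff_quot f (s n) q - \<i> * h q) + l2_norm M h)" for n
    proof -
      have "l2_norm M (\<lambda>q. pullback u f q - f q) \<le> real (Suc n) * l2_norm M (\<lambda>q. pullback (s n) f q - f q)"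
        using tele[of "Suc n" "s n"] by (simp add: s_def del: of_nat_Suc)
      also have "(\<lambda>q. pullback (s n) f q - f q) = (\<lambda>q. of_real (s n) * diff_quot f (s n) q)"
        using s0[of n] by (simp add: diff_quot_def)
      also have "real (Suc n) * l2_norm M (\<lambda>q. of_real (s n) * diff_quot f (s n) q) = \<bar>u\<bar> * l2_norm M (diff_quot f (s n))"
        unfolding l2_norm_scale[OF diff_quot_L2[OF fL]] norm_of_real by (simp add: s_def abs_divide del: of_nat_Suc)
      also have "\<dots> \<le> \<bar>u\<bar> * (l2_norm M (\<lambda>q. diff_quot f (s n) q - \<i> * h q) + l2_norm M h)"
      proof (rule mult_left_mono)
        have "l2_norm M (\<lambda>q. (diff_quot f (s n) q - \<i> * h q) + \<i> * h q) \<le> l2_norm M (\<lambda>q. diff_quot f (s n) q - \<i> * h q) + l2_norm M (\<lambda>q. \<i> * h q)"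
          by (rule l2_norm_triangle[OF l2.V_diff[OF diff_quot_L2[OF fL] ihL] ihL])
        then show "l2_norm M (diff_quot f (s n)) \<le> l2_norm M (\<lambda>q. diff_quot f (s n) q - \<i> * h q) + l2_norm M h"
          using l2_norm_scale[OF hL, of \<i>] by simp
      qed simp
      finally show ?thesis .
    qed
    then show ?thesis using LIMSEQ_le_const[OF lim] by simp
  qed
qed

text \<open>The identity \<open>q^2 + p^2 = 2 N + 1\<close> for quadratic forms: expand the norm of
  \<open>g + \<i> h\<close> and evaluate the cross term by \<open>weak_CCR\<close>.\<close>

lemma annihilation_norm:
  assumes "annihilation {x} x f k"
  obtains g h where "position {x} x f g" "momentum {x} x f h"
    "(l2_norm M g)\<^sup>2 + (l2_norm M h)\<^sup>2 = 2 * (l2_norm M k)\<^sup>2 + (l2_norm M f)\<^sup>2"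
proof -
  obtain g h where g: "position {x} x f g" and h: "momentum {x} x f h" and kL: "k \<in> L2 M"
    and k: "AE q in M. k q = (g q + \<i> * h q) / of_real (sqrt 2)"
    using assms by (auto simp: annihilation_def)
  have gL: "g \<in> L2 M" and hL: "h \<in> L2 M" using g h by (auto simp: position_def momentum_def)
  let ?h = "\<lambda>q. \<i> * h q"
  have ihL: "?h \<in> L2 M" by (rule L2_scale[OF hL])
  have "l2_norm M (\<lambda>q. of_real (sqrt 2) * k q) = l2_norm M (\<lambda>q. g q + ?h q)"
    using k by (intro l2_norm_cong L2_scale kL L2_add gL ihL) auto
  then have "(l2_norm M (\<lambda>q. of_real (sqrt 2) * k q))\<^sup>2 = Re (l2_inner M (\<lambda>q. g q + ?h q) (\<lambda>q. g q + ?h q))"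
    by simp
  also have "l2_inner M (\<lambda>q. g q + ?h q) (\<lambda>q. g q + ?h q) =
      (l2_inner M g g + l2_inner M g ?h) + (l2_inner M ?h g + l2_inner M ?h ?h)"
    by (simp only: l2.add_left[OF gL ihL L2_add[OF gL ihL]] l2.add_right[OF gL gL ihL] l2.add_right[OF ihL gL ihL])
  also have "l2_inner M ?h g = cnj (l2_inner M g ?h)" by (rule l2.swap[OF gL ihL])
  also have "Re ((l2_inner M g g + l2_inner M g ?h) + (cnj (l2_inner M g ?h) + l2_inner M ?h ?h)) =
      (l2_norm M g)\<^sup>2 + 2 * Re (l2_inner M g ?h) + (l2_norm M ?h)\<^sup>2"
    by simp
  finally have "2 * (l2_norm M k)\<^sup>2 = (l2_norm M g)\<^sup>2 - (l2_norm M f)\<^sup>2 + (l2_norm M h)\<^sup>2"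
    unfolding weak_CCR[OF g h] l2_norm_scale[OF hL] l2_norm_scale[OF kL] by (simp add: power_mult_distrib)
  then show ?thesis using that[OF g h] by simp
qed

text \<open>The weak form of \<open>N f = g\<close>: the inner product of \<open>N f\<close> with
  \<open>f'\<close> is that of the annihilated vectors. Symmetry and positivity of the number
  operator both follow from it.\<close>

lemma number_operator_annihilation:
  assumes "number_operator {x} f g"
  obtains k where "annihilation {x} x f k"
    "\<And>f' k'. annihilation {x} x f' k' \<Longrightarrow> l2_inner M k k' = l2_inner M g f'"
proof -
  obtain h k where k: "annihilation {x} x f k" and adj: "adjoint_graph M (annihilation {x} x) k (h x)"
    and gh: "AE q in M. g q = h x q" and gL: "g \<in> L2 M"
    using assms by (auto simp: number_operator_def)
  have hL: "h x \<in> L2 M" using adj by (simp add: adjoint_graph_def)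
  have "l2_inner M k k' = l2_inner M g f'" if "annihilation {x} x f' k'" for f' k'
  proof -
    have f'L: "f' \<in> L2 M" using that by (auto simp: annihilation_def position_def)
    have "l2_inner M k k' = l2_inner M (h x) f'" using adj that by (auto simp: adjoint_graph_def)
    also have "\<dots> = l2_inner M g f'" using gh by (intro l2_inner_cong_left hL gL f'L) auto
    finally show ?thesis .
  qed
  then show ?thesis using that[OF k] by blast
qed

lemma annihilation_L2: "annihilation {x} x f k \<Longrightarrow> f \<in> L2 M \<and> k \<in> L2 M"
  by (auto simp: annihilation_def position_def)

lemma number_operator_L2: "number_operator {x} f g \<Longrightarrow> f \<in> L2 M \<and> g \<in> L2 M"
  by (simp add: number_operator_def)

lemma number_operator_sym:
  assumes "number_operator {x} f g" "number_operator {x} f' g'"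
  shows "l2_inner M f g' = l2_inner M g f'"
proof -
  obtain k where k: "annihilation {x} x f k" "\<And>f' k'. annihilation {x} x f' k' \<Longrightarrow> l2_inner M k k' = l2_inner M g f'"
    using number_operator_annihilation[OF assms(1)] by blast
  obtain k' where k': "annihilation {x} x f' k'" "\<And>f k. annihilation {x} x f k \<Longrightarrow> l2_inner M k' k = l2_inner M g' f"
    using number_operator_annihilation[OF assms(2)] by blast
  have "l2_inner M f g' = cnj (l2_inner M g' f)"
    using l2.swap[of g' M f] assms by (auto simp: number_operator_def)
  also have "\<dots> = cnj (l2_inner M k' k)" using k'(2)[OF k(1)] by simp
  also have "\<dots> = l2_inner M k k'"
    using l2.swap[of k' M k] annihilation_L2[OF k(1)] annihilation_L2[OF k'(1)] by simp
  also have "\<dots> = l2_inner M g f'" by (rule k(2)[OF k'(1)])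
  finally show ?thesis .
qed

lemma number_operator_form:
  assumes "number_operator {x} f g"
  obtains k where "annihilation {x} x f k" "Re (l2_inner M f g) = (l2_norm M k)\<^sup>2"
proof -
  obtain k where k: "annihilation {x} x f k" "\<And>f' k'. annihilation {x} x f' k' \<Longrightarrow> l2_inner M k k' = l2_inner M g f'"
    using number_operator_annihilation[OF assms(1)] by blast
  have "l2_inner M f g = l2_inner M g f" by (rule number_operator_sym[OF assms assms])
  also have "\<dots> = l2_inner M k k" using k(2)[OF k(1)] by simp
  finally show ?thesis using that[OF k(1)] by simp
qed

lemma schroedinger_W_eq:
  assumes "q \<in> space M"
  shows "schroedinger_W {x} \<xi> f q =
    exp (\<i> * of_real (val \<xi> x $ 2 * (q x + val \<xi> x $ 1 / 2))) * pullback (val \<xi> x $ 1) f q"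
  unfolding schroedinger_W_def pullback_def shift_restrict[OF assms] by simp

lemma schroedinger_W_L2:
  assumes f: "f \<in> L2 M"
  shows "schroedinger_W {x} \<xi> f \<in> L2 M"
proof (rule L2_bound[OF _ pullback_L2[OF f, of "val \<xi> x $ 1"], of _ 1])
  note [measurable] = L2_measurable[OF pullback_L2[OF f]]
  show "schroedinger_W {x} \<xi> f \<in> borel_measurable M"
    using pullback_L2[OF f, of "val \<xi> x $ 1"] by (subst measurable_cong[OF schroedinger_W_eq]) measurable
  show "AE q in M. cmod (schroedinger_W {x} \<xi> f q) \<le> 1 * cmod (pullback (val \<xi> x $ 1) f q)"
    by (rule AE_I2) (simp add: schroedinger_W_eq norm_mult)
qed

lemma schroedinger_W_norm:
  assumes f: "f \<in> L2 M"
  shows "l2_norm M (schroedinger_W {x} \<xi> f) = l2_norm M f"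
proof -
  have "l2_norm M (schroedinger_W {x} \<xi> f) = l2_norm M (pullback (val \<xi> x $ 1) f)"
    unfolding l2_norm_def by (intro arg_cong[of _ _ sqrt] Bochner_Integration.integral_cong refl)
      (simp add: schroedinger_W_eq norm_mult)
  then show ?thesis by (simp add: pullback_norm f)
qed

lemma schroedinger_W_sum:
  "schroedinger_W {x} \<xi> (\<lambda>q. \<Sum>e\<in>F. c e * e q) = (\<lambda>q. \<Sum>e\<in>F. c e * schroedinger_W {x} \<xi> e q)"
  by (simp add: schroedinger_W_def sum_distrib_left sum_distrib_right mult_ac)

text \<open>On an axis the Weyl operator is a pure phase or a pure translation, so its distance from
  1 is controlled by position alone or by momentum alone; \<open>annihilation_norm\<close> bounds
  both.\<close>

lemma schroedinger_W_small:
  assumes a: "annihilation {x} x f k" and axis: "val \<xi> x $ 1 = 0 \<or> val \<xi> x $ 2 = 0"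
  shows "(l2_norm M (\<lambda>q. schroedinger_W {x} \<xi> f q - f q))\<^sup>2
    \<le> ((val \<xi> x $ 1)\<^sup>2 + (val \<xi> x $ 2)\<^sup>2) * (2 * (l2_norm M k)\<^sup>2 + (l2_norm M f)\<^sup>2)"
proof -
  obtain g h where g: "position {x} x f g" and h: "momentum {x} x f h"
    and gh: "(l2_norm M g)\<^sup>2 + (l2_norm M h)\<^sup>2 = 2 * (l2_norm M k)\<^sup>2 + (l2_norm M f)\<^sup>2"
    using annihilation_norm[OF a] by blast
  have fL: "f \<in> L2 M" and gL: "g \<in> L2 M" and gq: "AE q in M. g q = of_real (q x) * f q"
    using g by (auto simp: position_def)
  let ?d = "\<lambda>q. schroedinger_W {x} \<xi> f q - f q"
  have dL: "?d \<in> L2 M" by (intro l2.V_diff schroedinger_W_L2 fL)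
  define u v where "u = val \<xi> x $ 1" and "v = val \<xi> x $ 2"
  show ?thesis
  proof (cases "u = 0")
    case True
    have "l2_norm M ?d \<le> l2_norm M (\<lambda>q. of_real v * g q)"
    proof (rule l2_norm_mono[OF dL L2_scale[OF gL]])
      have "AE q in M. q \<in> space M" by simp
      with gq show "AE q in M. cmod (?d q) \<le> cmod (of_real v * g q)"
      proof eventually_elim
        case (elim q)
        have "?d q = (exp (\<i> * of_real (v * q x)) - 1) * f q"
          using True by (simp add: schroedinger_W_eq[OF elim(2)] u_def v_def pullback_def algebra_simps)
        then have "cmod (?d q) \<le> \<bar>v * q x\<bar> * cmod (f q)"
          using cmod_exp_i_minus_one_le[of "v * q x"] by (simp add: norm_mult mult_right_mono)
        then show ?case using elim(1) by (simp add: norm_mult abs_mult mult_ac)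
      qed
    qed
    then have "(l2_norm M ?d)\<^sup>2 \<le> (\<bar>v\<bar> * l2_norm M g)\<^sup>2"
      unfolding l2_norm_scale[OF gL] by (intro power_mono) auto
    also have "\<dots> \<le> v\<^sup>2 * ((l2_norm M g)\<^sup>2 + (l2_norm M h)\<^sup>2)"
      by (simp add: power_mult_distrib mult_left_mono)
    finally show ?thesis unfolding gh using True by (simp add: u_def v_def)
  next
    case False
    then have v0: "v = 0" using axis by (auto simp: u_def v_def)
    have "l2_norm M ?d = l2_norm M (\<lambda>q. pullback u f q - f q)"
      using v0 unfolding l2_norm_def
      by (intro arg_cong[of _ _ sqrt] Bochner_Integration.integral_cong refl)
         (simp add: schroedinger_W_eq u_def v_def)
    also have "\<dots> \<le> \<bar>u\<bar> * l2_norm M h" by (rule pullback_norm_diff_le[OF h])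
    finally have "(l2_norm M ?d)\<^sup>2 \<le> (\<bar>u\<bar> * l2_norm M h)\<^sup>2" by (intro power_mono) auto
    also have "\<dots> \<le> u\<^sup>2 * ((l2_norm M g)\<^sup>2 + (l2_norm M h)\<^sup>2)"
      by (simp add: power_mult_distrib mult_left_mono)
    finally show ?thesis unfolding gh using v0 by (simp add: u_def v_def)
  qed
qed

end

lemma schroedinger_of_W: "schroedinger \<Gamma> (W \<xi>) f = schroedinger_W \<Gamma> \<xi> f"
proof -
  have "supp (weyl_coeffs (W \<xi>)) = {\<xi>}" by (simp add: W.rep_eq)
  then show ?thesis by (simp add: schroedinger_def coeff_at_W)
qed

lemma (in nonneg_spectral) form_le:
  assumes f: "f \<in> ran (below n)"
  shows "Re (ip f (Nf f)) \<le> real n * (l2_norm M f)\<^sup>2"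
proof -
  have fL: "f \<in> L2 M" using f by (rule ran_L2)
  interpret finite_measure "\<mu> f" by (rule finite_measure_\<mu>[OF fL])
  have "(LINT s|\<mu> f. s) \<le> (LINT s|\<mu> f. real n)"
  proof (rule integral_mono_AE)
    show "integrable (\<mu> f) (\<lambda>s. s)" by (rule integrable_bounded_\<mu>(1)[of "below n" 0 "real n"]) (use f in auto)
    show "AE s in \<mu> f. s \<le> real n" using AE_\<mu>[OF below_borel f] by eventually_elim simp
  qed simp
  then show ?thesis
    using form_eq_integral[OF domain_below[OF f]] measure_\<mu>[OF fL, of UNIV] by (simp add: E_UNIV fL mult.commute)
qed

text \<open>The bound is uniform in the site because all singletons have cardinality 1 and hence the
  same energy bound. The cutoff \<open>m\<close> stays free: raising it shrinks the tail at the
  expense of the first term.\<close>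

theorem local_Weyl_estimate:
  fixes \<omega> :: "'d::finite weyl \<Rightarrow> complex"
  assumes "finite_particle_density \<omega>"
  obtains \<nu> where "\<And>x \<eta> m. supp \<eta> \<subseteq> {x} \<Longrightarrow> val \<eta> x $ 1 = 0 \<or> val \<eta> x $ 2 = 0 \<Longrightarrow> m > 0 \<Longrightarrow>
    cmod (\<omega> (W \<eta>) - 1) \<le>
      sqrt (((val \<eta> x $ 1)\<^sup>2 + (val \<eta> x $ 2)\<^sup>2) * (2 * real m + 1)) + 2 * sqrt ((\<nu> + 2) / real m)"
proof -
  obtain \<nu> where \<nu>: "\<And>\<Gamma>. finite \<Gamma> \<Longrightarrow> \<exists>\<rho> m. local_density \<omega> \<Gamma> \<rho> \<and> has_particle_number \<Gamma> \<rho> m \<and> m \<le> ereal (\<nu> * real (card \<Gamma>))"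
    using assms by (auto simp: finite_particle_density_def)
  have "cmod (\<omega> (W \<eta>) - 1) \<le>
      sqrt (((val \<eta> x $ 1)\<^sup>2 + (val \<eta> x $ 2)\<^sup>2) * (2 * real m + 1)) + 2 * sqrt ((\<nu> + 2) / real m)"
    if \<eta>: "supp \<eta> \<subseteq> {x}" "val \<eta> x $ 1 = 0 \<or> val \<eta> x $ 2 = 0" and m: "m > 0" for x \<eta> m
  proof -
    interpret site x .
    obtain \<rho> N0 where \<rho>: "local_density \<omega> {x} \<rho>" and N0: "has_particle_number {x} \<rho> N0" "N0 \<le> ereal \<nu>"
      using \<nu>[of "{x}"] by auto
    obtain E \<tau> where E: "spectral_measure_of M (number_operator {x}) E"
      and tr: "\<And>n::nat. has_trace M (\<lambda>f. op_app (number_operator {x}) (E {0..real n} (\<rho> f))) (of_real (\<tau> n))"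
      and N0': "N0 = (SUP n. ereal (\<tau> n))"
      using N0(1) by (auto simp: has_particle_number_def)
    have \<tau>: "\<tau> n \<le> \<nu>" for n
    proof -
      have "ereal (\<tau> n) \<le> N0" unfolding N0' by (rule SUP_upper) simp
      then show ?thesis using N0(2) by (metis ereal_less_eq(3) order_trans)
    qed
    interpret nonneg_spectral M "number_operator {x}" E
    proof
      show "spectral_measure_of M (number_operator {x}) E" by fact
      show "f \<in> L2 M \<and> g \<in> L2 M" if "number_operator {x} f g" for f g using that by (rule number_operator_L2)
      show "l2_inner M f g' = l2_inner M g f'" if "number_operator {x} f g" "number_operator {x} f' g'" for f g f' g'
        using that by (rule number_operator_sym)
      show "0 \<le> Re (l2_inner M f g)" if "number_operator {x} f g" for f g
        using number_operator_form[OF that] by (metis zero_le_power2)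
    qed
    define \<delta> where "\<delta> = ((val \<eta> x $ 1)\<^sup>2 + (val \<eta> x $ 2)\<^sup>2) * (2 * real m + 1)"
    have \<delta>: "\<delta> \<ge> 0" by (simp add: \<delta>_def)
    have "cmod (\<omega> (W \<eta>) - 1) \<le> sqrt \<delta> + 2 * sqrt ((\<nu> + 2) / real m)"
    proof (rule trace_isometry_minus_one_le[where U = "schroedinger_W {x} \<eta>", OF _ tr \<tau> schroedinger_W_L2 schroedinger_W_norm schroedinger_W_sum m])
      show "density_operator M \<rho>" using \<rho> by (simp add: local_density_def)
      show "0 \<le> sqrt \<delta>" using \<delta> by simp
      show "has_trace M (\<lambda>f. \<rho> (schroedinger_W {x} \<eta> f)) (\<omega> (W \<eta>))"
      proof -
        have "W \<eta> \<in> local_algebra {x}" unfolding local_algebra_def using \<eta>(1) by (intro weyl.span_base) auto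
        then have "has_trace M (\<lambda>f. \<rho> (schroedinger {x} (W \<eta>) f)) (\<omega> (W \<eta>))" using \<rho> by (auto simp: local_density_def)
        then show ?thesis by (simp only: schroedinger_of_W)
      qed
      fix f assume f: "f \<in> ran (below m)"
      obtain k where k: "annihilation {x} x f k" "Re (l2_inner M f (Nf f)) = (l2_norm M k)\<^sup>2"
        using number_operator_form[OF domain_below[OF f]] by blast
      have "(l2_norm M (\<lambda>q. schroedinger_W {x} \<eta> f q - f q))\<^sup>2
          \<le> ((val \<eta> x $ 1)\<^sup>2 + (val \<eta> x $ 2)\<^sup>2) * (2 * (l2_norm M k)\<^sup>2 + (l2_norm M f)\<^sup>2)"
        by (rule schroedinger_W_small[OF k(1) \<eta>(2)])
      also have "\<dots> \<le> ((val \<eta> x $ 1)\<^sup>2 + (val \<eta> x $ 2)\<^sup>2) * ((2 * real m + 1) * (l2_norm M f)\<^sup>2)"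
        using form_le[OF f] k(2) by (intro mult_left_mono) (auto simp: algebra_simps)
      also have "\<dots> = (sqrt \<delta> * l2_norm M f)\<^sup>2" using \<delta> by (simp add: power_mult_distrib) (simp add: \<delta>_def)
      finally show "l2_norm M (\<lambda>q. schroedinger_W {x} \<eta> f q - f q) \<le> sqrt \<delta> * l2_norm M f"
        by (rule power2_le_imp_le) (use \<delta> in simp)
    qed
    then show ?thesis by (simp add: \<delta>_def)
  qed
  then show ?thesis using that by blast
qed

section \<open>Convergence\<close>

lemma sympl_single: "sympl \<xi> (Poly_Mapping.single x v) = val \<xi> x $ 1 * v $ 2 - v $ 1 * val \<xi> x $ 2"
proof -
  let ?\<eta> = "Poly_Mapping.single x v"
  have "sympl \<xi> ?\<eta> = (\<Sum>y\<in>insert x (supp \<xi>). val \<xi> y $ 1 * val ?\<eta> y $ 2 - val ?\<eta> y $ 1 * val \<xi> y $ 2)"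
    by (rule sympl_superset) auto
  also have "\<dots> = (\<Sum>y\<in>insert x (supp \<xi>). if y = x then val \<xi> x $ 1 * v $ 2 - v $ 1 * val \<xi> x $ 2 else 0)"
    by (intro sum.cong) (auto simp: lookup_single when_def)
  finally have "sympl \<xi> ?\<eta> = (\<Sum>y\<in>insert x (supp \<xi>). if y = x then val \<xi> x $ 1 * v $ 2 - v $ 1 * val \<xi> x $ 2 else 0)" .
  then show ?thesis by simp
qed

lemma tendsto_W_iterates:
  fixes \<alpha> :: "'d::finite weyl \<Rightarrow> 'd weyl"
  assumes \<alpha>: "gaussian_qca \<alpha> \<Phi>" and reg: "regular \<Phi>" and hyp: "locally_hyperbolic \<Phi>"
    and \<omega>: "state \<omega>" and fpd: "finite_particle_density \<omega>" and \<xi>: "\<xi> \<noteq> 0"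
  shows "(\<lambda>k. \<omega> ((\<alpha> ^^ k) (W \<xi>))) \<longlonglongrightarrow> 0"
proof (rule tendstoI)
  fix \<epsilon> :: real assume \<epsilon>: "\<epsilon> > 0"
  have \<Phi>: "phase_space_map \<Phi>" using \<alpha> by (simp add: gaussian_qca_def)
  obtain \<nu> where \<nu>: "\<And>x \<eta> m. supp \<eta> \<subseteq> {x} \<Longrightarrow> val \<eta> x $ 1 = 0 \<or> val \<eta> x $ 2 = 0 \<Longrightarrow> m > 0 \<Longrightarrow>
    cmod (\<omega> (W \<eta>) - 1) \<le>
      sqrt (((val \<eta> x $ 1)\<^sup>2 + (val \<eta> x $ 2)\<^sup>2) * (2 * real m + 1)) + 2 * sqrt ((\<nu> + 2) / real m)"
    using local_Weyl_estimate[OF fpd] by blast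
  have lim: "(\<lambda>m. 2 * sqrt ((\<nu> + 2) / real (Suc m))) \<longlonglongrightarrow> 2 * sqrt 0"
    by (intro tendsto_intros LIMSEQ_Suc[OF lim_const_over_n])
  have "\<forall>\<^sub>F m in sequentially. 2 * sqrt ((\<nu> + 2) / real (Suc m)) < \<epsilon>\<^sup>2 / 4"
    by (rule order_tendstoD(2)[OF lim]) (use \<epsilon> in simp)
  then obtain m0 where m0: "2 * sqrt ((\<nu> + 2) / real (Suc m0)) < \<epsilon>\<^sup>2 / 4"
    by (auto simp: eventually_sequentially)
  define m where "m = Suc m0"
  \<comment> \<open>\<open>C\<close> makes the first error term at most
    \<open>\<epsilon>^2 / 8\<close>. With the tail below \<open>\<epsilon>^2 / 4\<close> the sum is
    below \<open>\<epsilon>^2 / 2\<close>, and \<open>state_W_le\<close> doubles it.\<close>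
  define C where "C = 8 * pi * sqrt (2 * real m + 1) / \<epsilon>\<^sup>2"
  have C: "C > 0" using \<epsilon> by (simp add: C_def m_def)
  have small: "cmod (\<omega> (W \<zeta>)) < \<epsilon>" if r: "\<bar>val \<zeta> x $ i\<bar> \<ge> C" for \<zeta> x i
  proof -
    define r where "r = val \<zeta> x $ i"
    have r0: "r \<noteq> 0" "\<bar>r\<bar> \<ge> C" using r C by (auto simp: r_def)
    \<comment> \<open>Only the coordinate conjugate to \<open>i\<close> is used: the symplectic
      product is then \<open>pi\<close>, and \<open>\<eta>\<close> lies on an axis as
      \<open>local_Weyl_estimate\<close> demands.\<close>
    define \<eta> where "\<eta> = Poly_Mapping.single x (if i = 1 then axis 2 (pi / r) else axis 1 (- pi / r) :: real^2)"
    have pi: "sympl \<zeta> \<eta> = pi"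
      using r0 exhaust_2[of i] by (auto simp: \<eta>_def sympl_single r_def axis_def)
    have "(pi / r)\<^sup>2 \<le> (pi / C)\<^sup>2"
      using r0 C by (simp add: power_divide frac_le abs_le_square_iff[symmetric])
    then have "sqrt ((pi / r)\<^sup>2 * (2 * real m + 1)) \<le> sqrt ((pi / C)\<^sup>2 * (2 * real m + 1))"
      by (intro real_sqrt_le_mono mult_right_mono) auto
    also have "\<dots> = pi / C * sqrt (2 * real m + 1)" using C by (simp add: real_sqrt_mult)
    also have "\<dots> = \<epsilon>\<^sup>2 / 8" using \<epsilon> by (simp add: C_def field_simps)
    finally have small: "sqrt ((pi / r)\<^sup>2 * (2 * real m + 1)) \<le> \<epsilon>\<^sup>2 / 8" .
    have "cmod (\<omega> (W \<eta>) - 1) \<le> sqrt ((pi / r)\<^sup>2 * (2 * real m + 1)) + 2 * sqrt ((\<nu> + 2) / real m)"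
      using \<nu>[of \<eta> x m] by (auto simp: \<eta>_def axis_def m_def split: if_splits)
    then have "cmod (\<omega> (W \<eta>) - 1) < \<epsilon>\<^sup>2 / 8 + \<epsilon>\<^sup>2 / 4" using small m0 by (simp add: m_def)
    also have "\<dots> < \<epsilon>\<^sup>2 / 2" using \<epsilon> by simp
    finally have "cmod (\<omega> (W \<eta>) - 1) < \<epsilon>\<^sup>2 / 2" .
    then have "(cmod (\<omega> (W \<zeta>)))\<^sup>2 < \<epsilon>\<^sup>2" using state_W_le[OF \<omega> pi] by simp
    then show ?thesis using \<epsilon> by (simp add: power_less_imp_less_base)
  qed
  have "\<forall>\<^sub>F k in sequentially. \<exists>x i. \<bar>val ((\<Phi> ^^ k) \<xi>) x $ i\<bar> \<ge> C"
    by (rule phase_space_iterates_unbounded[OF \<Phi> gaussian_qca_sympl[OF \<alpha>] reg hyp \<xi>])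
  then show "\<forall>\<^sub>F k in sequentially. dist (\<omega> ((\<alpha> ^^ k) (W \<xi>))) 0 < \<epsilon>"
  proof (rule eventually_mono)
    fix k assume "\<exists>x i. \<bar>val ((\<Phi> ^^ k) \<xi>) x $ i\<bar> \<ge> C"
    then have "cmod (\<omega> (W ((\<Phi> ^^ k) \<xi>))) < \<epsilon>" using small by blast
    moreover obtain c where "cmod c = 1" "(\<alpha> ^^ k) (W \<xi>) = c *\<^sub>C W ((\<Phi> ^^ k) \<xi>)"
      using gaussian_qca_iterate[OF \<alpha>] by blast
    ultimately show "dist (\<omega> ((\<alpha> ^^ k) (W \<xi>))) 0 < \<epsilon>"
      by (simp add: state_linear[OF \<omega>] norm_mult)
  qed
qed

lemma weyl_functional_expansion:
  fixes f :: "'d::finite weyl \<Rightarrow> complex"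
  assumes add: "\<And>a b. f (a + b) = f a + f b" and scale: "\<And>c a. f (c *\<^sub>C a) = c * f a"
  shows "f a = (\<Sum>\<xi>\<in>supp (weyl_coeffs a). coeff_at a \<xi> * f (W \<xi>))"
proof -
  have zero: "f 0 = 0" using add[of 0 0] by simp
  have sum: "f (\<Sum>i\<in>I. g i) = (\<Sum>i\<in>I. f (g i))" for I :: "'d phase set" and g
    by (induction I rule: infinite_finite_induct) (simp_all add: add zero)
  have "f a = f (\<Sum>\<xi>\<in>supp (weyl_coeffs a). coeff_at a \<xi> *\<^sub>C W \<xi>)" by (subst weyl_expansion) simp
  then show ?thesis by (simp add: sum scale)
qed

theorem theorem1p2:
  fixes \<alpha> :: "'d::finite weyl \<Rightarrow> 'd weyl"
    and \<Phi> :: "'d phase \<Rightarrow> 'd phase"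
    and \<omega> :: "'d weyl \<Rightarrow> complex"
  assumes "gaussian_qca \<alpha> \<Phi>"
    and "regular \<Phi>"
    and "locally_hyperbolic \<Phi>"
    and "state \<omega>"
    and "locally_normal \<omega>"
    and "finite_particle_density \<omega>"
  shows "(\<forall>\<xi>. \<xi> \<noteq> 0 \<longrightarrow> (\<lambda>k. \<omega> ((\<alpha> ^^ k) (W \<xi>))) \<longlonglongrightarrow> 0) \<and>
         (\<forall>a. (\<lambda>k. \<omega> ((\<alpha> ^^ k) a)) \<longlonglongrightarrow> coeff_at a 0 \<and> coeff_at a 0 = omega_infty a)"
proof -
  have W: "(\<lambda>k. \<omega> ((\<alpha> ^^ k) (W \<xi>))) \<longlonglongrightarrow> 0" if "\<xi> \<noteq> 0" for \<xi>
    by (rule tendsto_W_iterates[OF assms(1-4,6) that])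
  have aut: "star_automorphism \<alpha>" using assms(1) by (simp add: gaussian_qca_def)
  then have \<alpha>: "\<alpha> (a + b) = \<alpha> a + \<alpha> b" "\<alpha> (c *\<^sub>C a) = c *\<^sub>C \<alpha> a" "\<alpha> 1 = 1" for a b c
    unfolding star_automorphism_def by (metis Vector_Spaces.linear_iff)+
  have \<alpha>k: "(\<alpha> ^^ k) (a + b) = (\<alpha> ^^ k) a + (\<alpha> ^^ k) b" "(\<alpha> ^^ k) (c *\<^sub>C a) = c *\<^sub>C (\<alpha> ^^ k) a" "(\<alpha> ^^ k) 1 = 1" for k a b c
    by (induction k) (simp_all add: \<alpha>)
  have "(\<lambda>k. \<omega> ((\<alpha> ^^ k) a)) \<longlonglongrightarrow> coeff_at a 0" for a
  proof -
    \<comment> \<open>\<open>W 0\<close> is the unit, which every iterate fixes; this is the term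
      that survives in the limit.\<close>
    have "(\<lambda>k. \<omega> ((\<alpha> ^^ k) (W \<xi>))) \<longlonglongrightarrow> (if \<xi> = 0 then 1 else 0)" for \<xi>
      using W[of \<xi>] assms(4) by (auto simp: W_zero \<alpha>k state_def)
    then have "(\<lambda>k. \<Sum>\<xi>\<in>supp (weyl_coeffs a). coeff_at a \<xi> * \<omega> ((\<alpha> ^^ k) (W \<xi>)))
        \<longlonglongrightarrow> (\<Sum>\<xi>\<in>supp (weyl_coeffs a). coeff_at a \<xi> * (if \<xi> = 0 then 1 else 0))"
      by (intro tendsto_intros)
    moreover have "\<omega> ((\<alpha> ^^ k) a) = (\<Sum>\<xi>\<in>supp (weyl_coeffs a). coeff_at a \<xi> * \<omega> ((\<alpha> ^^ k) (W \<xi>)))" for k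
      by (rule weyl_functional_expansion) (simp_all add: \<alpha>k state_linear[OF assms(4)])
    moreover have "(\<Sum>\<xi>\<in>supp (weyl_coeffs a). coeff_at a \<xi> * (if \<xi> = 0 then 1 else 0)) = coeff_at a 0"
      by (simp add: in_keys_iff if_distrib[of "(*) _"] cong: if_cong)
    ultimately show ?thesis by simp
  qed
  then show ?thesis using W by (simp add: omega_infty_eq)
qed

end
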